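(* A function $\psi(n,z)$ is a polynomial discrete Darboux transform of $(1+z)^n$ if and only if $$\psi(n,z)=\frac{\theta_1(z)}{\theta_2(z)}\,\psi_{(\tilde X,\tilde Z)}(n,z),$$ where: - $\theta_1,\theta_2$ are monic polynomials of the same degree; - $(\tilde X,\tilde Z)$ is a pair of $N\times N$ complex matrices (for some $N\ge0$) with $\mathrm{rank}([\tilde X,\tilde Z]+I)=1$ and $\det(I+\tilde Z)\ne0$; - $\psi_{(\tilde X,\tilde Z)}$ is given by $$\psi_{(\tilde X,\tilde Z)}(n,z)=(1+z)^n\,\frac{\det\big(\tilde X-n(I+\tilde Z)^{-1}+(zI-\tilde Z)^{-1}\big)}{\det\big(\tilde X-n(I+\tilde Z)^{-1}\big)}.$$
   Context: Difference operators: $T$ acts on functions of $n$ by $T\phi(n)=\phi(n+1)$, and $\Delta=T-I$. A difference operator in $\Delta$ is a finite sum $\sum_{k\ge0}a_k(n)\Delta^k$; it is monic if its leading coefficient is $1$, and its order is the highest power of $\Delta$. Discrete Darboux transform: a function $\psi(n,z)$ is a discrete Darboux transform of $(1+z)^n$ if there exist monic difference operators $R(n,\Delta),S(n,\Delta)$ and monic polynomials $\theta,\nu$, with the order of $R$ equal to $\deg\theta$, such that $$\psi(n,z)=\frac1{\theta(1+z)}R(n,\Delta)(1+z)^n\quad\text{and}\quad(1+z)^n=\frac1{\nu(1+z)}S(n,\Delta)\psi(n,z).$$ Polynomial: such a transform is called polynomial if the coefficients of $R$ and $S$ are rational functions of $n$. The function $\psi_{(\tilde X,\tilde Z)}$ is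 the stationary wave function of the discrete KP hierarchy associated with the tau-function $\det\{\tilde X-\sum_k kt_k\tilde Z^{k-1}-n(I+\tilde Z)^{-1}\}$.
   Formalization: For N = 0 the condition rank([X,Z]+I)=1 is dropped: a 0×0 matrix has rank 0, and without the empty pair the transform ψ=(1+z)^n itself would have no representation; the rank condition is imposed for all N ≥ 1. *)

theory Defs
  imports "HOL-Computational_Algebra.Polynomial_Factorial"
          "HOL-Computational_Algebra.Field_as_Ring"
          "HOL-Computational_Algebra.Normalized_Fraction"
          "Jordan_Normal_Form.Determinant"
          "Jordan_Normal_Form.Gauss_Jordan_Elimination"
          "Jordan_Normal_Form.DL_Rank"
begin

text \<open>
  Algebraic model. The discrete variable n and the spectral variable z are
  independent indeterminates. The field of rational functions in (n, z) is
  F = Frac(C[n][z]) = complex poly poly fract; the outer poly variable is z,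
  its coefficients are polynomials in n. The field of rational functions of n
  alone (the coefficient field of polynomial difference operators) is
  K = complex poly fract.

  A function psi(n,z) = (1+z)^n * f(n,z) with f in F is represented by f.
  (Every polynomial discrete Darboux transform of (1+z)^n and every function on
  the right-hand side of the theorem is of this form.)
\<close>

type_synonym ratF = "complex poly poly fract"
type_synonym ratK = "complex poly fract"

definition cF :: "complex \<Rightarrow> ratF" where
  "cF c = Fract [:[:c:]:] 1"

definition zF :: ratF where
  "zF = Fract [:0, 1:] 1"

definition nF :: ratF where
  "nF = Fract [:[:0, 1:]:] 1"

definition embK :: "ratK \<Rightarrow> ratF" where
  "embK a = Fract [:fst (quot_of_fract a):] [:snd (quot_of_fract a):]"

definition shpoly :: "complex poly poly \<Rightarrow> complex poly poly" where
  "shpoly p = map_poly (\<lambda>q. pcompose q [:1, 1:]) p"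

definition shiftF :: "ratF \<Rightarrow> ratF" where
  "shiftF x = Fract (shpoly (fst (quot_of_fract x))) (shpoly (snd (quot_of_fract x)))"

text \<open>T and Delta = T - I acting on psi = (1+z)^n f, written on the representative f:
  T((1+z)^n f(n,z)) = (1+z)^n (1+z) f(n+1,z).\<close>
definition T_op :: "ratF \<Rightarrow> ratF" where
  "T_op f = (1 + zF) * shiftF f"

definition Delta_op :: "ratF \<Rightarrow> ratF" where
  "Delta_op f = T_op f - f"

text \<open>A difference operator sum_k a_k(n) Delta^k with coefficients a_k rational in n
  is represented by the polynomial sum_k a_k X^k in ratK poly
  (order = degree, monic = leading coefficient 1).\<close>
definition apply_op :: "ratK poly \<Rightarrow> ratF \<Rightarrow> ratF" where
  "apply_op R f = (\<Sum>k\<le>degree R. embK (coeff R k) * (Delta_op ^^ k) f)"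

definition evalF :: "complex poly \<Rightarrow> ratF \<Rightarrow> ratF" where
  "evalF p x = poly (map_poly cF p) x"

text \<open>Polynomial discrete Darboux transform of (1+z)^n; (1+z)^n is represented by 1.\<close>
definition poly_DDT :: "ratF \<Rightarrow> bool" where
  "poly_DDT f \<longleftrightarrow>
     (\<exists>(R :: ratK poly) (S :: ratK poly) (\<theta> :: complex poly) (\<nu> :: complex poly).
        lead_coeff R = 1 \<and> lead_coeff S = 1 \<and> lead_coeff \<theta> = 1 \<and> lead_coeff \<nu> = 1 \<and>
        degree R = degree \<theta> \<and>
        f = apply_op R 1 / evalF \<theta> (1 + zF) \<and>
        1 = apply_op S f / evalF \<nu> (1 + zF))"

definition minv :: "ratF mat \<Rightarrow> ratF mat" where
  "minv A = the (mat_inverse A)"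

text \<open>psi_(X,Z)(n,z) = (1+z)^n * det(X - n(I+Z)^{-1} + (zI - Z)^{-1}) / det(X - n(I+Z)^{-1});
  psi_rep X Z is the factor after (1+z)^n.\<close>
definition psi_rep :: "complex mat \<Rightarrow> complex mat \<Rightarrow> ratF" where
  "psi_rep X Z =
    (let N = dim_row X;
         XF = map_mat cF X; ZF = map_mat cF Z;
         A = XF - nF \<cdot>\<^sub>m minv (1\<^sub>m N + ZF)
     in det (A + minv (zF \<cdot>\<^sub>m 1\<^sub>m N - ZF)) / det A)"

end

theory Submission
  imports Defs "Jordan_Normal_Form.Char_Poly"
begin

text \<open>
  Put \<open>w = 1 + z\<close>, \<open>B = I + Z\<close>, \<open>A(n) = X - n B\<^sup>-\<^sup>1\<close> and write \<open>[X, Z] + I = u v\<close>.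
  The matrix determinant lemma turns the quotient of determinants into
  \<open>f = 1 + v (w - B)\<^sup>-\<^sup>1 A(n)\<^sup>-\<^sup>1 u\<close>.

  From a pair to a transform: \<open>A(n) B - B A(n+1) = u v\<close>, so products of \<open>T\<^sup>j f\<close> with the
  coefficients of the dual function \<open>1 - v A(n+1)\<^sup>-\<^sup>1 (w - B)\<^sup>-\<^sup>1 u\<close> telescope, and the operator
  built from the latter sends \<open>f\<close> to the characteristic polynomial \<open>\<chi>(w)\<close> of \<open>B\<close>.

  From a transform to a pair: operators act on \<open>K[w]\<close>, \<open>K = \<complex>(n)\<close>, and the hypothesis says that the
  left module \<open>J\<close> generated by the polynomial \<open>R\<close> contains some \<open>q(w)\<close> free of \<open>n\<close>. A power of
  \<open>w\<close> can be split off so that \<open>R(n, 0) \<noteq> 0\<close>, and a Gauss lemma for the valuation at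
  \<open>n = \<infinity>\<close> gives a limit \<open>R \<rightarrow> \<theta>(w)\<close>. Let \<open>V\<close> consist of the \<open>g \<in> K[w]\<close> of degree less
  than that of \<open>R\<close>, vanishing at \<open>n = \<infinity>\<close> and congruent modulo \<open>J\<close> to an element of
  \<open>\<complex>[n][w]\<close>. It has finite dimension because \<open>q \<in> J\<close>. Applying \<open>T\<close> modulo \<open>R\<close> and multiplying by \<open>n\<close>
  modulo \<open>\<complex>[w]\<close> give endomorphisms \<open>B\<close> and \<open>\<Xi>\<close> of \<open>V\<close>; then \<open>Z = B - I\<close>, \<open>X = \<Xi> B\<^sup>-\<^sup>1\<close> is
  the required pair, with \<open>u\<close> given by \<open>R - \<theta> \<in> V\<close>.
\<close>


section \<open>Extending homomorphisms to fraction fields\<close>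

lemma Fract_quot_of_fract': "Fract (fst (quot_of_fract x)) (snd (quot_of_fract x)) = x"
  using quot_to_fract_quot_of_fract[of x] by (simp add: quot_to_fract_def case_prod_unfold)

text \<open>Written through the normalised representative so that \<open>embK\<close> and
  \<open>shiftF\<close> are instances of it by unfolding alone.\<close>

definition fract_map :: "('a::{ring_gcd,idom_divide,semiring_gcd_mult_normalize} \<Rightarrow> 'b::idom) \<Rightarrow> 'a fract \<Rightarrow> 'b fract" where
  "fract_map h x = Fract (h (fst (quot_of_fract x))) (h (snd (quot_of_fract x)))"

lemma fract_cases:
  obtains a b where "x = Fract a b" "b \<noteq> 0"
  by (cases x) auto

locale fract_hom = inj_idom_hom hom
  for hom :: "'a::{ring_gcd,idom_divide,semiring_gcd_mult_normalize} \<Rightarrow> 'b::idom"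
begin

text \<open>Equality of fractions is a cross-multiplied identity, which a homomorphism preserves;
  injectivity keeps the denominators nonzero. Hence any representative may replace the normalised
  one.\<close>

lemma fract_map_Fract:
  assumes "b \<noteq> 0" shows "fract_map hom (Fract a b) = Fract (hom a) (hom b)"
proof -
  define c d where "c = fst (quot_of_fract (Fract a b))" "d = snd (quot_of_fract (Fract a b))"
  have "Fract c d = Fract a b" "d \<noteq> 0"
    unfolding c_d_def by (simp_all add: Fract_quot_of_fract')
  then have "c * b = a * d" using assms by (simp add: eq_fract)
  then have "hom c * hom b = hom a * hom d" by (simp flip: hom_mult)
  then show ?thesis using assms \<open>d \<noteq> 0\<close>
    unfolding fract_map_def c_d_def[symmetric] by (simp add: eq_fract)
qed

lemma fract_map_to_fract [simp]: "fract_map hom (to_fract a) = to_fract (hom a)"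
  by (simp add: to_fract_def fract_map_Fract)


lemma field_hom_fract_map: "field_hom (fract_map hom)"
proof
  fix x y :: "'a fract"
  obtain a b where x: "x = Fract a b" "b \<noteq> 0" by (rule fract_cases)
  obtain c d where y: "y = Fract c d" "d \<noteq> 0" by (rule fract_cases)
  show "fract_map hom (x * y) = fract_map hom x * fract_map hom y"
    using x y by (simp add: fract_map_Fract hom_distribs)
  show "fract_map hom (x + y) = fract_map hom x + fract_map hom y"
    using x y by (simp add: fract_map_Fract hom_distribs)
next
  show "fract_map hom 0 = 0" using fract_map_to_fract[of 0] by simp
  show "fract_map hom 1 = 1" using fract_map_to_fract[of 1] by simp
qed

end

section \<open>Constants, indeterminates and the shift in \<open>ratK\<close> and
  \<open>ratF\<close>\<close>

definition cK :: "complex \<Rightarrow> ratK" where "cK c = to_fract [:c:]"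

definition nK :: ratK where "nK = to_fract [:0, 1:]"

definition sigK :: "ratK \<Rightarrow> ratK" where "sigK = fract_map (\<lambda>q. pcompose q [:1, 1:])"

interpretation shift_hom: fract_hom "\<lambda>q::complex poly. pcompose q [:1, 1:]"
  by unfold_locales (simp_all add: pcompose_add pcompose_mult pcompose_1 pcompose_eq_0)

interpretation const_hom: fract_hom "\<lambda>q::complex poly. [:q:]"
  by unfold_locales (simp_all add: one_pCons)

interpretation shpoly_hom: fract_hom shpoly
proof -
  interpret map_poly_inj_idom_hom "\<lambda>q::complex poly. pcompose q [:1, 1:]" ..
  show "fract_hom shpoly" unfolding shpoly_def[abs_def] ..
qed

interpretation cK_hom: inj_idom_hom cK
  by unfold_locales (simp_all add: cK_def one_pCons[symmetric] flip: to_fract_add to_fract_mult)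

interpretation cF_hom: inj_idom_hom cF
  unfolding cF_def[abs_def] to_fract_def[symmetric]
  by unfold_locales (simp_all add: one_pCons[symmetric] flip: to_fract_add to_fract_mult)

interpretation cK_hom: field_hom cK ..
interpretation cF_hom: field_hom cF ..

interpretation sigK_hom: field_hom sigK
  unfolding sigK_def by (rule shift_hom.field_hom_fract_map)

lemma embK_conv: "embK = fract_map (\<lambda>q. [:q:])"
  by (rule ext) (simp add: embK_def fract_map_def)

interpretation embK_hom: field_hom embK
  unfolding embK_conv by (rule const_hom.field_hom_fract_map)

lemma shiftF_conv: "shiftF = fract_map shpoly"
  by (rule ext) (simp add: shiftF_def fract_map_def)

interpretation shiftF_hom: field_hom shiftF
  unfolding shiftF_conv by (rule shpoly_hom.field_hom_fract_map)

lemma embK_cK [simp]: "embK (cK c) = cF c"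
  by (simp add: embK_conv cK_def cF_def const_hom.fract_map_to_fract flip: to_fract_def)

lemma embK_nK [simp]: "embK nK = nF"
  by (simp add: embK_conv nK_def nF_def const_hom.fract_map_to_fract flip: to_fract_def)

lemma sigK_cK [simp]: "sigK (cK c) = cK c"
  by (simp add: sigK_def cK_def shift_hom.fract_map_to_fract)

lemma sigK_nK [simp]: "sigK nK = nK + 1"
  by (simp add: sigK_def nK_def shift_hom.fract_map_to_fract pcompose_pCons one_pCons 
    flip: to_fract_add to_fract_1)

lemma shpoly_const: "shpoly [:a:] = [:pcompose a [:1, 1:]:]"
  by (cases "a = 0") (simp_all add: shpoly_def map_poly_pCons)

lemma shiftF_embK [simp]: "shiftF (embK x) = embK (sigK x)"
proof -
  obtain a b where x: "x = Fract a b" "b \<noteq> 0" by (rule fract_cases)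
  then show ?thesis
    by (simp add: shiftF_conv embK_conv sigK_def const_hom.fract_map_Fract 
       shift_hom.fract_map_Fract shpoly_hom.fract_map_Fract shpoly_const)
qed

lemma shiftF_cF [simp]: "shiftF (cF c) = cF c"
  using shiftF_embK[of "cK c"] by simp

text \<open>In terms of w, \<open>T\<close> is the shift of n followed by multiplication by
  w.\<close>

definition wF :: ratF where "wF = 1 + zF"

lemma shiftF_zF [simp]: "shiftF zF = zF"
  by (simp add: shiftF_conv zF_def shpoly_hom.fract_map_to_fract flip: to_fract_def)
    (simp add: shpoly_def map_poly_pCons)

lemma shiftF_wF [simp]: "shiftF wF = wF"
  by (simp add: wF_def shiftF_hom.hom_add)

lemma T_op_def': "T_op f = wF * shiftF f"
  by (simp add: T_op_def wF_def)


section \<open>Difference operators\<close>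

text \<open>The operator \<open>D\<close> is a parameter so that one coefficient polynomial can be
  read as an operator in Delta or in \<open>T\<close>.\<close>

definition lop :: "(ratF \<Rightarrow> ratF) \<Rightarrow> ratK poly \<Rightarrow> ratF \<Rightarrow> ratF" where
  "lop D S f = (\<Sum>k\<le>degree S. embK (coeff S k) * (D ^^ k) f)"

lemma lop_bound: "degree S \<le> M \<Longrightarrow> lop D S f = (\<Sum>k\<le>M. embK (coeff S k) * (D ^^ k) f)"
  unfolding lop_def by (rule sum.mono_neutral_left) (auto simp: coeff_eq_0)

lemma lop_0 [simp]: "lop D 0 f = 0"
  by (simp add: lop_def)

lemma lop_add: "lop D (S + S') f = lop D S f + lop D S' f"
proof -
  let ?M = "max (degree S) (degree S')"
  show ?thesis
    by (subst (1 2 3) lop_bound[where M = ?M])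
      (auto simp: degree_add_le hom_distribs algebra_simps sum.distrib embK_hom.hom_add)
qed

lemma lop_pCons: "lop D (pCons a S) f = embK a * f + lop D S (D f)"
  by (subst lop_bound[where M = "Suc (degree S)"])
     (auto simp: degree_pCons_le sum.atMost_Suc_shift funpow_Suc_right lop_def simp del: funpow.simps(2) sum.atMost_Suc)

lemma lop_additive:
  assumes "\<And>f g. D (f + g) = D f + D g"
  shows "lop D S (f + g) = lop D S f + lop D S g"
proof -
  have "(D ^^ k) (f + g) = (D ^^ k) f + (D ^^ k) g" for k
    by (induction k) (simp_all add: assms)
  then show ?thesis by (simp add: lop_def algebra_simps sum.distrib)
qed

lemma T_op_add: "T_op (f + g) = T_op f + T_op g"
  by (simp add: T_op_def shiftF_hom.hom_add algebra_simps)

lemma Delta_op_add: "Delta_op (f + g) = Delta_op f + Delta_op g"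
  by (simp add: Delta_op_def T_op_add)

lemma apply_op_conv: "apply_op = lop Delta_op"
  by (intro ext) (simp add: apply_op_def lop_def)

text \<open>T = I + Delta, and the coefficients stand to the left of the powers, so substituting 1 +
  X for the variable X only re-expands the powers. The rest of the argument can then use
  \<open>T\<close>, whose action is simpler.\<close>

lemma apply_op_pcompose: "apply_op (pcompose S [:1, 1:]) f = lop T_op S f"
proof (induction S arbitrary: f)
  case (pCons a S)
  have "apply_op (pcompose (pCons a S) [:1, 1:]) f =
        apply_op ([:a:] + (pcompose S [:1, 1:] + pCons 0 (pcompose S [:1, 1:]))) f"
    by (simp add: pcompose_pCons)
  also have "\<dots> = embK a * f + (apply_op (pcompose S [:1, 1:]) f
      + apply_op (pcompose S [:1, 1:]) (Delta_op f))"
    unfolding apply_op_conv by (simp only: lop_add lop_pCons) simp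
  also have "\<dots> = embK a * f + apply_op (pcompose S [:1, 1:]) (f + Delta_op f)"
    unfolding apply_op_conv by (simp only: lop_additive[of Delta_op, OF Delta_op_add])
  finally show ?case
    using pCons.IH by (simp add: lop_pCons Delta_op_def)
qed (simp add: apply_op_conv)

section \<open>Operators in \<open>T\<close> acting on polynomials in w over
  \<open>ratK\<close>\<close>

abbreviation cP :: "complex poly \<Rightarrow> ratK poly" where "cP \<equiv> map_poly cK"

text \<open>Embeds K[w] in \<open>ratF\<close>. By \<open>lop_T_1\<close> the same polynomial, read
  as an operator in \<open>T\<close>, sends 1 to this value; operators and functions are thus both
  represented in K[w].\<close>

definition io :: "ratK poly \<Rightarrow> ratF" where "io G = poly (map_poly embK G) wF"

interpretation to_fract_hom: inj_idom_hom to_fract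
  by unfold_locales simp_all

lemma exists_common_denominator:
  fixes G :: "'a::idom fract poly"
  obtains d p where "d \<noteq> 0" "smult (to_fract d) G = fract_poly p"
proof -
  have "\<exists>d p. d \<noteq> 0 \<and> smult (to_fract d) G = fract_poly p"
  proof (induction G)
    case 0
    then show ?case by (intro exI[of _ 1] exI[of _ 0]) simp
  next
    case (pCons a G)
    then obtain d p where d: "d \<noteq> 0" "smult (to_fract d) G = fract_poly p" by blast
    obtain x y where a: "a = Fract x y" "y \<noteq> 0" by (rule fract_cases)
    have "smult (to_fract (d * y)) (pCons a G) = fract_poly (pCons (d * x) (smult y p))"
      using a d(1) arg_cong[OF d(2), of "smult (to_fract y)"]
      by (simp add: to_fract_hom.map_poly_pCons_hom Fract_conv_to_fract mult.commute)
    then show ?case using d(1) a(2) by (metis mult_eq_0_iff)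
  qed
  then show ?thesis using that by blast
qed

text \<open>Injectivity is the transcendence of w = 1 + z over K: once denominators in n are
  cleared, substituting w amounts to composing with 1 + z, which kills no nonzero
  polynomial.\<close>

interpretation io_hom: inj_idom_hom io
proof -
  interpret m: map_poly_inj_idom_hom embK ..
  show "inj_idom_hom io"
  proof
    show "io G = 0 \<Longrightarrow> G = 0" for G
    proof -
      assume G: "io G = 0"
      obtain d p where d: "d \<noteq> 0" "smult (to_fract d) G = fract_poly p"
        by (rule exists_common_denominator)
      have emb: "embK (to_fract x) = to_fract [:x:]" for x
        by (simp add: embK_conv const_hom.fract_map_to_fract)
      have w: "wF = to_fract [:1, 1:]"
        unfolding wF_def zF_def to_fract_def by (simp add: One_fract_def one_pCons)
      have "map_poly embK (fract_poly p) = map_poly to_fract (map_poly (\<lambda>a. [:a:]) p)"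
        by (intro poly_eqI) (simp add: coeff_map_poly emb)
      then have "io (fract_poly p) = to_fract (pcompose p [:1, 1:])"
        by (simp only: io_def w to_fract_hom.poly_map_poly pcompose_altdef)
      moreover have "io (fract_poly p) = 0"
        using G unfolding d(2)[symmetric] io_def embK_hom.map_poly_hom_smult by simp
      ultimately have "pcompose p [:1, 1:] = 0" by simp
      then have "p = 0" by (simp add: pcompose_eq_0)
      then show "G = 0" using d by auto
    qed
  qed (simp_all add: io_def m.hom_add m.hom_mult)
qed

text \<open>\<open>T_op\<close> transported to K[w] through \<open>io\<close>, see
  \<open>T_op_io\<close>.\<close>

definition TP :: "ratK poly \<Rightarrow> ratK poly" where "TP G = pCons 0 (map_poly sigK G)"

lemma T_op_io: "T_op (io G) = io (TP G)"
proof -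
  have "map_poly shiftF (map_poly embK G) = map_poly embK (map_poly sigK G)"
    by (intro poly_eqI) (simp add: coeff_map_poly)
  moreover have "shiftF (io G) = poly (map_poly shiftF (map_poly embK G)) (shiftF wF)"
    by (simp only: io_def shiftF_hom.poly_map_poly)
  ultimately show ?thesis
    by (simp add: T_op_def' io_def TP_def embK_hom.map_poly_pCons_hom)
qed

lemma io_smult: "io (smult a G) = embK a * io G"
  by (simp add: io_def embK_hom.map_poly_hom_smult)

lemma T_op_div: "shiftF c = c \<Longrightarrow> T_op (f / c) = T_op f / c"
  by (simp add: T_op_def shiftF_hom.hom_div)

text \<open>The action on K[w] of the operator in \<open>T\<close> with coefficients
  \<open>S\<close>. If \<open>G\<close> is read as an operator too, this is their product in the
  skew polynomial ring, by \<open>lop_opP\<close>.\<close>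

definition opP :: "ratK poly \<Rightarrow> ratK poly \<Rightarrow> ratK poly" where
  "opP S G = (\<Sum>k\<le>degree S. smult (coeff S k) ((TP ^^ k) G))"

lemma lop_T_io:
  assumes "shiftF c = c"
  shows "lop T_op S (io G / c) = io (opP S G) / c"
proof -
  have "(T_op ^^ k) (io G / c) = io ((TP ^^ k) G) / c" for k
    by (induction k) (simp_all add: T_op_div[OF assms] T_op_io)
  then show ?thesis
    by (simp add: lop_def opP_def io_hom.hom_sum io_smult sum_divide_distrib)
qed

lemma io_monom: "io (monom a k) = embK a * wF ^ k"
  by (simp add: io_def poly_monom)

lemma lop_T_1: "lop T_op R 1 = io R"
proof -
  have "(T_op ^^ k) 1 = wF ^ k" for k
    by (induction k) (simp_all add: T_op_def' shiftF_hom.hom_power)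
  then have "lop T_op R 1 = (\<Sum>k\<le>degree R. io (monom (coeff R k) k))"
    by (simp add: lop_def io_monom)
  then show ?thesis by (simp flip: io_hom.hom_sum add: poly_as_sum_of_monoms)
qed

lemma evalF_wF: "evalF p wF = io (cP p)"
proof -
  have "map_poly embK (cP p) = map_poly cF p"
    by (intro poly_eqI) (simp add: coeff_map_poly)
  then show ?thesis by (simp add: evalF_def io_def)
qed

lemma evalF_pcompose: "evalF (pcompose p [:c, 1:]) x = evalF p (cF c + x)"
  by (simp add: evalF_def cF_hom.map_poly_pcompose poly_pcompose cF_hom.map_poly_pCons_hom)

lemma evalF_zF: "evalF p zF = io (cP (pcompose p [:-1, 1:]))"
  by (simp add: evalF_wF[symmetric] evalF_pcompose) (simp add: wF_def cF_hom.hom_uminus)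

lemma io_cP_eq_0_iff [simp]: "io (cP p) = 0 \<longleftrightarrow> p = 0"
  by (metis evalF_wF cF_hom.hom_zero evalF_def io_hom.hom_0_iff map_poly_0 cK_hom.degree_map_poly_hom cK_hom.hom_lead_coeff leading_coeff_0_iff cK_hom.hom_0_iff)

lemma shiftF_io_cP [simp]: "shiftF (io (cP p)) = io (cP p)"
proof -
  have "map_poly shiftF (map_poly cF p) = map_poly cF p"
    by (intro poly_eqI) (simp add: coeff_map_poly)
  then show ?thesis 
   by (metis evalF_wF evalF_def shiftF_hom.poly_map_poly shiftF_wF)
qed

lemma monic_pcompose:
  fixes p :: "'a::idom poly"
  assumes "lead_coeff p = 1"
  shows "lead_coeff (pcompose p [:c, 1:]) = 1" "degree (pcompose p [:c, 1:]) = degree p"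
  using assms lead_coeff_comp[of "[:c, 1:]" p] by (simp_all add: degree_pcompose)

lemma pcompose_shift_back: 
  fixes p :: "'a::idom poly"
  shows "pcompose (pcompose p [:-c, 1:]) [:c, 1:] = p"
  by (simp add: pcompose_assoc[symmetric] pcompose_pCons pcompose_idR)

text \<open>Translating the variable by 1 passes between Delta and \<open>T\<close> without changing
  degree or leading coefficient, and the division by \<nu> is cleared. The definition is used below
  in this form.\<close>

lemma poly_DDT_iff:
  "poly_DDT f \<longleftrightarrow> (\<exists>R S \<theta> \<nu>. lead_coeff R = 1 \<and> lead_coeff S = 1 \<and>
     lead_coeff \<theta> = 1 \<and> lead_coeff \<nu> = 1 \<and> degree R = degree \<theta> \<and>
     f = io R / io (cP \<theta>) \<and> lop T_op S f = io (cP \<nu>))" (is "_ \<longleftrightarrow> ?rhs")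
proof
  assume "poly_DDT f"
  then obtain R S \<theta> \<nu> where *: "lead_coeff R = 1" "lead_coeff S = 1" "lead_coeff \<theta> = 1"
    "lead_coeff \<nu> = 1" "degree R = degree \<theta>" "f = apply_op R 1 / evalF \<theta> (1 + zF)"
    "1 = apply_op S f / evalF \<nu> (1 + zF)"
    unfolding poly_DDT_def by blast
  define R' S' where "R' = pcompose R [:-1, 1:]" "S' = pcompose S [:-1, 1:]"
  have "R = pcompose R' [:1, 1:]" "S = pcompose S' [:1, 1:]"
    unfolding R'_S'_def by (simp_all add: pcompose_shift_back[of _ 1])
  then have "f = io R' / io (cP \<theta>)" "1 = lop T_op S' f / io (cP \<nu>)"
    using *(6,7) unfolding wF_def[symmetric] evalF_wF by (simp_all only: apply_op_pcompose lop_T_1)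
  then show ?rhs
    using * monic_pcompose[OF *(1), of "-1"] monic_pcompose[OF *(2), of "-1"] unfolding R'_S'_def
    by (intro exI[of _ R'] exI[of _ S'] exI[of _ \<theta>] exI[of _ \<nu>]) (auto simp: R'_S'_def)
next
  assume ?rhs
  then obtain R S \<theta> \<nu> where *: "lead_coeff R = 1" "lead_coeff S = 1" "lead_coeff \<theta> = 1"
    "lead_coeff \<nu> = 1" "degree R = degree \<theta>" "f = io R / io (cP \<theta>)"
    "lop T_op S f = io (cP \<nu>)"
    by blast
  have "\<nu> \<noteq> 0" using *(4) by auto
  then show "poly_DDT f" unfolding poly_DDT_def wF_def[symmetric] evalF_wF
    using * monic_pcompose[OF *(1), of 1] monic_pcompose[OF *(2), of 1]
    by (intro exI[of _ "pcompose R [:1, 1:]"] exI[of _ "pcompose S [:1, 1:]"] exI[of _ \<theta>] exI[of _ \<nu>])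
      (simp add: apply_op_pcompose lop_T_1)
qed


lemma degree_map_sigK [simp]: "degree (map_poly sigK G) = degree G"
  by (rule sigK_hom.degree_map_poly_hom)

lemma TP_0 [simp]: "TP 0 = 0"
  by (simp add: TP_def)

lemma TP_add: "TP (G + H) = TP G + TP H"
  by (simp add: TP_def sigK_hom.map_poly_hom_add)

lemma TP_smult: "TP (smult a G) = smult (sigK a) (TP G)"
  by (simp add: TP_def sigK_hom.map_poly_hom_smult)

lemma TP_sum: "TP (\<Sum>i\<in>I. g i) = (\<Sum>i\<in>I. TP (g i))"
  by (induction I rule: infinite_finite_induct) (simp_all add: TP_add)

lemma coeff_TP_Suc [simp]: "coeff (TP G) (Suc k) = sigK (coeff G k)"
  by (simp add: TP_def coeff_map_poly)

lemma coeff_TP_0 [simp]: "coeff (TP G) 0 = 0"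
  by (simp add: TP_def)

lemma TP_pow_monic:
  assumes "lead_coeff G = 1"
  shows "degree ((TP ^^ k) G) = degree G + k" "coeff ((TP ^^ k) G) (degree G + k) = 1"
proof -
  have "G \<noteq> 0" using assms by auto
  then have "(TP ^^ k) G \<noteq> 0 \<and> degree ((TP ^^ k) G) = degree G + k \<and> coeff ((TP ^^ k) G) (degree G + k) = 1"
    using assms by (induction k) (auto simp: TP_def degree_pCons_eq)
  then show "degree ((TP ^^ k) G) = degree G + k" "coeff ((TP ^^ k) G) (degree G + k) = 1" by auto
qed

lemma opP_bound: "degree S \<le> M \<Longrightarrow> opP S G = (\<Sum>k\<le>M. smult (coeff S k) ((TP ^^ k) G))"
  unfolding opP_def by (rule sum.mono_neutral_left) (auto simp: coeff_eq_0)

lemma opP_0 [simp]: "opP 0 G = 0"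
  by (simp add: opP_def)

lemma opP_add: "opP (S + S') G = opP S G + opP S' G"
proof -
  let ?M = "max (degree S) (degree S')"
  show ?thesis
    by (subst (1 2 3) opP_bound[where M = ?M])
      (auto simp: degree_add_le smult_add_left sum.distrib)
qed

lemma opP_smult: "opP (smult a S) G = smult a (opP S G)"
proof (cases "a = 0")
  case False
  then show ?thesis by (simp add: opP_def smult_sum2)
qed simp

lemma opP_TP: "opP (TP S) G = TP (opP S G)"
proof -
  have "opP (TP S) G = (\<Sum>k\<le>Suc (degree S). smult (coeff (TP S) k) ((TP ^^ k) G))"
    by (rule opP_bound) (simp add: TP_def degree_pCons_le)
  also have "\<dots> = (\<Sum>k\<le>degree S. smult (sigK (coeff S k)) (TP ((TP ^^ k) G)))"
    by (simp add: sum.atMost_Suc_shift del: sum.atMost_Suc)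
  finally show ?thesis by (simp add: opP_def TP_sum TP_smult)
qed

lemma opP_monom: "opP (monom a k) G = smult a ((TP ^^ k) G)"
proof -
  have "opP (monom a k) G = (\<Sum>i\<le>k. if i = k then smult a ((TP ^^ k) G) else 0)"
    unfolding opP_bound[OF degree_monom_le] by (rule sum.cong) auto
  then show ?thesis by simp
qed

text \<open>\<open>TP ^^ k\<close> raises the degree of a monic polynomial by k and keeps it monic,
  so the top coefficient comes from the leading term of \<open>P\<close> alone.\<close>

lemma opP_degree:
  assumes "lead_coeff G = 1" "P \<noteq> 0"
  shows "degree (opP P G) = degree P + degree G" "lead_coeff (opP P G) = lead_coeff P"
proof -
  have "coeff (opP P G) (degree P + degree G) =
      (\<Sum>k\<le>degree P. if k = degree P then lead_coeff P else 0)"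
    unfolding opP_def coeff_sum coeff_smult
    by (rule sum.cong) (auto simp: TP_pow_monic[OF assms(1)] add.commute coeff_eq_0 )
  then have 1: "coeff (opP P G) (degree P + degree G) = lead_coeff P" by simp
  have "degree (opP P G) \<le> degree P + degree G"
    unfolding opP_def
    by (rule degree_sum_le) (auto simp: TP_pow_monic[OF assms(1)] intro!: order_trans[OF degree_smult_le])
  moreover have "degree P + degree G \<le> degree (opP P G)"
    using 1 assms by (intro le_degree) auto
  ultimately show "degree (opP P G) = degree P + degree G" by simp
  then show "lead_coeff (opP P G) = lead_coeff P" using 1 by simp
qed

lemma lop_smult: "lop D (smult a S) f = embK a * lop D S f"
proof (cases "a = 0")
  case False
  then show ?thesis by (simp add: lop_def embK_hom.hom_mult sum_distrib_left mult.assoc)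
qed simp

lemma lop_sum: "lop D (\<Sum>i\<in>I. S i) f = (\<Sum>i\<in>I. lop D (S i) f)"
  by (induction I rule: infinite_finite_induct) (simp_all add: lop_add)

lemma T_op_sum: "T_op (\<Sum>i\<in>I. g i) = (\<Sum>i\<in>I. T_op (g i))"
  by (simp add: T_op_def shiftF_hom.hom_sum sum_distrib_left)

lemma lop_TP: "lop T_op (TP S) f = T_op (lop T_op S f)"
proof -
  have "lop T_op (TP S) f = (\<Sum>k\<le>Suc (degree S). embK (coeff (TP S) k) * (T_op ^^ k) f)"
    by (rule lop_bound) (simp add: TP_def degree_pCons_le)
  also have "\<dots> = (\<Sum>k\<le>degree S. embK (sigK (coeff S k)) * T_op ((T_op ^^ k) f))"
    by (simp add: sum.atMost_Suc_shift del: sum.atMost_Suc)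
  also have "\<dots> = (\<Sum>k\<le>degree S. T_op (embK (coeff S k) * (T_op ^^ k) f))"
    by (simp add: T_op_def shiftF_hom.hom_mult mult_ac)
  finally show ?thesis by (simp add: lop_def T_op_sum)
qed

lemma lop_opP: "lop T_op (opP P S) f = lop T_op P (lop T_op S f)"
proof -
  have "lop T_op ((TP ^^ k) S) f = (T_op ^^ k) (lop T_op S f)" for k
    by (induction k) (simp_all add: lop_TP)
  then show ?thesis
    by (simp add: opP_def lop_sum lop_smult) (simp add: lop_def)
qed

text \<open>A factor free of n commutes with \<open>T\<close>, so the operator acts only on the
  function 1 beside it.\<close>

lemma lop_T_shift_invariant:
  assumes "shiftF h = h"
  shows "lop T_op P h = io P * h"
proof -
  have "(T_op ^^ k) h = (T_op ^^ k) 1 * h" for k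
    by (induction k) (simp_all add: T_op_def shiftF_hom.hom_mult assms)
  then have "lop T_op P h = lop T_op P 1 * h"
    by (simp add: lop_def sum_distrib_right mult.assoc)
  then show ?thesis by (simp add: lop_T_1)
qed

section \<open>Determinants\<close>

lemma mat_inverse_unique:
  assumes "A \<in> carrier_mat n n" "B \<in> carrier_mat n n" "C \<in> carrier_mat n n"
    and "A * B = 1\<^sub>m n" "A * C = (1\<^sub>m n :: 'a :: field mat)"
  shows "B = C"
proof -
  have "B * A = 1\<^sub>m n" using assms mat_mult_left_right_inverse by blast
  then have "B * (A * C) = C"
    using assms assoc_mult_mat[OF assms(2,1,3)] by simp
  then show ?thesis using assms by simp
qed

text \<open>\<open>minv\<close> hides an option: the given inverse makes \<open>A\<close> a unit, so
  \<open>mat_inverse\<close> cannot fail, and uniqueness identifies its result.\<close>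

lemma minv_eq:
  assumes "A \<in> carrier_mat n n" "B \<in> carrier_mat n n" "A * B = 1\<^sub>m n"
  shows "minv A = B"
proof (cases "mat_inverse A")
  case None
  from mat_inverse(1)[OF assms(1) None, of n] assms
  have False using mat_mult_left_right_inverse[OF assms]
    by (auto simp: Units_def ring_mat_def)
  then show ?thesis ..
next
  case (Some C)
  from mat_inverse(2)[OF assms(1) Some] show ?thesis
    using mat_inverse_unique[of A n B C] assms Some by (simp add: minv_def)
qed

text \<open>Clearing the lower left block of the bordered matrix \<open>?M\<close> by column
  operations leaves one side as its determinant, clearing it by row operations leaves the
  other.\<close>

lemma det_one_plus_rank_one:
  fixes U V :: "'a :: idom mat"
  assumes U: "U \<in> carrier_mat n 1" and V: "V \<in> carrier_mat 1 n"
  shows "det (1\<^sub>m n + U * V) = 1 + (V * U) $$ (0,0)"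
proof -
  let ?M = "four_block_mat (1\<^sub>m n) U (- V) (1\<^sub>m 1)"
  let ?L = "four_block_mat (1\<^sub>m n) (0\<^sub>m n 1) V (1\<^sub>m 1)"
  let ?L' = "four_block_mat (1\<^sub>m n) (0\<^sub>m n 1) (- V) (1\<^sub>m 1)"
  have VU: "V * U \<in> carrier_mat 1 1" "U * V \<in> carrier_mat n n" using U V by auto
  have 1: "?M * ?L = four_block_mat (1\<^sub>m n + U * V) U (0\<^sub>m 1 n) (1\<^sub>m 1)"
    by (subst mult_four_block_mat[of _ n n _ 1 _ 1 _ _ n _ 1]) (use U V in auto)
  have 2: "?L' * four_block_mat (1\<^sub>m n) U (0\<^sub>m 1 n) (1\<^sub>m 1 + V * U) = ?M"
    by (subst mult_four_block_mat[of _ n n _ 1 _ 1 _ _ n _ 1]) 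
      (use U V VU in \<open>auto intro!: cong_four_block_mat eq_matI simp: uminus_mult_left_mat\<close>)
  have dL: "det ?L = 1" "det ?L' = 1"
    using U V by (simp_all add: det_four_block_mat_upper_right_zero[of _ n _ 1])
  have "det (1\<^sub>m n + U * V) = det (four_block_mat (1\<^sub>m n + U * V) U (0\<^sub>m 1 n) (1\<^sub>m 1))"
    using U V by (simp add: det_four_block_mat_lower_left_zero[of _ n _ 1])
  also have "\<dots> = det ?M"
    unfolding 1[symmetric] using U V by (subst det_mult[of _ "n + 1"]) (auto simp: dL[simplified])
  also have "\<dots> = det (four_block_mat (1\<^sub>m n) U (0\<^sub>m 1 n) (1\<^sub>m 1 + V * U))"
    unfolding 2[symmetric] using U V by (subst det_mult[of _ "n + 1"]) (auto simp: dL[simplified])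
  also have "\<dots> = det (1\<^sub>m 1 + V * U)"
    using U VU by (simp add: det_four_block_mat_lower_left_zero[of _ n _ 1])
  also have "\<dots> = 1 + (V * U) $$ (0,0)"
    using U V by (subst det_single) auto
  finally show ?thesis .
qed

text \<open>The relation \<open>comm\<close> gives A (1 + A' U V W') W = W (A + W'). Taking
  determinants, cancelling \<open>det W\<close> and applying the rank-one formula yields the
  quotient.\<close>

lemma det_ratio_rank_one:
  fixes A W :: "'a :: field mat"
  assumes A: "A \<in> carrier_mat n n" and W: "W \<in> carrier_mat n n"
    and A': "A' \<in> carrier_mat n n" and W': "W' \<in> carrier_mat n n"
    and U: "U \<in> carrier_mat n 1" and V: "V \<in> carrier_mat 1 n"
    and inv: "A * A' = 1\<^sub>m n" "W * W' = 1\<^sub>m n"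
    and comm: "W * A + 1\<^sub>m n = A * W + U * V"
  shows "det (A + W') / det A = 1 + (V * W' * A' * U) $$ (0,0)"
proof -
  note c = A W A' W' U V
  have inv': "W' * W = 1\<^sub>m n" using inv(2) W W' mat_mult_left_right_inverse by blast
  have *: "A * ((1\<^sub>m n + A' * U * (V * W')) * W) = W * (A + W')"
  proof -
    have "(1\<^sub>m n + A' * U * (V * W')) * W = W + A' * U * (V * W') * W"
      using c by (subst add_mult_distrib_mat[of _ n n]) auto
    also have "A' * U * (V * W') * W = A' * U * V"
    proof -
      have "A' * U * (V * W') * W = A' * U * (V * W' * W)"
        using c by (intro assoc_mult_mat[of _ n 1 _ n _ n]) auto
      also have "V * W' * W = V"
        using c inv' by (subst assoc_mult_mat[of _ 1 n _ n _ n]) auto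
      finally show ?thesis .
    qed
    also have "A * (W + A' * U * V) = A * W + A * (A' * U * V)"
      using c by (subst mult_add_distrib_mat[of _ n n]) auto
    also have "A * (A' * U * V) = A * A' * (U * V)"
      using c by (simp add: assoc_mult_mat[of _ n n _ n _ n] assoc_mult_mat[of _ n n _ 1 _ n])
    also have "\<dots> = U * V" using c inv by simp
    also have "A * W + U * V = W * A + W * W'" using comm inv by simp
    also have "\<dots> = W * (A + W')"
      using c by (subst mult_add_distrib_mat[of _ n n]) auto
    finally show ?thesis .
  qed
  have dA: "det A \<noteq> 0" and dW: "det W \<noteq> 0"
    using det_mult[OF A A'] det_mult[OF W W'] inv by auto
  have "det A * (det (1\<^sub>m n + A' * U * (V * W')) * det W) = det W * det (A + W')"
  proof -
    have M: "1\<^sub>m n + A' * U * (V * W') \<in> carrier_mat n n" "A + W' \<in> carrier_mat n n" using c by auto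
    show ?thesis
      using arg_cong[OF *, of det] det_mult[OF A mult_carrier_mat[OF M(1) W]] det_mult[OF M(1) W]
        det_mult[OF W M(2)] by simp
  qed
  moreover have "det (1\<^sub>m n + A' * U * (V * W')) = 1 + (V * W' * (A' * U)) $$ (0,0)"
    using c by (intro det_one_plus_rank_one) auto
  moreover have "V * W' * (A' * U) = V * W' * A' * U"
    using c by (intro assoc_mult_mat[of _ 1 n _ n _ 1, symmetric]) auto
  ultimately have "det W * (det A * (1 + (V * W' * A' * U) $$ (0,0))) = det W * det (A + W')"
    by (simp add: mult.left_commute)
  then have "det A * (1 + (V * W' * A' * U) $$ (0,0)) = det (A + W')"
    using dW by simp
  then show ?thesis using dA by (metis nonzero_mult_div_cancel_left)
qed

section \<open>Entrywise homomorphisms and the resolvent form of the wave function\<close>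

context semiring_hom begin

lemma mat_hom_add: "A \<in> carrier_mat nr nc \<Longrightarrow> B \<in> carrier_mat nr nc \<Longrightarrow> mat\<^sub>h (A + B) = mat\<^sub>h A + mat\<^sub>h B"
  by (intro eq_matI) (auto simp: hom_add)

end

lemma (in ring_hom) mat_hom_minus: "A \<in> carrier_mat nr nc \<Longrightarrow> B \<in> carrier_mat nr nc \<Longrightarrow> mat\<^sub>h (A - B) = mat\<^sub>h A - mat\<^sub>h B"
  by (intro eq_matI) (auto simp: hom_minus)

lemma (in semiring_hom) mat_hom_smult: "mat\<^sub>h (a \<cdot>\<^sub>m A) = hom a \<cdot>\<^sub>m mat\<^sub>h A"
  by (intro eq_matI) (auto simp: hom_mult)

text \<open>\<open>D\<close> is the inverse of 1 + Z and hence commutes with Z, so the term in n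
  drops out of the commutator of \<open>A\<close> and Z. What remains is the rank-one relation
  required by \<open>det_ratio_rank_one\<close> for w - (1 + Z) = z - Z.\<close>

lemma psi_rep_eq:
  assumes X: "X \<in> carrier_mat n n" and Z: "Z \<in> carrier_mat n n"
    and U: "U \<in> carrier_mat n 1" and V: "V \<in> carrier_mat 1 n"
    and D: "D \<in> carrier_mat n n" "(1\<^sub>m n + Z) * D = 1\<^sub>m n"
    and comm: "X * Z - Z * X + 1\<^sub>m n = U * V"
    and A: "A = map_mat cF X - nF \<cdot>\<^sub>m map_mat cF D"
    and A': "A' \<in> carrier_mat n n" "A * A' = 1\<^sub>m n"
    and W': "W' \<in> carrier_mat n n" "(wF \<cdot>\<^sub>m 1\<^sub>m n - map_mat cF (1\<^sub>m n + Z)) * W' = 1\<^sub>m n"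
  shows "psi_rep X Z = 1 + (map_mat cF V * W' * A' * map_mat cF U) $$ (0,0)"
proof -
  let ?h = "map_mat cF"
  let ?W = "wF \<cdot>\<^sub>m 1\<^sub>m n - ?h (1\<^sub>m n + Z)"
  have BF: "1\<^sub>m n + ?h Z = ?h (1\<^sub>m n + Z)"
    using Z by (simp add: cF_hom.mat_hom_add[of _ n n] cF_hom.mat_hom_one)
  have "?h (1\<^sub>m n + Z) * ?h D = 1\<^sub>m n"
    using D Z by (simp add: cF_hom.mat_hom_mult[of _ n n, symmetric] cF_hom.mat_hom_one)
  then have m1: "minv (1\<^sub>m n + ?h Z) = ?h D"
    unfolding BF using D(1) Z by (intro minv_eq[of _ n]) auto
  have Weq: "zF \<cdot>\<^sub>m 1\<^sub>m n - ?h Z = ?W"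
    using Z by (intro eq_matI) (auto simp: wF_def cF_hom.hom_add)
  then have m2: "minv (zF \<cdot>\<^sub>m 1\<^sub>m n - ?h Z) = W'"
    using W' Z by (intro minv_eq[of _ n]) auto
  have Ac: "A \<in> carrier_mat n n" using A D X by auto
  have Wc: "?W \<in> carrier_mat n n" using Z by auto
  have DZ: "D * Z = Z * D"
  proof -
    have "D * (1\<^sub>m n + Z) = 1\<^sub>m n" using D Z mat_mult_left_right_inverse[of "1\<^sub>m n + Z" n D] by auto
    then have "D + D * Z = D + Z * D"
      using D Z mult_add_distrib_mat[OF D(1) one_carrier_mat Z] add_mult_distrib_mat[OF one_carrier_mat Z D(1)]
      by simp
    then have *: "(D + D * Z) $$ (i,j) = (D + Z * D) $$ (i,j)" for i j by simp
    show ?thesis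
    proof (rule eq_matI)
      fix i j assume "i < dim_row (Z * D)" "j < dim_col (Z * D)"
      then have "i < n" "j < n" using D Z by auto
      then show "(D * Z) $$ (i,j) = (Z * D) $$ (i,j)"
        using *[of i j] D(1) Z by (simp del: index_mult_mat(1))
    qed (use D Z in auto)
  qed
  have comm': "?h Z * A - A * ?h Z + ?h (U * V) = 1\<^sub>m n"
  proof -
    have e: "?h Z * ?h D = ?h D * ?h Z"
      using D Z DZ by (simp add: cF_hom.mat_hom_mult[of _ n n, symmetric])
    have "?h Z * A - A * ?h Z = ?h Z * ?h X - ?h X * ?h Z"
      unfolding A using X Z D e
      by (simp add: mult_minus_distrib_mat[of _ n n] minus_mult_distrib_mat[of _ n n] 
          mult_smult_distrib[of _ n n] mult_smult_assoc_mat[of _ n n])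
        (intro eq_matI, auto)
    also have "\<dots> + ?h (U * V) = 1\<^sub>m n"
      unfolding comm[symmetric] using X Z
      by (intro eq_matI) (auto simp: cF_hom.mat_hom_mult[of _ n n, symmetric] cF_hom.hom_add cF_hom.hom_minus)
    finally show ?thesis .
  qed
  have "?W * A + 1\<^sub>m n = A * ?W + ?h U * ?h V"
  proof -
    have UV: "?h U * ?h V = ?h (U * V)" using U V by (simp add: cF_hom.mat_hom_mult[of _ n 1])
    have "?W * A = zF \<cdot>\<^sub>m A - ?h Z * A"
      unfolding Weq[symmetric] using Z Ac by (simp add: minus_mult_distrib_mat[of _ n n] mult_smult_assoc_mat[of _ n n])
    moreover have "A * ?W = zF \<cdot>\<^sub>m A - A * ?h Z"
      unfolding Weq[symmetric] using Z Ac mult_minus_distrib_mat[OF Ac, of "zF \<cdot>\<^sub>m 1\<^sub>m n" n "?h Z"]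
        mult_smult_distrib[OF Ac, of "1\<^sub>m n" n zF] by simp
    ultimately show ?thesis unfolding UV comm'[symmetric] using Ac Z U V
      by (intro eq_matI) auto
  qed
  then have "det (A + W') / det A = 1 + (?h V * W' * A' * ?h U) $$ (0,0)"
    using Ac Wc A' W' U V by (intro det_ratio_rank_one[of A n ?W]) auto
  then show ?thesis
    using X Z m1 m2 by (simp add: psi_rep_def Let_def A)
qed


declare One_nat_def [simp del] \<comment> \<open>keeps the dimension 1 of rows and columns literal\<close>

section \<open>Invertibility of the matrices with a transcendental entry\<close>

text \<open>Evaluation at t is a ring homomorphism and passes through the determinant defining the
  characteristic polynomial. For t = w or t = n the value is transcendental over the constants and
  cannot be a root.\<close>

lemma (in inj_comm_ring_hom) det_char_matrix:
  assumes "M \<in> carrier_mat n n"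
  shows "det (t \<cdot>\<^sub>m 1\<^sub>m n - map_mat hom M) = poly (map_poly hom (char_poly M)) t"
proof -
  have "t \<cdot>\<^sub>m 1\<^sub>m n - map_mat hom M = map_mat (\<lambda>p. poly p t) (char_poly_matrix (map_mat hom M))"
    using assms by (intro eq_matI) (auto simp: char_poly_matrix_def)
  then show ?thesis
    using assms by (simp add: comm_ring_hom.hom_det[OF poly_hom.comm_ring_hom_axioms] char_poly_def[symmetric] char_poly_hom)
qed

lemma nonzero_det_inverse:
  assumes "A \<in> carrier_mat n n" "det A \<noteq> (0 :: 'a :: field)"
  obtains B where "B \<in> carrier_mat n n" "A * B = 1\<^sub>m n" "B * A = 1\<^sub>m n"
  using det_non_zero_imp_unit[OF assms, of "()"] assms(1)
  by (auto simp: Units_def ring_mat_def)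

lemma char_poly_nonzero: "(M :: 'a :: field mat) \<in> carrier_mat n n \<Longrightarrow> char_poly M \<noteq> 0"
  using degree_monic_char_poly[of M n] by auto

lemma exists_W_inverse:
  assumes "B \<in> carrier_mat n n"
  obtains W' where "W' \<in> carrier_mat n n" "(wF \<cdot>\<^sub>m 1\<^sub>m n - map_mat cF B) * W' = 1\<^sub>m n"
    "W' * (wF \<cdot>\<^sub>m 1\<^sub>m n - map_mat cF B) = 1\<^sub>m n"
proof (rule nonzero_det_inverse)
  show "wF \<cdot>\<^sub>m 1\<^sub>m n - map_mat cF B \<in> carrier_mat n n" using assms by auto
  have "det (wF \<cdot>\<^sub>m 1\<^sub>m n - map_mat cF B) = io (cP (char_poly B))"
    using cF_hom.det_char_matrix[OF assms] by (simp add: evalF_wF[symmetric] evalF_def)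
  then show "det (wF \<cdot>\<^sub>m 1\<^sub>m n - map_mat cF B) \<noteq> 0"
    using char_poly_nonzero[OF assms] by simp
qed

lemma poly_cP_nK: "poly (cP p) nK = to_fract p"
proof -
  have "cP p = map_poly to_fract (map_poly (\<lambda>c. [:c:]) p)"
    by (intro poly_eqI) (simp add: coeff_map_poly cK_def)
  then have "poly (cP p) nK = to_fract (pcompose p [:0, 1:])"
    by (simp only: nK_def to_fract_hom.poly_map_poly pcompose_altdef)
  then show ?thesis by simp
qed

text \<open>Multiplying X - n D by B gives X B - n, whose determinant is up to sign the
  characteristic polynomial of X B at the indeterminate n, hence nonzero.\<close>

lemma exists_A_inverse:
  assumes "X \<in> carrier_mat n n" "D \<in> carrier_mat n n" "B \<in> carrier_mat n n" "D * B = 1\<^sub>m n"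
  obtains A' where "A' \<in> carrier_mat n n" "(map_mat cK X - nK \<cdot>\<^sub>m map_mat cK D) * A' = 1\<^sub>m n"
    "A' * (map_mat cK X - nK \<cdot>\<^sub>m map_mat cK D) = 1\<^sub>m n"
proof -
  let ?A = "map_mat cK X - nK \<cdot>\<^sub>m map_mat cK D" and ?M = "nK \<cdot>\<^sub>m 1\<^sub>m n - map_mat cK (X * B)"
  have c: "?A \<in> carrier_mat n n" "?M \<in> carrier_mat n n" "map_mat cK B \<in> carrier_mat n n" using assms by auto
  have "det ?M = to_fract (char_poly (X * B))"
    using assms by (subst cK_hom.det_char_matrix[of _ n]) (auto simp: poly_cP_nK)
  moreover have "char_poly (X * B) \<noteq> 0" using assms by (intro char_poly_nonzero[of _ n]) auto
  ultimately have "det ?M \<noteq> 0" by simp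
  have "?A * map_mat cK B = map_mat cK X * map_mat cK B - nK \<cdot>\<^sub>m (map_mat cK D * map_mat cK B)"
    using assms by (simp add: minus_mult_distrib_mat[of _ n n] mult_smult_assoc_mat[of _ n n])
  also have "\<dots> = - ?M"
    using assms
    by (simp add: cK_hom.mat_hom_mult[of _ n n, symmetric] cK_hom.mat_hom_one) (intro eq_matI, auto)
  finally have "det ?A * det (map_mat cK B) = det (- ?M)"
    using det_mult[OF c(1,3)] by simp
  moreover have "det (- ?M) \<noteq> 0" using \<open>det ?M \<noteq> 0\<close> det_0_negate[OF c(2)] by simp
  ultimately have "det ?A \<noteq> 0" by auto
  then show ?thesis using that by (elim nonzero_det_inverse[OF c(1)]) auto
qed

text \<open>\<open>C j\<close> is the coefficient of t^j in the adjugate of t - B. Comparing powers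
  of t in (t - B) adj(t - B) = \<chi>(t), with \<chi> the characteristic polynomial, gives the
  recursion.\<close>

lemma resolvent_coefficients:
  fixes B :: "'a :: field mat"
  assumes B: "B \<in> carrier_mat n n"
  obtains C where "\<And>j. C j \<in> carrier_mat n n" "\<And>j. j \<ge> n \<Longrightarrow> C j = 0\<^sub>m n n"
    "B * C 0 = - (coeff (char_poly B) 0 \<cdot>\<^sub>m 1\<^sub>m n)"
    "\<And>j. B * C (Suc j) = C j - coeff (char_poly B) (Suc j) \<cdot>\<^sub>m 1\<^sub>m n"
proof -
  define M where "M = adj_mat (char_poly_matrix B)"
  define C where "C j = map_mat (\<lambda>p. coeff p j) M" for j
  have cp: "char_poly_matrix B \<in> carrier_mat n n" using B by simp
  note adj = adj_mat[OF cp, folded M_def char_poly_def]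
  have Cc: "C j \<in> carrier_mat n n" for j using adj(1) by (simp add: C_def)
  have eq: "[:0,1:] * M $$ (i,k) - (\<Sum>l<n. [:B $$ (i,l):] * M $$ (l,k)) = (if i = k then char_poly B else 0)"
    if "i < n" "k < n" for i k
  proof -
    have "(char_poly_matrix B * M) $$ (i,k) = (\<Sum>l<n. (if i = l then [:0,1:] * M $$ (l,k) else 0) - [:B $$ (i,l):] * M $$ (l,k))"
      using that adj(1) B 
      by (auto simp: scalar_prod_def char_poly_matrix_def lessThan_atLeast0 algebra_simps intro!: sum.cong)
    then show ?thesis using that adj(2) by (cases "i = k") (simp_all add: sum_subtractf)
  qed
  have BC: "(B * C j) $$ (i,k) = coeff (\<Sum>l<n. [:B $$ (i,l):] * M $$ (l,k)) j" if "i < n" "k < n" for i k j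
    using that adj(1) B by (auto simp: scalar_prod_def C_def lessThan_atLeast0 coeff_sum intro!: sum.cong)
  have BC2: "(B * C j) $$ (i,k) = coeff ([:0,1:] * M $$ (i,k) - (if i = k then char_poly B else 0)) j"
    if "i < n" "k < n" for i k j
    using BC[OF that] eq[OF that, symmetric] by simp
  have 1: "B * C 0 = - (coeff (char_poly B) 0 \<cdot>\<^sub>m 1\<^sub>m n)"
    by (rule eq_matI) (use B Cc in \<open>auto simp: BC2 simp del: index_mult_mat(1)\<close>)
  have 2: "B * C (Suc j) = C j - coeff (char_poly B) (Suc j) \<cdot>\<^sub>m 1\<^sub>m n" for j
  proof (rule eq_matI)
    fix i k assume "i < dim_row (C j - coeff (char_poly B) (Suc j) \<cdot>\<^sub>m 1\<^sub>m n)"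
      "k < dim_col (C j - coeff (char_poly B) (Suc j) \<cdot>\<^sub>m 1\<^sub>m n)"
    then have ik: "i < n" "k < n" by simp_all
    then have "C j $$ (i,k) = coeff (M $$ (i,k)) j" using adj(1) by (simp add: C_def)
    then show "(B * C (Suc j)) $$ (i,k) = (C j - coeff (char_poly B) (Suc j) \<cdot>\<^sub>m 1\<^sub>m n) $$ (i,k)"
      unfolding BC2[OF ik] using ik Cc[of j] by simp
  qed (use B Cc[of "Suc j"] in auto)
  define m where "m = Max (insert n ((\<lambda>(i,k). degree (M $$ (i,k))) ` ({..<n} \<times> {..<n})))"
  have m: "C j = 0\<^sub>m n n" if "j > m" for j
  proof (rule eq_matI)
    fix i k assume ik: "i < dim_row (0\<^sub>m n n)" "k < dim_col (0\<^sub>m n n)"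
    then have "degree (M $$ (i,k)) \<le> m" unfolding m_def by (intro Max_ge) force+
    then show "C j $$ (i,k) = 0\<^sub>m n n $$ (i,k)"
      using that ik adj(1) by (simp add: C_def coeff_eq_0)
  qed (use adj(1) in \<open>auto simp: C_def\<close>)
  \<comment> \<open>Downward induction from the crude degree bound \<open>m\<close>: for j >= n the
    characteristic polynomial has no term of degree j + 1, so the recursion reads C_j = B
    C_(j+1).\<close>
  have 3: "C j = 0\<^sub>m n n" if "j \<ge> n" for j
  proof (cases "j > m")
    case False
    then have "j \<le> Suc m" by simp
    then show ?thesis using that
    proof (induction j rule: inc_induct)
      case (step j)
      have "coeff (char_poly B) (Suc j) = 0"
        using degree_monic_char_poly[OF B] step.prems by (intro coeff_eq_0) simp
      then have "C j = B * C (Suc j)" unfolding 2 using Cc[of j] by (intro eq_matI) auto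
      then show ?case using step B by simp
    qed (use m in auto)
  qed (rule m)
  show ?thesis using that[of C] Cc 1 2 3 by blast
qed


section \<open>The dual wave function\<close>

lemma row_col_mult:
  assumes "P \<in> carrier_mat 1 1" "Q \<in> carrier_mat 1 1"
  shows "(P * Q) $$ (0,0) = P $$ (0,0) * (Q :: 'a :: comm_ring_1 mat) $$ (0,0)"
  using assms by (auto simp: scalar_prod_def One_nat_def)

lemma index_minus_11:
  assumes "P \<in> carrier_mat 1 1" "Q \<in> carrier_mat 1 1"
  shows "(P - Q) $$ (0,0) = P $$ (0,0) - (Q :: 'a :: comm_ring_1 mat) $$ (0,0)"
  using assms by auto

lemma index_smult_11:
  assumes "P \<in> carrier_mat 1 1"
  shows "(c \<cdot>\<^sub>m P) $$ (0,0) = c * (P :: 'a :: comm_ring_1 mat) $$ (0,0)"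
  using assms by auto

text \<open>\<open>y\<close> is the row v (w - B)^(-1), specified by its defining equation rather
  than by an inverse matrix.\<close>

context
  fixes n :: nat and B :: "'a :: field mat" and y v u :: "'a mat" and w :: 'a
  assumes B [simp]: "B \<in> carrier_mat n n" and y [simp]: "y \<in> carrier_mat 1 n"
    and v [simp]: "v \<in> carrier_mat 1 n" and u [simp]: "u \<in> carrier_mat n 1"
    and resolvent: "w \<cdot>\<^sub>m y - y * B = v"
begin

lemma resolvent_apply:
  assumes [simp]: "p \<in> carrier_mat n 1"
  shows "(v * p) $$ (0,0) = w * (y * p) $$ (0,0) - (y * (B * p)) $$ (0,0)"
proof -
  have "v * p = w \<cdot>\<^sub>m (y * p) - y * (B * p)"
    unfolding resolvent[symmetric]
    using minus_mult_distrib_mat[OF smult_carrier_mat[OF y] mult_carrier_mat[OF y B] assms]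
      mult_smult_assoc_mat[OF y assms] assoc_mult_mat[OF y B assms] by simp
  then show ?thesis using mult_carrier_mat[OF y assms] mult_carrier_mat[OF y mult_carrier_mat[OF B assms]]
    by (simp only: index_minus_11 index_smult_11 smult_carrier_mat)
qed

text \<open>To be used with a = A(n+j)^(-1), a' = A(n+j+1)^(-1) and consecutive resolvent
  coefficients: the left side is then a coefficient of the dual operator times the j-th shift of the
  wave function. \<open>comm\<close> turns the product of the two rank-one terms into a difference,
  so that after multiplication by w^j the last two terms telescope in j.\<close>

lemma dual_step:
  assumes [simp]: "a \<in> carrier_mat n n" "a' \<in> carrier_mat n n" "C \<in> carrier_mat n n" "C' \<in> carrier_mat n n"
    and comm: "B * a' - a * B = a * (u * v) * a'" and BC: "B * C = C' - \<chi> \<cdot>\<^sub>m 1\<^sub>m n"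
  shows "(\<chi> - (v * (a' * (C * u))) $$ (0,0)) * (1 + (y * (a * u)) $$ (0,0)) =
     \<chi> + (y * (a * (C' * u))) $$ (0,0) - w * (y * (a' * (C * u))) $$ (0,0)"
proof -
  define p where "p = C * u"
  have [simp]: "p \<in> carrier_mat n 1" by (simp add: p_def mult_carrier_mat[of _ n n])
  have c [simp]: "a' * p \<in> carrier_mat n 1" "B * p \<in> carrier_mat n 1" "a * u \<in> carrier_mat n 1"
     "v * (a' * p) \<in> carrier_mat 1 1" "y * (a * u) \<in> carrier_mat 1 1"
    by (auto intro!: mult_carrier_mat[of _ _ n])
  have c4: "a * (C' * u) \<in> carrier_mat n 1"
    by (auto intro!: mult_carrier_mat[of _ _ n])
  \<comment> \<open>Multiplied in the opposite order, the two scalars form y a (u v) a' p, to which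
    \<open>comm\<close> applies.\<close>
  have 1: "(v * (a' * p)) $$ (0,0) * (y * (a * u)) $$ (0,0) =
        (y * (B * (a' * p))) $$ (0,0) - (y * (a * (B * p))) $$ (0,0)"
  proof -
    have [simp]: "v * a' \<in> carrier_mat 1 n" "u * (v * a') \<in> carrier_mat n n" "u * v \<in> carrier_mat n n"
      using mult_carrier_mat[OF v assms(2)] mult_carrier_mat[OF u v]
        mult_carrier_mat[OF u mult_carrier_mat[OF v assms(2)]] by auto
    have e1: "y * (a * u) * (v * (a' * p)) = y * (a * (u * v) * a' * p)"
      by (simp add: assoc_mult_mat[of _ 1 n _ n _ 1] assoc_mult_mat[of _ n n _ n _ 1] assoc_mult_mat[of _ n n _ n _ n]
         assoc_mult_mat[of _ n 1 _ n _ n] assoc_mult_mat[of _ n 1 _ n _ 1] assoc_mult_mat[of _ 1 n _ 1 _ 1]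
         assoc_mult_mat[of _ n n _ 1 _ 1] mult_carrier_mat[of _ n 1 _ n] mult_carrier_mat[of _ n n _ n])
    also have "a * (u * v) * a' * p = B * (a' * p) - a * (B * p)"
      unfolding comm[symmetric]
      using minus_mult_distrib_mat[OF mult_carrier_mat[OF B assms(2)] mult_carrier_mat[OF assms(1) B] \<open>p \<in> carrier_mat n 1\<close>]
      by (simp add: assoc_mult_mat[of _ n n _ n _ 1])
    also have "y * (B * (a' * p) - a * (B * p)) = y * (B * (a' * p)) - y * (a * (B * p))"
      by (intro mult_minus_distrib_mat[of _ 1 n _ 1]) (auto intro!: mult_carrier_mat[of _ _ n])
    finally have "(y * (a * u) * (v * (a' * p))) $$ (0,0) =
        (y * (B * (a' * p))) $$ (0,0) - (y * (a * (B * p))) $$ (0,0)"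
      by (simp only:) (intro index_minus_11, auto intro!: mult_carrier_mat[of _ _ n])
    then show ?thesis using row_col_mult[OF c(5,4)] by (simp add: mult.commute)
  qed
  have 2: "(y * (a * (B * p))) $$ (0,0) = (y * (a * (C' * u))) $$ (0,0) - \<chi> * (y * (a * u)) $$ (0,0)"
  proof -
    have "B * p = B * C * u" by (simp add: p_def assoc_mult_mat[of _ n n _ n _ 1])
    also have "\<dots> = C' * u - \<chi> \<cdot>\<^sub>m u"
      unfolding BC
      using minus_mult_distrib_mat[OF assms(4) smult_carrier_mat[OF one_carrier_mat, of \<chi>] u]
        mult_smult_assoc_mat[OF one_carrier_mat u, of \<chi>] left_mult_one_mat[OF u] by simp
    also have "a * (C' * u - \<chi> \<cdot>\<^sub>m u) = a * (C' * u) - \<chi> \<cdot>\<^sub>m (a * u)"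
      unfolding mult_smult_distrib[OF assms(1) u, symmetric]
      by (rule mult_minus_distrib_mat[of _ n n _ 1]) (auto intro!: mult_carrier_mat[of _ _ n])
    also have "y * (a * (C' * u) - \<chi> \<cdot>\<^sub>m (a * u)) = y * (a * (C' * u)) - \<chi> \<cdot>\<^sub>m (y * (a * u))"
      unfolding mult_smult_distrib[OF y c(3), symmetric]
      by (rule mult_minus_distrib_mat[of _ 1 n _ 1]) (auto intro!: mult_carrier_mat[of _ _ n])
    finally show ?thesis
      by (simp only: index_minus_11 index_smult_11 c smult_carrier_mat mult_carrier_mat[OF y c4])
  qed
  have 3: "(v * (a' * p)) $$ (0,0) = w * (y * (a' * p)) $$ (0,0) - (y * (B * (a' * p))) $$ (0,0)"
    by (rule resolvent_apply) simp
  have alg: "(c - s) * (1 + t) = c + l - w * z"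
    if "s * t = q - k" "k = l - c * t" "s = w * z - q" for c s t l z q k :: 'a
  proof -
    have "(c - s) * (1 + t) = c + c * t - s - s * t" by (simp add: algebra_simps)
    then show ?thesis unfolding that(1) unfolding that(2,3) by simp
  qed
  show ?thesis unfolding p_def[symmetric] by (rule alg[OF 1 2 3])
qed

end


lemma map_embK_cK [simp]: "map_mat embK (map_mat cK M) = map_mat cF M"
  by (intro eq_matI) auto

lemma index_map_11: "P \<in> carrier_mat 1 1 \<Longrightarrow> map_mat h P $$ (0,0) = h (P $$ (0,0))"
  by auto

lemma T_op_pow: "(T_op ^^ j) f = wF ^ j * (shiftF ^^ j) f"
  by (induction j) (simp_all add: T_op_def' shiftF_hom.hom_mult shiftF_hom.hom_power mult_ac)

lemma sum_telescope_power:
  fixes w :: "'a :: comm_ring_1"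
  shows "(\<Sum>j\<le>n. w ^ j * (w * g (Suc j) - g j)) = w ^ Suc n * g (Suc n) - g 0"
  by (induction n) (simp_all add: algebra_simps)

lemma io_cP_altdef:
  assumes "degree p \<le> n"
  shows "io (cP p) = (\<Sum>j\<le>n. cF (coeff p j) * wF ^ j)"
proof -
  have "io (cP p) = poly (map_poly cF p) wF" by (simp add: evalF_wF[symmetric] evalF_def)
  also have "\<dots> = (\<Sum>j\<le>n. cF (coeff p j) * wF ^ j)"
    unfolding poly_altdef using assms
    by (intro sum.mono_neutral_cong_left) (auto simp: coeff_eq_0 coeff_map_poly)
  finally show ?thesis .
qed

text \<open>As D and B = 1 + Z are mutually inverse, the two products are X B - n and B X - (n + 1).
  The shift of n thus supplies the identity matrix, and [X, B] = [X, Z].\<close>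

lemma cm_shift_commutator:
  fixes X Z D U V :: "complex mat"
  assumes X: "X \<in> carrier_mat n n" and Z: "Z \<in> carrier_mat n n"
    and U: "U \<in> carrier_mat n 1" and V: "V \<in> carrier_mat 1 n"
    and comm: "X * Z - Z * X + 1\<^sub>m n = U * V"
    and D: "D \<in> carrier_mat n n" "D * (1\<^sub>m n + Z) = 1\<^sub>m n"
    and A: "A = map_mat cK X - nK \<cdot>\<^sub>m map_mat cK D"
  shows "A * map_mat cK (1\<^sub>m n + Z) - map_mat cK (1\<^sub>m n + Z) * map_mat sigK A = map_mat cK U * map_mat cK V"
proof -
  let ?B = "1\<^sub>m n + Z"
  have B: "?B \<in> carrier_mat n n" using Z by auto
  have BD: "?B * D = 1\<^sub>m n" using mat_mult_left_right_inverse[OF D(1) B D(2)] .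
  have sA: "map_mat sigK A = map_mat cK X - (nK + 1) \<cdot>\<^sub>m map_mat cK D"
    unfolding A using X D by (intro eq_matI) (auto simp: sigK_hom.hom_minus sigK_hom.hom_mult)
  have 1: "A * map_mat cK ?B = map_mat cK (X * ?B) - nK \<cdot>\<^sub>m 1\<^sub>m n"
  proof -
    have "A * map_mat cK ?B = map_mat cK X * map_mat cK ?B - nK \<cdot>\<^sub>m (map_mat cK D * map_mat cK ?B)"
      unfolding A using X B D
      by (simp add: minus_mult_distrib_mat[of _ n n] mult_smult_assoc_mat[of _ n n])
    then show ?thesis
      unfolding cK_hom.mat_hom_mult[OF X B, symmetric] cK_hom.mat_hom_mult[OF D(1) B, symmetric] D(2)
        cK_hom.mat_hom_one .
  qed
  have 2: "map_mat cK ?B * map_mat sigK A = map_mat cK (?B * X) - (nK + 1) \<cdot>\<^sub>m 1\<^sub>m n"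
  proof -
    have "map_mat cK ?B * map_mat sigK A = map_mat cK ?B * map_mat cK X - (nK + 1) \<cdot>\<^sub>m (map_mat cK ?B * map_mat cK D)"
      unfolding sA using X B D
      by (simp add: mult_minus_distrib_mat[of _ n n] mult_smult_distrib[of _ n n])
    then show ?thesis
      unfolding cK_hom.mat_hom_mult[OF B X, symmetric] cK_hom.mat_hom_mult[OF B D(1), symmetric] BD
        cK_hom.mat_hom_one .
  qed
  have 3: "X * ?B = X + X * Z" "?B * X = X + Z * X"
    using mult_add_distrib_mat[OF X one_carrier_mat Z] add_mult_distrib_mat[OF one_carrier_mat Z X] X by auto
  have "map_mat cK U * map_mat cK V = map_mat cK (X * Z - Z * X + 1\<^sub>m n)"
    using U V by (simp add: comm cK_hom.mat_hom_mult[of _ n 1])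
  also have "\<dots> = A * map_mat cK ?B - map_mat cK ?B * map_mat sigK A"
    unfolding 1 2 3 using X Z
    by (intro eq_matI) (auto simp: cK_hom.hom_add cK_hom.hom_minus simp del: index_mult_mat(1))
  finally show ?thesis by simp
qed

lemma conjugate_commutator:
  fixes a :: "'a :: field mat"
  assumes c: "A \<in> carrier_mat n n" "A' \<in> carrier_mat n n" "a \<in> carrier_mat n n" "a' \<in> carrier_mat n n"
    "B \<in> carrier_mat n n" "M \<in> carrier_mat n n"
    and inv: "a * A = 1\<^sub>m n" "A' * a' = 1\<^sub>m n" and M: "A * B - B * A' = M"
  shows "B * a' - a * B = a * M * a'"
proof -
  have AB: "A * B \<in> carrier_mat n n" "B * A' \<in> carrier_mat n n" "a * B \<in> carrier_mat n n" using c by auto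
  have "a * M = a * (A * B) - a * (B * A')"
    unfolding M[symmetric] by (rule mult_minus_distrib_mat[OF c(3) AB(1,2)])
  also have "a * (A * B) = B"
    using assoc_mult_mat[OF c(3,1,5)] inv c by simp
  also have "a * (B * A') = a * B * A'"
    using assoc_mult_mat[OF c(3,5,2)] by simp
  finally have "a * M * a' = B * a' - a * B * A' * a'"
    using minus_mult_distrib_mat[OF c(5) mult_carrier_mat[OF AB(3) c(2)] c(4)] by simp
  also have "a * B * A' * a' = a * B"
    using assoc_mult_mat[OF AB(3) c(2) c(4)] inv right_mult_one_mat[OF AB(3)] by simp
  finally show ?thesis by simp
qed

text \<open>Both polynomials of the transform are the characteristic polynomial \<chi> of B = 1 + Z.
  \<open>R\<close> represents \<chi>(w) f, polynomial in w because the adjugate clears (w - B)^(-1);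
  \<open>S\<close> is built from the dual function, likewise multiplied by \<chi>(w).\<close>

lemma cm_wave_function_operators:
  assumes X: "X \<in> carrier_mat n n" and Z: "Z \<in> carrier_mat n n"
    and U: "U \<in> carrier_mat n 1" and V: "V \<in> carrier_mat 1 n"
    and comm: "X * Z - Z * X + 1\<^sub>m n = U * V" and det: "det (1\<^sub>m n + Z) \<noteq> 0"
  obtains R S \<chi> where "lead_coeff R = 1" "lead_coeff S = 1" "lead_coeff \<chi> = 1"
    "degree R = degree \<chi>" "psi_rep X Z = io R / io (cP \<chi>)" "lop T_op S (psi_rep X Z) = io (cP \<chi>)"
proof -
  let ?B = "1\<^sub>m n + Z"
  have B: "?B \<in> carrier_mat n n" using Z by auto
  obtain D where D: "D \<in> carrier_mat n n" "?B * D = 1\<^sub>m n" "D * ?B = 1\<^sub>m n"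
    by (rule nonzero_det_inverse[OF B det])
  define A0 where "A0 = map_mat cK X - nK \<cdot>\<^sub>m map_mat cK D"
  obtain a0 where a0: "a0 \<in> carrier_mat n n" "A0 * a0 = 1\<^sub>m n" "a0 * A0 = 1\<^sub>m n"
    unfolding A0_def by (rule exists_A_inverse[OF X D(1) B D(3)])
  \<comment> \<open>\<open>A j\<close> and \<open>a j\<close> are A(n + j) and its inverse.\<close>
  define A where "A j = (map_mat sigK ^^ j) A0" for j
  define a where "a j = (map_mat sigK ^^ j) a0" for j
  have A0c: "A0 \<in> carrier_mat n n" using X D by (auto simp: A0_def)
  have ASuc: "A (Suc j) = map_mat sigK (A j)" "a (Suc j) = map_mat sigK (a j)" for j
    by (simp_all add: A_def a_def)
  have Ac [simp]: "A j \<in> carrier_mat n n" for j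
    by (induction j) (simp_all add: ASuc, simp add: A_def A0c)
  have ac [simp]: "a j \<in> carrier_mat n n" for j
    by (induction j) (simp_all add: ASuc, simp add: a_def a0)
  have Aa: "A j * a j = 1\<^sub>m n" "a j * A j = 1\<^sub>m n" for j
  proof (induction j)
    case 0
    show "A 0 * a 0 = 1\<^sub>m n" "a 0 * A 0 = 1\<^sub>m n" using a0 by (simp_all add: A_def a_def)
  next
    case (Suc j)
    show "A (Suc j) * a (Suc j) = 1\<^sub>m n" "a (Suc j) * A (Suc j) = 1\<^sub>m n"
      using Suc unfolding ASuc sigK_hom.mat_hom_mult[OF Ac ac, symmetric] sigK_hom.mat_hom_mult[OF ac Ac, symmetric]
      by (simp_all add: sigK_hom.mat_hom_one)
  qed
  define BK UK VK where "BK = map_mat cK ?B" "UK = map_mat cK U" "VK = map_mat cK V"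
  have cK [simp]: "BK \<in> carrier_mat n n" "UK \<in> carrier_mat n 1" "VK \<in> carrier_mat 1 n"
    using B U V by (simp_all add: BK_UK_VK_def)
  have sK: "map_mat sigK BK = BK" "map_mat sigK UK = UK" "map_mat sigK VK = VK"
    by (auto simp: BK_UK_VK_def intro!: eq_matI)
  have UVK [simp]: "UK * VK \<in> carrier_mat n n" using mult_carrier_mat[OF cK(2,3)] .
  have AB: "A j * BK - BK * A (Suc j) = UK * VK" for j
  proof (induction j)
    case 0
    show ?case using cm_shift_commutator[OF X Z U V comm D(1,3) A0_def]
      by (simp add: A_def BK_UK_VK_def)
  next
    case (Suc j)
    have "A (Suc j) * BK - BK * A (Suc (Suc j)) = map_mat sigK (A j * BK - BK * A (Suc j))"
      using sigK_hom.mat_hom_minus[OF mult_carrier_mat[OF Ac cK(1)] mult_carrier_mat[OF cK(1) Ac], of j "Suc j"]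
        sigK_hom.mat_hom_mult[OF Ac cK(1), of j] sigK_hom.mat_hom_mult[OF cK(1) Ac, of "Suc j"]
      by (simp add: ASuc sK)
    then show ?case unfolding Suc.IH using sigK_hom.mat_hom_mult[OF cK(2,3)] sK by simp
  qed
  have commK: "BK * a (Suc j) - a j * BK = a j * (UK * VK) * a (Suc j)" for j
    by (rule conjugate_commutator[OF Ac Ac ac ac cK(1) UVK Aa(2) Aa(1) AB])
  define BF UF VF where "BF = map_mat cF ?B" "UF = map_mat cF U" "VF = map_mat cF V"
  define aF where "aF j = map_mat embK (a j)" for j
  have emb: "map_mat embK BK = BF" "map_mat embK UK = UF" "map_mat embK VK = VF"
    by (simp_all add: BK_UK_VK_def BF_UF_VF_def)
  have cF [simp]: "BF \<in> carrier_mat n n" "UF \<in> carrier_mat n 1" "VF \<in> carrier_mat 1 n" "aF j \<in> carrier_mat n n" for j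
    using B U V by (simp_all add: BF_UF_VF_def aF_def)
  have commF: "BF * aF (Suc j) - aF j * BF = aF j * (UF * VF) * aF (Suc j)" for j
  proof -
    have "map_mat embK (BK * a (Suc j) - a j * BK) = BF * aF (Suc j) - aF j * BF"
      using embK_hom.mat_hom_minus[OF mult_carrier_mat[OF cK(1) ac] mult_carrier_mat[OF ac cK(1)], of "Suc j" j]
       embK_hom.mat_hom_mult[OF cK(1) ac] embK_hom.mat_hom_mult[OF ac cK(1)]
      by (simp add: emb aF_def)
    moreover have "map_mat embK (a j * (UK * VK) * a (Suc j)) = aF j * (UF * VF) * aF (Suc j)"
      using embK_hom.mat_hom_mult[OF mult_carrier_mat[OF ac UVK] ac, of j "Suc j"] embK_hom.mat_hom_mult[OF ac UVK]
        embK_hom.mat_hom_mult[OF cK(2,3)]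
      by (simp add: emb aF_def)
    ultimately show ?thesis by (simp add: commK)
  qed
  obtain W' where W': "W' \<in> carrier_mat n n" "(wF \<cdot>\<^sub>m 1\<^sub>m n - BF) * W' = 1\<^sub>m n" "W' * (wF \<cdot>\<^sub>m 1\<^sub>m n - BF) = 1\<^sub>m n"
    unfolding BF_UF_VF_def by (rule exists_W_inverse[OF B])
  define W where "W = wF \<cdot>\<^sub>m 1\<^sub>m n - BF"
  have Wc: "W \<in> carrier_mat n n" unfolding W_def by (rule minus_carrier_mat[OF cF(1)])
  define y where "y = VF * W'"
  have yc [simp]: "y \<in> carrier_mat 1 n" using mult_carrier_mat[OF cF(3) W'(1)] by (simp add: y_def)
  have res: "wF \<cdot>\<^sub>m y - y * BF = VF"
  proof -
    have "wF \<cdot>\<^sub>m y - y * BF = y * W"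
      using mult_minus_distrib_mat[OF yc _ cF(1), of "wF \<cdot>\<^sub>m 1\<^sub>m n"] mult_smult_distrib[OF yc one_carrier_mat, of wF] right_mult_one_mat[OF yc]
      by (simp add: W_def)
    also have "\<dots> = VF" using assoc_mult_mat[OF cF(3) W'(1) Wc] W'(3) right_mult_one_mat[OF cF(3)] by (simp add: y_def W_def)
    finally show ?thesis .
  qed
  \<comment> \<open>Shift invariance passes from W to its inverse by uniqueness of inverses.\<close>
  have sW': "map_mat shiftF W' = W'"
  proof (rule mat_inverse_unique[OF Wc])
    have "map_mat shiftF W = W" using Z by (intro eq_matI) (auto simp: W_def BF_UF_VF_def shiftF_hom.hom_minus shiftF_hom.hom_mult)
    then show "W * map_mat shiftF W' = 1\<^sub>m n"
      using shiftF_hom.mat_hom_mult[OF Wc W'(1)] W'(2) by (simp add: W_def shiftF_hom.mat_hom_one)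
  qed (use W' in \<open>auto simp: W_def\<close>)
  have sU: "map_mat shiftF UF = UF" "map_mat shiftF VF = VF"
    by (auto simp: BF_UF_VF_def intro!: eq_matI)
  have sy: "map_mat shiftF y = y"
    using shiftF_hom.mat_hom_mult[OF cF(3) W'(1)] sW' sU by (simp add: y_def)
  have sa: "map_mat shiftF (aF j) = aF (Suc j)" for j
    by (intro eq_matI) (auto simp: aF_def ASuc)
  \<comment> \<open>The j-th shift of f, in which only A(n)^(-1) depends on n.\<close>
  define g where "g j = 1 + (y * (aF j * UF)) $$ (0,0)" for j
  have aU [simp]: "aF j * UF \<in> carrier_mat n 1" "a j * UK \<in> carrier_mat n 1" for j
    using mult_carrier_mat[OF cF(4,2)] mult_carrier_mat[OF ac cK(2)] by auto
  have psi: "psi_rep X Z = g 0"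
  proof -
    have "map_mat cF X - nF \<cdot>\<^sub>m map_mat cF D = map_mat embK A0"
      unfolding A0_def using X D by (intro eq_matI) (auto simp: embK_hom.hom_minus embK_hom.hom_mult)
    then have "(map_mat cF X - nF \<cdot>\<^sub>m map_mat cF D) * aF 0 = 1\<^sub>m n"
      using embK_hom.mat_hom_mult[OF A0c a0(1)] a0 by (simp add: aF_def a_def embK_hom.mat_hom_one)
    then have "psi_rep X Z = 1 + (VF * W' * aF 0 * UF) $$ (0,0)"
      unfolding BF_UF_VF_def(2,3) using W' unfolding BF_UF_VF_def(1)
      by (intro psi_rep_eq[OF X Z U V D(1,2) comm refl]) auto
    then show ?thesis
      using assoc_mult_mat[OF yc cF(4,2), of 0] by (simp add: y_def g_def)
  qed
  have sg: "shiftF (g j) = g (Suc j)" for j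
  proof -
    have "shiftF ((y * (aF j * UF)) $$ (0,0)) = map_mat shiftF (y * (aF j * UF)) $$ (0,0)"
      by (rule index_map_11[symmetric, OF mult_carrier_mat[OF yc aU(1)]])
    then show ?thesis
      using shiftF_hom.mat_hom_mult[OF yc aU(1), of j] shiftF_hom.mat_hom_mult[OF cF(4,2), of j]
      by (simp add: g_def sy sa sU shiftF_hom.hom_add del: index_mult_mat(1))
  qed
  have sgj: "(shiftF ^^ j) (g 0) = g j" for j
    by (induction j) (simp_all add: sg)
  define \<chi> where "\<chi> = char_poly ?B"
  have chi: "degree \<chi> = n" "coeff \<chi> n = 1" using degree_monic_char_poly[OF B] by (auto simp: \<chi>_def)
  obtain C where C: "\<And>j. C j \<in> carrier_mat n n" "\<And>j. j \<ge> n \<Longrightarrow> C j = 0\<^sub>m n n"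
    "?B * C 0 = - (coeff \<chi> 0 \<cdot>\<^sub>m 1\<^sub>m n)"
    "\<And>j. ?B * C (Suc j) = C j - coeff \<chi> (Suc j) \<cdot>\<^sub>m 1\<^sub>m n"
    unfolding \<chi>_def using resolvent_coefficients[OF B] by blast
  \<comment> \<open>The resolvent coefficients with index lowered by one and C_(-1) = 0, which
    unites the two cases of the recursion.\<close>
  define Cm where "Cm j = (case j of 0 \<Rightarrow> 0\<^sub>m n n | Suc i \<Rightarrow> C i)" for j
  have Cm_simps: "Cm 0 = 0\<^sub>m n n" "Cm (Suc j) = C j" for j by (simp_all add: Cm_def)
  have Cmc: "Cm j \<in> carrier_mat n n" for j using C(1) by (simp add: Cm_def split: nat.split)
  have BC: "?B * C j = Cm j - coeff \<chi> j \<cdot>\<^sub>m 1\<^sub>m n" for j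
    using C(3,4) by (cases j) (auto simp: Cm_simps)
  define CF where "CF j = map_mat cF (C j)" for j
  define CmF where "CmF j = map_mat cF (Cm j)" for j
  have CFc [simp]: "CF j \<in> carrier_mat n n" "CmF j \<in> carrier_mat n n" for j
    using C(1) Cmc by (simp_all add: CF_def CmF_def)
  have BCF: "BF * CF j = CmF j - cF (coeff \<chi> j) \<cdot>\<^sub>m 1\<^sub>m n" for j
    using arg_cong[OF BC, of "map_mat cF" j] cF_hom.mat_hom_mult[OF B C(1)]
      cF_hom.mat_hom_minus[OF Cmc, of "coeff \<chi> j \<cdot>\<^sub>m 1\<^sub>m n"]
    by (simp add: CF_def CmF_def BF_UF_VF_def cF_hom.mat_hom_smult cF_hom.mat_hom_one)
  have CmF_Suc: "CmF (Suc j) = CF j" "CmF 0 = 0\<^sub>m n n" for j 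
    by (auto simp: CF_def CmF_def Cm_simps intro!: eq_matI)
  have CFn: "CF n = 0\<^sub>m n n" using C(2)[of n] by (auto simp: CF_def intro!: eq_matI)
  define r where "r j = (VK * (map_mat cK (C j) * (a 0 * UK))) $$ (0,0)" for j
  \<comment> \<open>The shift is \<open>Suc j\<close>, not 1: the coefficient v A(n+1)^(-1) C_j u of
    the dual function belongs to the right of T^j, and moving it to the left shifts n by j.\<close>
  define s where "s j = (VK * (a (Suc j) * (map_mat cK (C j) * UK))) $$ (0,0)" for j
  have CKc [simp]: "map_mat cK (C j) \<in> carrier_mat n n" for j using C(1) by simp
  have CU: "map_mat cK (C j) * UK \<in> carrier_mat n 1" "CF j * UF \<in> carrier_mat n 1" "CmF j * UF \<in> carrier_mat n 1" for j
    using mult_carrier_mat[OF CKc cK(2)] mult_carrier_mat[OF CFc(1) cF(2)] mult_carrier_mat[OF CFc(2) cF(2)] by auto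
  have er: "embK (r j) = (VF * (CF j * (aF 0 * UF))) $$ (0,0)" for j
  proof -
    have "embK (r j) = map_mat embK (VK * (map_mat cK (C j) * (a 0 * UK))) $$ (0,0)"
      unfolding r_def by (rule index_map_11[symmetric, OF mult_carrier_mat[OF cK(3) mult_carrier_mat[OF CKc aU(2)]]])
    then show ?thesis
      using embK_hom.mat_hom_mult[OF cK(3) mult_carrier_mat[OF CKc aU(2)], of j 0]
        embK_hom.mat_hom_mult[OF CKc aU(2), of j 0] embK_hom.mat_hom_mult[OF ac cK(2), of 0]
      by (simp add: emb aF_def CF_def del: index_mult_mat(1))
  qed
  have es: "embK (s j) = (VF * (aF (Suc j) * (CF j * UF))) $$ (0,0)" for j
  proof -
    have "embK (s j) = map_mat embK (VK * (a (Suc j) * (map_mat cK (C j) * UK))) $$ (0,0)"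
      unfolding s_def by (rule index_map_11[symmetric, OF mult_carrier_mat[OF cK(3) mult_carrier_mat[OF ac CU(1)]]])
    then show ?thesis
      using embK_hom.mat_hom_mult[OF cK(3) mult_carrier_mat[OF ac CU(1)], of "Suc j" j]
        embK_hom.mat_hom_mult[OF ac CU(1), of "Suc j" j] embK_hom.mat_hom_mult[OF CKc cK(2), of j]
      by (simp add: emb aF_def CF_def del: index_mult_mat(1))
  qed
  have rs0: "embK (r n) = 0" "embK (s n) = 0"
    unfolding er es CFn by (simp_all add: left_mult_zero_mat[OF aU(1)] left_mult_zero_mat[OF cF(2)] right_mult_zero_mat[OF cF(4)] right_mult_zero_mat[OF cF(3)] right_mult_zero_mat[OF yc] del: index_mult_mat(1))
  define R where "R = cP \<chi> + (\<Sum>j<n. monom (r j) j)"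
  define S where "S = cP \<chi> - (\<Sum>j<n. monom (s j) j)"
  have cR: "coeff (\<Sum>j<n. monom (t j) j) k = (if k < n then t k else 0)" for t :: "nat \<Rightarrow> ratK" and k
    by (simp add: coeff_sum)
  have RS: "degree R = n" "lead_coeff R = 1" "degree S = n" "lead_coeff S = 1"
  proof -
    have "coeff R n = 1" "coeff S n = 1" using chi by (simp_all add: R_def S_def cR)
    moreover have "degree R \<le> n" "degree S \<le> n"
      by (intro degree_le, simp add: R_def S_def cR coeff_eq_0 chi)+
    moreover from calculation have "degree R = n" "degree S = n"
      by (auto intro!: le_antisym le_degree)
    ultimately show "degree R = n" "lead_coeff R = 1" "degree S = n" "lead_coeff S = 1" by simp_all
  qed
  have ioc: "io (cP \<chi>) = (\<Sum>j\<le>n. cF (coeff \<chi> j) * wF ^ j)"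
    by (rule io_cP_altdef) (simp add: chi)
  have "io R = io (cP \<chi>) + (\<Sum>j<n. embK (r j) * wF ^ j)"
    by (simp add: R_def io_hom.hom_add io_hom.hom_sum io_monom)
  \<comment> \<open>The term j = n may be added because C_n = 0; the range then agrees with that of
    the coefficients of \<chi>.\<close>
  also have "(\<Sum>j<n. embK (r j) * wF ^ j) = (\<Sum>j\<le>n. embK (r j) * wF ^ j)"
    by (simp add: rs0 lessThan_Suc_atMost[symmetric])
  also have "\<dots> = io (cP \<chi>) * (y * (aF 0 * UF)) $$ (0,0)"
  proof -
    define p where "p = aF 0 * UF"
    have p [simp]: "p \<in> carrier_mat n 1" by (simp add: p_def)
    define Y where "Y j = (y * (CmF j * p)) $$ (0,0)" for j
    have rj: "embK (r j) = wF * Y (Suc j) - Y j + cF (coeff \<chi> j) * (y * p) $$ (0,0)" for j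
    proof -
      have "embK (r j) = wF * Y (Suc j) - (y * (BF * (CF j * p))) $$ (0,0)"
        unfolding er p_def[symmetric] Y_def CmF_Suc
        by (rule resolvent_apply[OF cF(1) yc cF(3,2) res mult_carrier_mat[OF CFc(1) p]])
      moreover have "y * (BF * (CF j * p)) = y * (CmF j * p) - cF (coeff \<chi> j) \<cdot>\<^sub>m (y * p)"
      proof -
        have "BF * (CF j * p) = (CmF j - cF (coeff \<chi> j) \<cdot>\<^sub>m 1\<^sub>m n) * p"
          using assoc_mult_mat[OF cF(1) CFc(1) p] by (simp add: BCF)
        also have "\<dots> = CmF j * p - cF (coeff \<chi> j) \<cdot>\<^sub>m p"
          using minus_mult_distrib_mat[OF CFc(2) smult_carrier_mat[OF one_carrier_mat] p]
            mult_smult_assoc_mat[OF one_carrier_mat p] left_mult_one_mat[OF p] by simp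
        finally show ?thesis
          using mult_minus_distrib_mat[OF yc mult_carrier_mat[OF CFc(2) p] smult_carrier_mat[OF p]]
            mult_smult_distrib[OF yc p] by simp
      qed
      moreover have "(y * (CmF j * p) - cF (coeff \<chi> j) \<cdot>\<^sub>m (y * p)) $$ (0,0) = Y j - cF (coeff \<chi> j) * (y * p) $$ (0,0)"
        unfolding Y_def using mult_carrier_mat[OF yc p] mult_carrier_mat[OF yc mult_carrier_mat[OF CFc(2) p], of j]
        by (simp only: index_minus_11 index_smult_11 smult_carrier_mat)
      ultimately show ?thesis by simp
    qed
    \<comment> \<open>Each \<open>r j\<close> is a telescoping difference plus a coefficient of
      \<chi> times y p; the boundary terms vanish since C_(-1) = C_n = 0.\<close>
    have "(\<Sum>j\<le>n. embK (r j) * wF ^ j) =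
        (\<Sum>j\<le>n. wF ^ j * (wF * Y (Suc j) - Y j)) + (\<Sum>j\<le>n. cF (coeff \<chi> j) * wF ^ j) * (y * p) $$ (0,0)"
      unfolding sum_distrib_right sum.distrib[symmetric]
      by (intro sum.cong refl) (simp add: rj algebra_simps del: index_mult_mat(1))
    moreover have "Y (Suc n) = 0" "Y 0 = 0"
      by (simp_all add: Y_def CmF_Suc CFn left_mult_zero_mat[OF p] right_mult_zero_mat[OF yc] del: index_mult_mat(1))
    ultimately show ?thesis unfolding sum_telescope_power by (simp add: ioc p_def)
  qed
  finally have ioR: "io R = io (cP \<chi>) * g 0" by (simp add: g_def algebra_simps)
  have "lop T_op S (g 0) = (\<Sum>j\<le>n. embK (coeff S j) * (wF ^ j * g j))"
    by (simp add: lop_def RS T_op_pow sgj)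
  also have "\<dots> = (\<Sum>j\<le>n. wF ^ j * ((cF (coeff \<chi> j) - embK (s j)) * g j))"
    using rs0 by (intro sum.cong) (auto simp: S_def cR embK_hom.hom_minus chi)
  also have "\<dots> = io (cP \<chi>)"
  proof -
    \<comment> \<open>The telescoping quantity of \<open>dual_step\<close>; it vanishes at j = 0 and
      j = n + 1 because C_(-1) = C_n = 0.\<close>
    define H where "H j = (y * (aF j * (CmF j * UF))) $$ (0,0)" for j
    have Hj: "(cF (coeff \<chi> j) - embK (s j)) * g j = cF (coeff \<chi> j) + H j - wF * H (Suc j)" for j
      unfolding es g_def H_def CmF_Suc
      by (rule dual_step[OF cF(1) yc cF(3,2) res cF(4,4) CFc(1,2) commF BCF])
    have "(\<Sum>j\<le>n. wF ^ j * ((cF (coeff \<chi> j) - embK (s j)) * g j)) =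
        (\<Sum>j\<le>n. cF (coeff \<chi> j) * wF ^ j) - (\<Sum>j\<le>n. wF ^ j * (wF * H (Suc j) - H j))"
      unfolding sum_subtractf[symmetric] Hj by (intro sum.cong refl) (simp add: algebra_simps del: index_mult_mat(1))
    moreover have "H (Suc n) = 0" "H 0 = 0"
      by (simp_all add: H_def CmF_Suc CFn left_mult_zero_mat[OF aU(1)] left_mult_zero_mat[OF cF(2)] right_mult_zero_mat[OF cF(4)] right_mult_zero_mat[OF cF(3)] right_mult_zero_mat[OF yc] del: index_mult_mat(1))
    ultimately show ?thesis unfolding sum_telescope_power by (simp add: ioc)
  qed
  finally have "lop T_op S (psi_rep X Z) = io (cP \<chi>)" by (simp add: psi)
  moreover have "\<chi> \<noteq> 0" using chi by auto
  then have "psi_rep X Z = io R / io (cP \<chi>)" by (simp add: psi ioR)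
  ultimately show ?thesis using that RS chi by metis
qed


interpretation cP_hom: map_poly_inj_idom_hom cK ..

section \<open>Matrices of rank one\<close>

lemma lincomb_pair_index:
  fixes b c :: "'a :: field vec"
  assumes "b \<in> carrier_vec n" "c \<in> carrier_vec n" "b \<noteq> c" "i < n"
  shows "module.lincomb (module_vec TYPE('a) n) a {b, c} $ i = a b * b $ i + a c * c $ i"
proof -
  interpret vs: vec_space "TYPE('a)" n .
  show ?thesis using assms by (subst vs.lincomb_index) auto
qed

lemma nonzero_vec_lin_indpt:
  fixes b :: "'a :: field vec"
  assumes "b \<in> carrier_vec n"
  shows "module.lin_dep class_ring (module_vec TYPE('a) n) {b} \<longleftrightarrow> b = 0\<^sub>v n"
proof -
  interpret vs: vec_space "TYPE('a)" n .
  show ?thesis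
  proof
    assume "vs.lin_dep {b}"
    then obtain a w where *: "vs.lincomb a {b} = 0\<^sub>v n" "w \<in> {b}" "a w \<noteq> 0"
      using vs.finite_lin_dep[of "{b}"] assms by auto
    have "a b * b $ i = 0" if "i < n" for i
      using arg_cong[OF *(1), of "\<lambda>v. v $ i"] that assms by (simp add: vs.lincomb_index)
    then show "b = 0\<^sub>v n" using * assms by (intro eq_vecI) auto
  next
    assume "b = 0\<^sub>v n"
    then show "vs.lin_dep {b}"
      using assms
      by (intro vs.lin_dep_crit[where A = "{b}" and a = "\<lambda>_. 1" and v = b])
        (auto intro!: eq_vecI simp: vs.lincomb_index vs.lincomb_dim)
  qed
qed

text \<open>A maximal independent set of columns has a single element b. Every other column is
  dependent on b, hence a multiple of it, and the multipliers form the row \<open>V\<close>.\<close>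

lemma rank_one_outer_product:
  fixes M :: "'a :: field mat"
  assumes M: "M \<in> carrier_mat n n" and rank: "vec_space.rank n M = 1"
  obtains U V where "U \<in> carrier_mat n 1" "V \<in> carrier_mat 1 n" "M = U * V"
proof -
  interpret vs: vec_space "TYPE('a)" n .
  let ?P = "\<lambda>T. T \<subseteq> set (cols M) \<and> vs.lin_indpt T"
  have "?P {}" by (auto simp: vs.lin_dep_def)
  then obtain S where S: "maximal S ?P" "finite S"
    using maximal_exists_superset[of "set (cols M)" ?P "{}"] by auto
  then have "card S = 1" using vs.rank_card_indpt[OF M S(1)] rank by simp
  then obtain b where b: "S = {b}" by (rule card_1_singletonE)
  have Pb: "?P {b}" and mx: "\<And>T. {b} \<subseteq> T \<Longrightarrow> ?P T \<Longrightarrow> T = {b}"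
    using S(1) unfolding b maximal_def by auto
  have cols: "set (cols M) \<subseteq> carrier_vec n" using cols_dim M by blast
  then have bc: "b \<in> carrier_vec n" using Pb by auto
  have b0: "b \<noteq> 0\<^sub>v n" using Pb nonzero_vec_lin_indpt[OF bc] by auto
  have "\<exists>t. \<forall>i<n. c $ i = b $ i * t" if c: "c \<in> set (cols M)" for c
  proof (cases "c = b")
    case True
    then show ?thesis by (intro exI[of _ 1]) auto
  next
    case False
    then have "vs.lin_dep {b, c}" using mx[of "{b, c}"] Pb c by auto
    moreover have cc: "c \<in> carrier_vec n" using c cols by auto
    ultimately obtain a w where *: "vs.lincomb a {b, c} = 0\<^sub>v n" "w \<in> {b, c}" "a w \<noteq> 0"
      using vs.finite_lin_dep[of "{b, c}"] bc by auto
    have eq: "a b * b $ i + a c * c $ i = 0" if "i < n" for i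
      using arg_cong[OF *(1), of "\<lambda>v. v $ i"] that lincomb_pair_index[OF bc cc _ that, of a] False by auto
    have "a c \<noteq> 0"
    proof
      assume "a c = 0"
      then have "a b \<noteq> 0" using * by auto
      then have "b = 0\<^sub>v n" using eq \<open>a c = 0\<close> bc by (intro eq_vecI) auto
      then show False using b0 by simp
    qed
    then have "\<forall>i<n. c $ i = b $ i * (- a b / a c)"
      using eq by (auto simp: field_simps eq_neg_iff_add_eq_0)
    then show ?thesis by blast
  qed
  then obtain t where t: "\<And>c i. c \<in> set (cols M) \<Longrightarrow> i < n \<Longrightarrow> c $ i = b $ i * t c" by metis
  have "M = mat n 1 (\<lambda>(i,j). b $ i) * mat 1 n (\<lambda>(i,j). t (col M j))"
  proof (rule eq_matI)
    fix i j assume ij: "i < dim_row (mat n 1 (\<lambda>(i,j). b $ i) * mat 1 n (\<lambda>(i,j). t (col M j)))"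
      "j < dim_col (mat n 1 (\<lambda>(i,j). b $ i) * mat 1 n (\<lambda>(i,j). t (col M j)))"
    then have "col M j \<in> set (cols M)" using M by (auto simp: cols_def)
    then have "col M j $ i = b $ i * t (col M j)" using t[of "col M j" i] ij by simp
    then show "M $$ (i,j) = (mat n 1 (\<lambda>(i,j). b $ i) * mat 1 n (\<lambda>(i,j). t (col M j))) $$ (i,j)"
      using ij M by (simp add: scalar_prod_def One_nat_def)
  qed (use M in auto)
  then show ?thesis using that[of "mat n 1 (\<lambda>(i,j). b $ i)" "mat 1 n (\<lambda>(i,j). t (col M j))"] by auto
qed

lemma rank_outer_product:
  fixes M :: "'a :: field mat"
  assumes U: "U \<in> carrier_mat n 1" and V: "V \<in> carrier_mat 1 n" and M: "M = U * V" "M \<noteq> 0\<^sub>m n n"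
  shows "vec_space.rank n M = 1"
proof -
  interpret vs: vec_space "TYPE('a)" n .
  have Mc: "M \<in> carrier_mat n n" using U V M by auto
  have "vs.rank M \<le> 1"
    by (rule vs.rank_le_1_product_entries[OF Mc, of "\<lambda>i. U $$ (i,0)" "\<lambda>j. V $$ (0,j)"])
      (use U V in \<open>auto simp: M scalar_prod_def One_nat_def\<close>)
  moreover have "vs.rank M \<ge> 1"
  proof -
    obtain i j where ij: "i < n" "j < n" "M $$ (i,j) \<noteq> 0"
      using M(2) Mc by (metis eq_matI carrier_matD index_zero_mat)
    then have "col M j \<noteq> 0\<^sub>v n" "col M j \<in> carrier_vec n" "col M j \<in> set (cols M)"
      using Mc by (auto simp: cols_def dest: arg_cong[of _ _ "\<lambda>v. v $ i"])
    then show ?thesis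
      using vs.rank_ge_card_indpt[OF Mc, of "{col M j}"] nonzero_vec_lin_indpt[of "col M j" n] by auto
  qed
  ultimately show ?thesis by simp
qed

text \<open>A commutator has trace 0, while the identity has trace n, nonzero for n > 0.\<close>

lemma commutator_plus_one_nonzero:
  fixes X Z :: "complex mat"
  assumes X: "X \<in> carrier_mat n n" and Z: "Z \<in> carrier_mat n n" and "n > 0"
  shows "X * Z - Z * X + 1\<^sub>m n \<noteq> 0\<^sub>m n n"
proof
  assume eq: "X * Z - Z * X + 1\<^sub>m n = 0\<^sub>m n n"
  have XZ: "(X * Z) $$ (i,i) = (\<Sum>k<n. X $$ (i,k) * Z $$ (k,i))" if "i < n" for i
    using that X Z by (auto simp: scalar_prod_def lessThan_atLeast0 intro!: sum.cong)
  have ZX: "(Z * X) $$ (i,i) = (\<Sum>k<n. X $$ (k,i) * Z $$ (i,k))" if "i < n" for i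
    using that X Z by (auto simp: scalar_prod_def lessThan_atLeast0 mult.commute intro!: sum.cong)
  have "(\<Sum>i<n. (X * Z) $$ (i,i)) = (\<Sum>i<n. (Z * X) $$ (i,i))"
    using XZ ZX sum.swap[of "\<lambda>i k. X $$ (i,k) * Z $$ (k,i)" "{..<n}" "{..<n}"] by simp
  moreover have "(X * Z) $$ (i,i) - (Z * X) $$ (i,i) = -1" if "i < n" for i
  proof -
    have "(X * Z - Z * X + 1\<^sub>m n) $$ (i,i) = 0" using that by (simp add: eq)
    then show ?thesis using that X Z by (simp del: index_mult_mat(1) add: add_eq_0_iff2)
  qed
  then have "(\<Sum>i<n. (X * Z) $$ (i,i) - (Z * X) $$ (i,i)) = (\<Sum>i<n. -1)"
    by (intro sum.cong) auto
  ultimately show False using \<open>n > 0\<close> by (simp add: sum_subtractf)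
qed

text \<open>For n > 0 the trace excludes u v = 0, so rank exactly 1 is the same as being a product u
  v. The empty matrix is such a product without having rank 1, whence the separate case n =
  0.\<close>

lemma rank_one_or_empty_iff:
  fixes X Z :: "complex mat"
  assumes X: "X \<in> carrier_mat n n" and Z: "Z \<in> carrier_mat n n"
  shows "(n = 0 \<or> vec_space.rank n (X * Z - Z * X + 1\<^sub>m n) = 1) \<longleftrightarrow>
    (\<exists>U V. U \<in> carrier_mat n 1 \<and> V \<in> carrier_mat 1 n \<and> X * Z - Z * X + 1\<^sub>m n = U * V)"
    (is "?l \<longleftrightarrow> ?r")
proof
  have c: "X * Z - Z * X + 1\<^sub>m n \<in> carrier_mat n n" using X Z by auto
  assume ?l
  then show ?r
  proof
    assume "n = 0"
    then show ?r using X Z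
      by (intro exI[of _ "0\<^sub>m n 1"] exI[of _ "0\<^sub>m 1 n"]) (auto intro!: eq_matI)
  next
    assume "vec_space.rank n (X * Z - Z * X + 1\<^sub>m n) = 1"
    then show ?r by (rule rank_one_outer_product[OF c]) blast
  qed
next
  assume ?r
  then show ?l using rank_outer_product commutator_plus_one_nonzero[OF X Z] by blast
qed

text \<open>The quotient of \<theta>1 and \<theta>2 is free of n and commutes with \<open>T\<close>:
  its numerator p goes into \<open>R\<close>, its denominator q joins \<chi>, and \<open>S\<close>
  is composed with q(T) to cancel that denominator. Equal degrees keep the order of the new
  \<open>R\<close> equal to the degree of its denominator.\<close>

lemma poly_DDT_of_cm_pair:
  assumes t: "lead_coeff \<theta>1 = 1" "lead_coeff \<theta>2 = 1" "degree \<theta>1 = degree \<theta>2"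
    and X: "X \<in> carrier_mat n n" and Z: "Z \<in> carrier_mat n n"
    and rank: "n = 0 \<or> vec_space.rank n (X * Z - Z * X + 1\<^sub>m n) = 1" and det: "det (1\<^sub>m n + Z) \<noteq> 0"
  shows "poly_DDT (evalF \<theta>1 zF / evalF \<theta>2 zF * psi_rep X Z)"
proof -
  obtain U V where UV: "U \<in> carrier_mat n 1" "V \<in> carrier_mat 1 n" "X * Z - Z * X + 1\<^sub>m n = U * V"
    using rank rank_one_or_empty_iff[OF X Z] by blast
  obtain R S \<chi> where *: "lead_coeff R = 1" "lead_coeff S = 1" "lead_coeff \<chi> = 1"
    "degree R = degree \<chi>" "psi_rep X Z = io R / io (cP \<chi>)" "lop T_op S (psi_rep X Z) = io (cP \<chi>)"
    by (rule cm_wave_function_operators[OF X Z UV det])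
  define p q where "p = pcompose \<theta>1 [:-1, 1:]" "q = pcompose \<theta>2 [:-1, 1:]"
  have pq: "lead_coeff p = 1" "lead_coeff q = 1" "degree p = degree q"
    using t monic_pcompose[of \<theta>1 "-1"] monic_pcompose[of \<theta>2 "-1"] unfolding p_q_def by auto
  then have nz: "p \<noteq> 0" "q \<noteq> 0" "\<chi> \<noteq> 0" "R \<noteq> 0" using * by auto
  define c where "c = io (cP p) / io (cP q)"
  have sc: "shiftF c = c" by (simp add: c_def shiftF_hom.hom_div)
  have "(T_op ^^ k) (c * f) = c * (T_op ^^ k) f" for k f
    by (induction k) (simp_all add: T_op_def shiftF_hom.hom_mult sc)
  then have "lop T_op S (c * psi_rep X Z) = c * io (cP \<chi>)"
    unfolding *(6)[symmetric] by (simp add: lop_def sum_distrib_left mult.left_commute)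
  \<comment> \<open>The result so far is free of n, and on such a function q(T) is multiplication by
    q(w).\<close>
  then have "lop T_op (opP (cP q) S) (c * psi_rep X Z) = io (cP q) * (c * io (cP \<chi>))"
    unfolding lop_opP by (subst lop_T_shift_invariant[symmetric]) (simp_all add: sc shiftF_hom.hom_mult)
  also have "\<dots> = io (cP (p * \<chi>))"
    using nz by (simp add: c_def io_hom.hom_mult cP_hom.hom_mult)
  finally have S: "lop T_op (opP (cP q) S) (c * psi_rep X Z) = io (cP (p * \<chi>))" .
  have cq: "cP q \<noteq> 0" "lead_coeff (cP q) = 1" using nz pq by simp_all
  have "poly_DDT (c * psi_rep X Z)" unfolding poly_DDT_iff
  proof (intro exI conjI)
    show "lead_coeff (cP p * R) = 1" using pq * by (simp add: lead_coeff_mult)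
    show "lead_coeff (opP (cP q) S) = 1" using opP_degree(2)[OF *(2) cq(1)] cq(2) by simp
    show "lead_coeff (q * \<chi>) = 1" using pq * by (simp add: lead_coeff_mult)
    show "lead_coeff (p * \<chi>) = 1" using pq * by (simp add: lead_coeff_mult)
    show "degree (cP p * R) = degree (q * \<chi>)"
      using nz pq * by (subst (1 2) degree_mult_eq) auto
    show "c * psi_rep X Z = io (cP p * R) / io (cP (q * \<chi>))"
      by (simp add: c_def *(5) io_hom.hom_mult cP_hom.hom_mult)
  qed (rule S)
  then show ?thesis by (simp add: c_def evalF_zF p_q_def)
qed


section \<open>Limits of rational functions at infinity\<close>

text \<open>The value at n = infinity of a rational function regular there. The coefficient of p is
  taken at the degree of q, so a smaller degree of p gives the value 0.\<close>

definition tends :: "ratK \<Rightarrow> complex \<Rightarrow> bool" where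
  "tends a c \<longleftrightarrow> (\<exists>p q. q \<noteq> 0 \<and> a = Fract p q \<and> degree p \<le> degree q \<and>
     coeff p (degree q) = c * lead_coeff q)"

lemma coeff_mult_bound:
  fixes p q :: "'a :: comm_semiring_0 poly"
  assumes "degree p \<le> m" "degree q \<le> k"
  shows "coeff (p * q) (m + k) = coeff p m * coeff q k"
proof (cases "degree p = m \<and> degree q = k")
  case True
  then show ?thesis using coeff_mult_degree_sum[of p q] by auto
next
  case False
  then have "degree p < m \<or> degree q < k" using assms by auto
  moreover have "degree (p * q) < m + k"
    using degree_mult_le[of p q] assms calculation by linarith
  ultimately show ?thesis by (auto simp: coeff_eq_0)
qed

text \<open>Cross-multiplication and comparison of top coefficients show that every representative
  gives the same answer.\<close>

lemma tends_Fract: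
  assumes "q \<noteq> 0"
  shows "tends (Fract p q) c \<longleftrightarrow> degree p \<le> degree q \<and> coeff p (degree q) = c * lead_coeff q"
proof
  assume "tends (Fract p q) c"
  then obtain p' q' where *: "q' \<noteq> 0" "Fract p q = Fract p' q'" "degree p' \<le> degree q'"
    "coeff p' (degree q') = c * lead_coeff q'" unfolding tends_def by blast
  then have eq: "p * q' = p' * q" using assms by (simp add: eq_fract)
  have le: "degree p \<le> degree q"
  proof (cases "p = 0")
    case False
    then have "p' \<noteq> 0" using eq *(1) by auto
    then have "degree p + degree q' = degree p' + degree q"
      using arg_cong[OF eq, of degree] *(1) assms False by (simp add: degree_mult_eq)
    then show ?thesis using *(3) by simp
  qed simp
  have "coeff (p * q') (degree q + degree q') = coeff (q * p') (degree q + degree q')"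
    unfolding eq by (simp only: mult.commute)
  then have "coeff p (degree q) * lead_coeff q' = lead_coeff q * (c * lead_coeff q')"
    using *(3,4) le by (simp add: coeff_mult_bound)
  then show "degree p \<le> degree q \<and> coeff p (degree q) = c * lead_coeff q"
    using le *(1) by simp
next
  assume "degree p \<le> degree q \<and> coeff p (degree q) = c * lead_coeff q"
  then show "tends (Fract p q) c" unfolding tends_def using assms by blast
qed

lemma tends_unique:
  assumes "tends a c" "tends a c'"
  shows "c = c'"
proof -
  obtain p q where a: "a = Fract p q" "q \<noteq> 0" by (rule fract_cases)
  have "c * lead_coeff q = c' * lead_coeff q"
    using assms by (simp add: a(1) tends_Fract[OF a(2)])
  then show ?thesis using a(2) by simp
qed

lemma tends_cK [simp]: "tends (cK x) c \<longleftrightarrow> c = x"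
  unfolding cK_def to_fract_def by (subst tends_Fract) auto

lemma tends_0 [simp]: "tends 0 c \<longleftrightarrow> c = 0"
  by (metis cK_hom.hom_zero tends_cK)

lemma tends_1 [simp]: "tends 1 c \<longleftrightarrow> c = 1"
  by (metis cK_hom.hom_one tends_cK)

lemma tends_add: "tends a c \<Longrightarrow> tends b e \<Longrightarrow> tends (a + b) (c + e)"
proof -
  assume *: "tends a c" "tends b e"
  obtain p q where a: "a = Fract p q" "q \<noteq> 0" by (rule fract_cases)
  obtain r s where b: "b = Fract r s" "s \<noteq> 0" by (rule fract_cases)
  have d: "degree p \<le> degree q" "coeff p (degree q) = c * lead_coeff q"
    "degree r \<le> degree s" "coeff r (degree s) = e * lead_coeff s"
    using * a b by (simp_all add: tends_Fract)
  have "degree (p * s + r * q) \<le> degree q + degree s"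
    using d degree_mult_le[of p s] degree_mult_le[of r q] by (intro degree_add_le) linarith+
  moreover have "coeff (p * s + r * q) (degree q + degree s) = (c + e) * lead_coeff (q * s)"
    using coeff_mult_bound[of p "degree q" s "degree s"] coeff_mult_bound[of r "degree s" q "degree q"] d
    by (simp add: lead_coeff_mult algebra_simps)
  ultimately show ?thesis using a b by (simp add: tends_Fract degree_mult_eq)
qed

lemma tends_mult: "tends a c \<Longrightarrow> tends b e \<Longrightarrow> tends (a * b) (c * e)"
proof -
  assume *: "tends a c" "tends b e"
  obtain p q where a: "a = Fract p q" "q \<noteq> 0" by (rule fract_cases)
  obtain r s where b: "b = Fract r s" "s \<noteq> 0" by (rule fract_cases)
  have d: "degree p \<le> degree q" "coeff p (degree q) = c * lead_coeff q"
    "degree r \<le> degree s" "coeff r (degree s) = e * lead_coeff s"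
    using * a b by (simp_all add: tends_Fract)
  have "degree (p * r) \<le> degree q + degree s"
    using d degree_mult_le[of p r] by linarith
  moreover have "coeff (p * r) (degree q + degree s) = (c * e) * lead_coeff (q * s)"
    using coeff_mult_bound[of p "degree q" r "degree s"] d
    by (simp add: lead_coeff_mult)
  ultimately show ?thesis using a b by (simp add: tends_Fract degree_mult_eq)
qed

lemma tends_diff: "tends a c \<Longrightarrow> tends b e \<Longrightarrow> tends (a - b) (c - e)"
  using tends_add[of a c "- b" "- e"] tends_mult[of "-1" "-1" b e] tends_cK[of "-1" "-1"]
  by (simp add: cK_hom.hom_uminus del: tends_cK)

lemma tends_sum: "(\<And>i. i \<in> I \<Longrightarrow> tends (a i) (c i)) \<Longrightarrow> tends (\<Sum>i\<in>I. a i) (\<Sum>i\<in>I. c i)"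
  by (induction I rule: infinite_finite_induct) (simp_all add: tends_add)

text \<open>Replacing n by n + 1 changes neither degrees nor leading coefficients: the shift fixes
  the point at infinity.\<close>

lemma tends_sigK [simp]: "tends (sigK a) c \<longleftrightarrow> tends a c"
proof -
  obtain p q where a: "a = Fract p q" "q \<noteq> 0" by (rule fract_cases)
  have "coeff (pcompose p [:1, 1:]) (degree q) = coeff p (degree q)" if "degree p \<le> degree q"
    using that lead_coeff_comp[of "[:1, 1:]" p]
    by (cases "degree p = degree q") (auto simp: degree_pcompose coeff_eq_0)
  moreover have "lead_coeff (pcompose q [:1, 1:]) = lead_coeff q"
    using lead_coeff_comp[of "[:1, 1:]" q] by simp
  ultimately show ?thesis
    using a by (auto simp: sigK_def shift_hom.fract_map_Fract tends_Fract degree_pcompose pcompose_eq_0)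
qed

lemma sigK_pow_inverse: "(sigK ^^ k) (1 / t) = 1 / (sigK ^^ k) t"
  by (induction k) (simp_all add: sigK_hom.hom_div)

lemma tends_sigK_pow [simp]: "tends ((sigK ^^ k) a) c \<longleftrightarrow> tends a c"
  by (induction k) simp_all

lemma tends_inverse:
  assumes "tends a c" "c \<noteq> 0"
  shows "tends (1 / a) (1 / c)"
proof -
  obtain p q where a: "a = Fract p q" "q \<noteq> 0" by (rule fract_cases)
  have *: "degree p \<le> degree q" "coeff p (degree q) = c * lead_coeff q"
    using assms a by (simp_all add: tends_Fract)
  then have nz: "coeff p (degree q) \<noteq> 0" using assms a by simp
  then have "degree p = degree q" using *(1) le_degree[OF nz] by simp
  moreover have "p \<noteq> 0" using nz by auto
  moreover have "1 / a = Fract q p" unfolding a(1) by (simp add: Fract_conv_to_fract)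
  ultimately show ?thesis using * assms(2) by (simp add: tends_Fract)
qed

lemma tends_exists_le:
  assumes "q \<noteq> 0" "degree p \<le> degree q"
  shows "\<exists>c. tends (Fract p q) c"
  using assms by (intro exI[of _ "coeff p (degree q) / lead_coeff q"]) (simp add: tends_Fract)

text \<open>A nonzero function vanishing at infinity has a numerator of smaller degree than its
  denominator, which leaves room for one factor n.\<close>

lemma tends_nK_mult:
  assumes "tends a 0"
  shows "\<exists>c. tends (nK * a) c"
proof -
  obtain p q where a: "a = Fract p q" "q \<noteq> 0" by (rule fract_cases)
  have *: "degree p \<le> degree q" "coeff p (degree q) = 0" using assms a by (simp_all add: tends_Fract)
  have "degree (pCons 0 p) \<le> degree q"
  proof (cases "p = 0")
    case False
    then have "degree p \<noteq> degree q" using *(2) by (metis leading_coeff_0_iff)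
    then show ?thesis using * by (simp add: degree_pCons_eq_if)
  qed simp
  then show ?thesis using tends_exists_le[of q "pCons 0 p"] a
    by (simp add: nK_def to_fract_def)
qed

section \<open>Limits of polynomials in w, coefficient by coefficient\<close>

definition ptends :: "ratK poly \<Rightarrow> complex poly \<Rightarrow> bool" where
  "ptends R r \<longleftrightarrow> (\<forall>k. tends (coeff R k) (coeff r k))"

lemma ptends_degree: "ptends P p \<Longrightarrow> degree p \<le> degree P"
proof (intro degree_le allI impI)
  fix i assume "ptends P p" "degree P < i"
  then have "tends 0 (coeff p i)" unfolding ptends_def by (metis coeff_eq_0)
  then show "coeff p i = 0" by simp
qed

lemma ptends_sum: "(\<And>i. i \<in> I \<Longrightarrow> ptends (a i) (c i)) \<Longrightarrow> ptends (\<Sum>i\<in>I. a i) (\<Sum>i\<in>I. c i)"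
  by (auto simp: ptends_def coeff_sum intro!: tends_sum)

lemma ptends_smult: "tends a c \<Longrightarrow> ptends G g \<Longrightarrow> ptends (smult a G) (smult c g)"
  by (simp add: ptends_def tends_mult)

lemma ptends_TP: "ptends G g \<Longrightarrow> ptends (TP G) (pCons 0 g)"
  unfolding ptends_def
proof
  fix k assume "\<forall>k. tends (coeff G k) (coeff g k)"
  then show "tends (coeff (TP G) k) (coeff (pCons 0 g) k)" by (cases k) auto
qed

text \<open>The shift is invisible at infinity, so \<open>T\<close> becomes multiplication by w
  there, and composition of operators becomes the ordinary product of polynomials.\<close>

lemma ptends_opP:
  assumes P: "ptends P p" and G: "ptends G g"
  shows "ptends (opP P G) (p * g)"
proof -
  have "ptends ((TP ^^ k) G) (monom 1 k * g)" for k
    using G by (induction k) (auto simp: monom_Suc dest: ptends_TP)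
  then have "ptends (opP P G) (\<Sum>k\<le>degree P. smult (coeff p k) (monom 1 k * g))"
    unfolding opP_def using P by (intro ptends_sum ptends_smult) (auto simp: ptends_def)
  also have "(\<Sum>k\<le>degree P. smult (coeff p k) (monom 1 k * g)) = (\<Sum>k\<le>degree P. monom (coeff p k) k) * g"
    by (simp add: sum_distrib_right smult_monom flip: mult_smult_left)
  also have "(\<Sum>k\<le>degree P. monom (coeff p k) k) = p"
    using ptends_degree[OF P] poly_as_sum_of_monoms'[of p "degree P"] by simp
  finally show ?thesis .
qed

text \<open>Division by a coefficient of largest order in n makes all coefficients regular at
  infinity and that one equal to 1, so the limit is not zero.\<close>

lemma exists_normalizer:
  assumes "R \<noteq> 0"
  obtains t r where "t \<noteq> 0" "r \<noteq> 0" "ptends (smult t R) r"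
proof -
  define v where "v a = int (degree (fst (quot_of_fract a))) - int (degree (snd (quot_of_fract a)))" for a :: ratK
  define I where "I = {k. k \<le> degree R \<and> coeff R k \<noteq> 0}"
  have "finite I" "I \<noteq> {}" using assms unfolding I_def by (auto intro: exI[of _ "degree R"])
  then have "Max ((\<lambda>i. v (coeff R i)) ` I) \<in> (\<lambda>i. v (coeff R i)) ` I" by (intro Max_in) auto
  then obtain k where k: "k \<in> I" "Max ((\<lambda>i. v (coeff R i)) ` I) = v (coeff R k)" by auto
  have kmax: "v (coeff R i) \<le> v (coeff R k)" if "i \<in> I" for i
    unfolding k(2)[symmetric] using \<open>finite I\<close> that by (intro Max_ge) auto
  have ex: "\<exists>c. tends (1 / coeff R k * coeff R i) c" for i
  proof (cases "coeff R i = 0")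
    case False
    define a b where "a = coeff R i" "b = coeff R k"
    define p q r s where "p = fst (quot_of_fract a)" "q = snd (quot_of_fract a)"
      "r = fst (quot_of_fract b)" "s = snd (quot_of_fract b)"
    have ab: "a = Fract p q" "b = Fract r s" "q \<noteq> 0" "s \<noteq> 0"
      by (simp_all add: p_q_r_s_def Fract_quot_of_fract')
    have "i \<in> I" using False by (simp add: I_def le_degree)
    then have v: "v a \<le> v b" unfolding a_b_def by (rule kmax)
    have "b \<noteq> 0" "a \<noteq> 0" using k(1) False by (simp_all add: a_b_def I_def)
    then have "r \<noteq> 0" "p \<noteq> 0" using ab by (auto simp: Zero_fract_def[symmetric] fract_collapse)
    moreover have "1 / b * a = Fract (p * s) (q * r)"
      using ab \<open>r \<noteq> 0\<close> by (simp add: Fract_conv_to_fract mult.commute)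
    moreover have "degree p + degree s \<le> degree q + degree r"
      using v by (simp add: v_def p_q_r_s_def)
    ultimately show ?thesis using ab tends_exists_le[of "q * r" "p * s"]
      by (simp add: a_b_def[symmetric] degree_mult_eq)
  qed auto
  then obtain c where c: "\<And>i. tends (1 / coeff R k * coeff R i) (c i)" by metis
  define r where "r = (\<Sum>i\<le>degree R. monom (c i) i)"
  have nz: "coeff R k \<noteq> 0" "k \<le> degree R" using k(1) by (simp_all add: I_def)
  have "c k = 1" using c[of k] nz by (auto simp: tends_unique)
  have "c i = 0" if "i > degree R" for i using c[of i] that by (simp add: coeff_eq_0)
  then have r: "coeff r i = c i" for i
    unfolding r_def by (cases "i \<le> degree R") (auto simp: coeff_sum)
  show ?thesis
  proof (rule that)
    show "1 / coeff R k \<noteq> 0" using nz by simp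
    show "r \<noteq> 0" using r[of k] \<open>c k = 1\<close> by auto
    show "ptends (smult (1 / coeff R k) R) r" using c by (simp add: ptends_def r)
  qed
qed

text \<open>As for Gauss's lemma: \<open>T\<close> acts trivially on leading terms at infinity, so the limits of
  suitably scaled factors multiply, and monicity then excludes any scaling.\<close>

lemma monic_right_divisor_has_limit:
  assumes R: "lead_coeff R = 1" and S: "lead_coeff S = 1" and SR: "opP S R = cP q" and "q \<noteq> 0"
  obtains \<theta> where "ptends R \<theta>"
proof -
  have "R \<noteq> 0" using R by auto
  then obtain t r where t: "t \<noteq> 0" "r \<noteq> 0" "ptends (smult t R) r" by (rule exists_normalizer)
  \<comment> \<open>\<open>S\<close> composed with 1/t: moving 1/t past T^k shifts it k times. This
    compensates the scaling of \<open>R\<close> by t.\<close>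
  define S1 where "S1 = (\<Sum>k\<le>degree S. monom (coeff S k / (sigK ^^ k) t) k)"
  have tk: "(sigK ^^ k) t \<noteq> 0" for k using t(1) by (induction k) auto
  have TPt: "(TP ^^ k) (smult t R) = smult ((sigK ^^ k) t) ((TP ^^ k) R)" for k
    by (induction k) (simp_all add: TP_smult)
  have cS1: "coeff S1 k = (if k \<le> degree S then coeff S k / (sigK ^^ k) t else 0)" for k
    by (auto simp: S1_def coeff_sum)
  have "degree S1 \<le> degree S" by (intro degree_le) (simp add: cS1)
  then have "opP S1 (smult t R) = cP q"
    unfolding SR[symmetric] opP_def[of S] by (subst opP_bound) (auto simp: cS1 TPt tk intro!: sum.cong)
  have S1l: "coeff S1 (degree S) = 1 / (sigK ^^ degree S) t" using S by (simp add: cS1)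
  then have "S1 \<noteq> 0" using tk[of "degree S"] by (metis coeff_0 divide_eq_0_iff zero_neq_one)
  then obtain s s' where s: "s \<noteq> 0" "s' \<noteq> 0" "ptends (smult s S1) s'" by (rule exists_normalizer)
  have "ptends (smult s (cP q)) (s' * r)"
    using ptends_opP[OF s(3) t(3)] \<open>opP S1 (smult t R) = cP q\<close> by (simp add: opP_smult)
  \<comment> \<open>\<open>q\<close> has constant coefficients, so at an index where the limit is
    nonzero the scalar s itself has a finite nonzero limit.\<close>
  moreover obtain k where k: "coeff (s' * r) k \<noteq> 0" using s t
    by (metis mult_eq_0_iff leading_coeff_0_iff)
  ultimately have *: "tends (s * cK (coeff q k)) (coeff (s' * r) k)"
    by (auto simp: ptends_def coeff_map_poly)
  then have qk: "coeff q k \<noteq> 0" using k by (metis mult_zero_right cK_hom.hom_zero tends_0)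
  define s0 where "s0 = coeff (s' * r) k * (1 / coeff q k)"
  have s0: "tends s s0" "s0 \<noteq> 0"
    using tends_mult[OF *, of "cK (1 / coeff q k)" "1 / coeff q k"] qk k
    by (simp_all add: s0_def mult.assoc flip: cK_hom.hom_mult)
  \<comment> \<open>The leading coefficient of \<open>S1\<close> is a shift of 1/t because
    \<open>S\<close> is monic. Dividing by s gives a finite limit for 1/t, and R = (1/t) (t R) then
    has one too.\<close>
  have "tends (s * (1 / (sigK ^^ degree S) t)) (coeff s' (degree S))"
    using s(3) S1l unfolding ptends_def by (metis coeff_smult)
  from tends_mult[OF tends_inverse[OF s0] this]
  have "tends ((sigK ^^ degree S) (1 / t)) (1 / s0 * coeff s' (degree S))"
    using s(1) by (simp add: sigK_pow_inverse)
  then have "tends (1 / t) (1 / s0 * coeff s' (degree S))" by simp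
  from ptends_smult[OF this t(3)] show ?thesis using t(1) that by simp
qed

section \<open>The left module generated by a monic operator\<close>

text \<open>Operators compose associatively as maps on \<open>ratF\<close>, and the injectivity of
  \<open>io\<close> carries this back to K[w].\<close>

lemma opP_opP: "opP (opP P S) G = opP P (opP S G)"
proof -
  have "io (opP (opP P S) G) = io (opP P (opP S G))"
    using lop_T_io[of 1 "opP P S" G] lop_T_io[of 1 S G] lop_T_io[of 1 P "opP S G"]
    by (simp add: lop_opP)
  then show ?thesis by (simp add: io_hom.eq_iff)
qed

lemma opP_uminus: "opP (- S) G = - opP S G"
  using opP_smult[of "-1" S G] by simp

lemma opP_diff: "opP (S - S') G = opP S G - opP S' G"
  using opP_add[of S "- S'" G] by (simp add: opP_uminus)

text \<open>A nonzero left multiple of a monic operator has at least its degree. Hence a class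
  modulo the left module has at most one representative of smaller degree.\<close>

lemma opP_degree_lt:
  assumes "lead_coeff R = 1" "\<And>k. k \<ge> degree R \<Longrightarrow> coeff (opP Q R) k = 0"
  shows "opP Q R = 0"
proof (rule ccontr)
  assume *: "opP Q R \<noteq> 0"
  then have "Q \<noteq> 0" by auto
  then have "degree (opP Q R) \<ge> degree R" using opP_degree(1)[OF assms(1)] by simp
  then have "lead_coeff (opP Q R) = 0" by (rule assms(2))
  then show False using * by simp
qed

text \<open>Division by a monic operator only subtracts multiples of its images under powers of
  \<open>TP\<close>, so the remainder keeps its coefficients in \<open>A\<close>. Below,
  \<open>A\<close> is all of K for reduction modulo \<open>R\<close> and C[n] for reduction modulo
  \<open>q\<close>.\<close>

lemma reduce_mod_operator:
  assumes H: "lead_coeff H = 1"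
    and A: "0 \<in> A" "\<And>a b. a \<in> A \<Longrightarrow> b \<in> A \<Longrightarrow> a - b \<in> A" "\<And>a b. a \<in> A \<Longrightarrow> b \<in> A \<Longrightarrow> a * b \<in> A"
    and HA: "\<And>k i. coeff ((TP ^^ k) H) i \<in> A" and GA: "\<And>i. coeff G i \<in> A"
  obtains e Q where "G = e + opP Q H" "\<And>k. k \<ge> degree H \<Longrightarrow> coeff e k = 0" "\<And>i. coeff e i \<in> A"
proof -
  have "\<exists>e Q. G = e + opP Q H \<and> (\<forall>k\<ge>degree H. coeff e k = 0) \<and> (\<forall>i. coeff e i \<in> A)"
    if "\<forall>k\<ge>degree H + M. coeff G k = 0" "\<forall>i. coeff G i \<in> A" for M
    using that
  proof (induction M arbitrary: G)
    case 0
    then show ?case by (intro exI[of _ G] exI[of _ 0]) auto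
  next
    case (Suc M)
    define c where "c = coeff G (degree H + M)"
    define G' where "G' = G - smult c ((TP ^^ M) H)"
    have "coeff G' k = 0" if "k \<ge> degree H + M" for k
    proof (cases "k = degree H + M")
      case True
      then show ?thesis using TP_pow_monic(2)[OF H, of M] by (simp add: G'_def c_def)
    next
      case False
      then show ?thesis using that Suc.prems(1) TP_pow_monic(1)[OF H, of M]
        by (simp add: G'_def coeff_eq_0)
    qed
    moreover have "coeff G' i \<in> A" for i
      unfolding G'_def c_def coeff_diff coeff_smult using Suc.prems(2) HA by (intro A) auto
    ultimately obtain e Q where *: "G' = e + opP Q H" "\<forall>k\<ge>degree H. coeff e k = 0" "\<forall>i. coeff e i \<in> A"
      using Suc.IH[of G'] by blast
    have "G = e + opP (Q + monom c M) H"
      using *(1) by (simp add: opP_add opP_monom G'_def algebra_simps)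
    then show ?case using * by blast
  qed
  from this[of "Suc (degree G)"] GA show ?thesis using that by (auto simp: coeff_eq_0)
qed

lemma TP_cP: "TP (cP p) = cP (pCons 0 p)"
proof (rule poly_eqI)
  fix i show "coeff (TP (cP p)) i = coeff (cP (pCons 0 p)) i"
    by (cases i) (simp_all add: coeff_map_poly)
qed

lemma TP_pow_cP: "(TP ^^ k) (cP q) = cP (monom 1 k * q)"
  by (induction k) (simp_all add: TP_cP monom_Suc del: map_poly_pCons)

text \<open>\<open>SR\<close> places the constant-coefficient polynomial \<open>q\<close> in the
  left module generated by \<open>R\<close>. \<open>lim\<close> is supplied by
  \<open>monic_right_divisor_has_limit\<close>; \<open>R0\<close> holds once a power of w is split
  off and will make the matrix B invertible.\<close>

locale darboux_data =
  fixes R S :: "ratK poly" and q \<theta> :: "complex poly"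
  assumes R: "lead_coeff R = 1" and q: "lead_coeff q = 1"
    and SR: "opP S R = cP q" and lim: "ptends R \<theta>" and R0: "coeff R 0 \<noteq> 0"
begin

abbreviation "d \<equiv> degree R"

definition J :: "ratK poly set" where "J = {opP Q R |Q. True}"

text \<open>\<open>range to_fract\<close> is C[n] inside K. By \<open>J_degree\<close> the first
  condition makes g the only such representative of its class modulo \<open>J\<close>.\<close>

definition V :: "ratK poly set" where
  "V = {g. (\<forall>k\<ge>d. coeff g k = 0) \<and> (\<forall>k. tends (coeff g k) 0) \<and>
     (\<exists>p. (\<forall>i. coeff p i \<in> range to_fract) \<and> g - p \<in> J)}"

lemma J_add: "x \<in> J \<Longrightarrow> y \<in> J \<Longrightarrow> x + y \<in> J"
  by (auto simp: J_def) (metis opP_add)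

lemma J_smult: "x \<in> J \<Longrightarrow> smult a x \<in> J"
  by (auto simp: J_def) (metis opP_smult)

lemma J_diff: "x \<in> J \<Longrightarrow> y \<in> J \<Longrightarrow> x - y \<in> J"
  by (auto simp: J_def) (metis opP_diff)

lemma J_TP: "x \<in> J \<Longrightarrow> TP x \<in> J"
  by (auto simp: J_def) (metis opP_TP)

lemma J_sum: "(\<And>i. i \<in> I \<Longrightarrow> x i \<in> J) \<Longrightarrow> (\<Sum>i\<in>I. x i) \<in> J"
proof (induction I rule: infinite_finite_induct)
  case empty
  have "opP 0 R \<in> J" unfolding J_def by blast
  then show ?case by simp
next
  case (infinite I)
  have "opP 0 R \<in> J" unfolding J_def by blast
  then show ?case using infinite by simp
qed (auto intro: J_add)

lemma R_in_J: "R \<in> J"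
  unfolding J_def using opP_monom[of 1 0 R] by (auto intro!: exI[of _ "monom 1 0"])

lemma J_degree: "x \<in> J \<Longrightarrow> (\<And>k. k \<ge> d \<Longrightarrow> coeff x k = 0) \<Longrightarrow> x = 0"
  unfolding J_def using opP_degree_lt[OF R] by blast

lemma poly_closed:
  "(0::ratK) \<in> range to_fract"
  "a \<in> range to_fract \<Longrightarrow> b \<in> range to_fract \<Longrightarrow> a - b \<in> range (to_fract :: _ \<Rightarrow> ratK)"
  "a \<in> range to_fract \<Longrightarrow> b \<in> range to_fract \<Longrightarrow> a * b \<in> range (to_fract :: _ \<Rightarrow> ratK)"
  by (auto simp flip: to_fract_0 to_fract_diff to_fract_mult)

lemma poly_closed_add: "a \<in> range to_fract \<Longrightarrow> b \<in> range to_fract \<Longrightarrow> a + b \<in> range (to_fract :: _ \<Rightarrow> ratK)"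
  by (auto simp flip: to_fract_add)

lemma poly_closed_sum: "(\<And>i. i \<in> I \<Longrightarrow> a i \<in> range to_fract) \<Longrightarrow> (\<Sum>i\<in>I. a i) \<in> range (to_fract :: _ \<Rightarrow> ratK)"
  by (induction I rule: infinite_finite_induct) (auto intro: poly_closed_add poly_closed)

lemma cK_poly [simp]: "cK c \<in> range to_fract" by (simp add: cK_def)

text \<open>Modulo q, an element of C[n][w] reduces to degree below that of q with coefficients
  still in C[n]. Only the finitely many powers w^k with k < deg q remain to be reduced modulo R, and
  the product of their denominators serves for all of V.\<close>

lemma V_bounded_denominator:
  obtains \<delta> :: "complex poly" where "\<delta> \<noteq> 0" "\<And>g k. g \<in> V \<Longrightarrow> to_fract \<delta> * coeff g k \<in> range to_fract"
proof -
  have "\<exists>e. monom 1 k - e \<in> J \<and> (\<forall>i\<ge>d. coeff e i = 0)" for k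
  proof -
    obtain e Q where "monom 1 k = e + opP Q R" "\<And>i. i \<ge> d \<Longrightarrow> coeff e i = 0"
      by (rule reduce_mod_operator[OF R, of UNIV]) auto
    then show ?thesis by (intro exI[of _ e]) (auto simp: J_def)
  qed
  then obtain e where e: "\<And>k. monom 1 k - e k \<in> J" "\<And>k i. i \<ge> d \<Longrightarrow> coeff (e k) i = 0" by metis
  have "\<exists>x::complex poly. x \<noteq> 0 \<and> (\<forall>i. to_fract x * coeff (e k) i \<in> range to_fract)" for k
  proof -
    obtain x p where x: "x \<noteq> 0" "smult (to_fract x) (e k) = fract_poly p"
      by (rule exists_common_denominator)
    have "to_fract x * coeff (e k) i = to_fract (coeff p i)" for i
      using arg_cong[OF x(2), of "\<lambda>p. coeff p i"] by (simp add: coeff_map_poly)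
    then show ?thesis using x(1) by auto
  qed
  then obtain x :: "nat \<Rightarrow> complex poly" where x: "\<And>k. x k \<noteq> 0" "\<And>k i. to_fract (x k) * coeff (e k) i \<in> range to_fract" by metis
  define \<delta> where "\<delta> = (\<Prod>k<degree q. x k)"
  have \<delta>e: "to_fract \<delta> * coeff (e k) i \<in> range to_fract" if "k < degree q" for k i
  proof -
    have "\<delta> = (\<Prod>j\<in>{..<degree q} - {k}. x j) * x k"
      unfolding \<delta>_def using that by (subst prod.remove[of _ k]) auto
    then have eq: "to_fract \<delta> * coeff (e k) i = to_fract (\<Prod>j\<in>{..<degree q} - {k}. x j) * (to_fract (x k) * coeff (e k) i)"
      by (simp add: mult.assoc)
    show ?thesis unfolding eq by (intro poly_closed(3) x(2)) simp
  qed
  have "to_fract \<delta> * coeff g k \<in> range to_fract" if g: "g \<in> V" for g k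
  proof -
    obtain p where p: "\<And>i. coeff p i \<in> range to_fract" "g - p \<in> J" and gd: "\<And>k. k \<ge> d \<Longrightarrow> coeff g k = 0"
      using g unfolding V_def by auto
    have "lead_coeff (cP q) = 1" using q by simp
    then obtain r Q where r: "p = r + opP Q (cP q)" "\<And>k. k \<ge> degree q \<Longrightarrow> coeff r k = 0" "\<And>i. coeff r i \<in> range to_fract"
      by (rule reduce_mod_operator[OF _ poly_closed _ p(1)]) (auto simp: TP_pow_cP coeff_map_poly)
    \<comment> \<open>As q = S R, the product Q q = (Q S) R is a left multiple of R.\<close>
    have "opP Q (cP q) \<in> J" unfolding SR[symmetric] opP_opP[symmetric] J_def by blast
    then have 1: "g - r \<in> J" using J_add[OF p(2)] r(1) by fastforce
    have rs: "r = (\<Sum>k<degree q. smult (coeff r k) (monom 1 k))"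
      by (rule poly_eqI) (use r(2) in \<open>auto simp: smult_monom coeff_sum not_less\<close>)
    have 2: "r - (\<Sum>k<degree q. smult (coeff r k) (e k)) \<in> J"
    proof -
      have "(\<Sum>k<degree q. smult (coeff r k) (monom 1 k - e k)) \<in> J"
        by (intro J_sum J_smult e)
      then show ?thesis by (subst rs) (simp add: smult_diff_right sum_subtractf)
    qed
    \<comment> \<open>Both terms have degree below d and differ by an element of J, hence
      coincide.\<close>
    have "g - (\<Sum>k<degree q. smult (coeff r k) (e k)) = 0"
      using J_add[OF 1 2] by (intro J_degree) (auto simp: gd e coeff_sum)
    then have "to_fract \<delta> * coeff g k = (\<Sum>j<degree q. coeff r j * (to_fract \<delta> * coeff (e j) k))"
      by (simp add: coeff_sum sum_distrib_left mult.left_commute)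
    then show ?thesis by (simp only:) (intro poly_closed_sum poly_closed(3)[OF r(3) \<delta>e], simp)
  qed
  moreover have "\<delta> \<noteq> 0" using x(1) by (simp add: \<delta>_def)
  ultimately show ?thesis using that by blast
qed

section \<open>Finite dimension of \<open>V\<close> over the complex numbers\<close>

sublocale cs: vector_space "\<lambda>c g. smult (cK c) (g :: ratK poly)"
  by unfold_locales (simp_all add: smult_add_right smult_add_left cK_hom.hom_add cK_hom.hom_mult)

text \<open>Over the common denominator \<delta> each coefficient is x/\<delta> with x = 0 or deg x
  < deg \<delta>, the strict bound expressing vanishing at infinity. Hence the products n^i w^k /
  \<delta> with i < deg \<delta> and k < d suffice.\<close>

lemma V_in_finite_span: "\<exists>F. finite F \<and> V \<subseteq> cs.span F"
proof -
  obtain \<delta> :: "complex poly" where \<delta>: "\<delta> \<noteq> 0" "\<And>g k. g \<in> V \<Longrightarrow> to_fract \<delta> * coeff g k \<in> range to_fract"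
    using V_bounded_denominator by blast
  define m where "m i k = monom (nK ^ i / to_fract \<delta>) k" for i k
  define F where "F = (\<lambda>(i,k). m i k) ` ({..<degree \<delta>} \<times> {..<d})"
  have "g \<in> cs.span F" if g: "g \<in> V" for g
  proof -
    have "monom (coeff g k) k \<in> cs.span F" if "k < d" for k
    proof -
      obtain x where x: "to_fract \<delta> * coeff g k = to_fract x" using \<delta>(2)[OF g, of k] by auto
      then have gk: "coeff g k = Fract x \<delta>" using \<delta>(1) by (simp add: Fract_conv_to_fract field_simps)
      have "tends (coeff g k) 0" using g by (simp add: V_def)
      then have dx: "degree x \<le> degree \<delta>" "coeff x (degree \<delta>) = 0" using \<delta>(1) unfolding gk by (simp_all add: tends_Fract)
      have "to_fract x = (\<Sum>i\<le>degree x. cK (coeff x i) * nK ^ i)"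
        unfolding poly_cP_nK[symmetric] by (simp add: poly_altdef coeff_map_poly)
      also have "\<dots> = (\<Sum>i<degree \<delta>. cK (coeff x i) * nK ^ i)"
        using dx le_neq_implies_less by (intro sum.mono_neutral_cong) (auto simp: coeff_eq_0 not_less not_le dest: le_neq_implies_less)
      finally have "coeff g k = (\<Sum>i<degree \<delta>. cK (coeff x i) * nK ^ i) / to_fract \<delta>"
        by (simp add: gk Fract_conv_to_fract)
      then have "monom (coeff g k) k = (\<Sum>i<degree \<delta>. smult (cK (coeff x i)) (m i k))"
        by (simp add: m_def smult_monom sum_divide_distrib monom_hom.hom_sum)
      moreover have "m i k \<in> F" if "i < degree \<delta>" for i
        using that \<open>k < d\<close> by (auto simp: F_def)
      ultimately show ?thesis by (auto intro!: cs.span_sum cs.span_scale intro: cs.span_base)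
    qed
    moreover have "g = (\<Sum>k<d. monom (coeff g k) k)"
      using g by (intro poly_eqI) (auto simp: coeff_sum V_def not_less)
    ultimately show ?thesis by (metis (no_types, lifting) cs.span_sum lessThan_iff)
  qed
  moreover have "finite F" by (simp add: F_def)
  ultimately show ?thesis by blast
qed

lemma V_I:
  assumes "\<And>k. k \<ge> d \<Longrightarrow> coeff g k = 0" "\<And>k. tends (coeff g k) 0"
    "\<And>i. coeff p i \<in> range to_fract" "g - p \<in> J"
  shows "g \<in> V"
  using assms unfolding V_def by blast

lemma V_subspace: "cs.subspace V"
proof (rule cs.subspaceI)
  show "0 \<in> V" using R_in_J J_smult[of R 0] by (auto simp: V_def intro!: exI[of _ 0] simp del: smult_0_left) simp
next
  fix x y assume x: "x \<in> V" and y: "y \<in> V"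
  from x obtain p where p: "\<forall>i. coeff p i \<in> range to_fract" "x - p \<in> J" by (auto simp: V_def)
  from y obtain r where r: "\<forall>i. coeff r i \<in> range to_fract" "y - r \<in> J" by (auto simp: V_def)
  have "x + y - (p + r) \<in> J" using J_add[OF p(2) r(2)] by (simp add: algebra_simps)
  moreover have "\<forall>i. coeff (p + r) i \<in> range to_fract" using p r by (auto intro: poly_closed_add)
  moreover have "tends (coeff (x + y) k) 0" for k
    using x y tends_add[of "coeff x k" 0 "coeff y k" 0] by (simp add: V_def)
  ultimately show "x + y \<in> V" using x y by (intro V_I[of _ "p + r"]) (auto simp: V_def)
next
  fix c x assume x: "x \<in> V"
  from x obtain p where p: "\<forall>i. coeff p i \<in> range to_fract" "x - p \<in> J" by (auto simp: V_def)
  have "smult (cK c) x - smult (cK c) p \<in> J" using J_smult[OF p(2)] by (simp add: smult_diff_right)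
  moreover have "\<forall>i. coeff (smult (cK c) p) i \<in> range to_fract" using p by (auto intro: poly_closed(3))
  moreover have "tends (coeff (smult (cK c) x) k) 0" for k
    using x tends_mult[of "cK c" c "coeff x k" 0] by (simp add: V_def)
  ultimately show "smult (cK c) x \<in> V" using x by (intro V_I[of _ "smult (cK c) p"]) (auto simp: V_def)
qed

lemma V_basis:
  obtains N :: nat and b :: "nat \<Rightarrow> ratK poly" where "\<And>i. i < N \<Longrightarrow> b i \<in> V"
    "\<And>g. g \<in> V \<Longrightarrow> \<exists>x. g = (\<Sum>i<N. smult (cK (x i)) (b i))"
    "\<And>x. (\<Sum>i<N. smult (cK (x i)) (b i)) = 0 \<Longrightarrow> (\<forall>i<N. x i = 0)"
proof -
  obtain F where F: "finite F" "V \<subseteq> cs.span F" using V_in_finite_span by blast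
  obtain Bs where Bs: "Bs \<subseteq> V" "cs.independent Bs" "V \<subseteq> cs.span Bs"
    using cs.maximal_independent_subset[of V] by blast
  have fin: "finite Bs"
    using cs.independent_span_bound[OF F(1) Bs(2)] Bs(1) F(2) by auto
  define N where "N = card Bs"
  obtain b where b: "bij_betw b {..<N} Bs"
    using ex_bij_betw_nat_finite[OF fin] by (auto simp: N_def lessThan_atLeast0)
  show ?thesis
  proof (rule that[of N b])
    show "b i \<in> V" if "i < N" for i using that b Bs(1) by (auto dest: bij_betwE)
    show "\<exists>x. g = (\<Sum>i<N. smult (cK (x i)) (b i))" if "g \<in> V" for g
    proof -
      have "g \<in> cs.span Bs" using that Bs by auto
      then obtain u where "g = (\<Sum>v\<in>Bs. smult (cK (u v)) v)"
        unfolding cs.span_finite[OF fin] by auto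
      then have "g = (\<Sum>i<N. smult (cK (u (b i))) (b i))"
        using sum.reindex_bij_betw[OF b, of "\<lambda>v. smult (cK (u v)) v"] by simp
      then show ?thesis by (intro exI[of _ "\<lambda>i. u (b i)"])
    qed
    show "\<forall>i<N. x i = 0" if 0: "(\<Sum>i<N. smult (cK (x i)) (b i)) = 0" for x
    proof (intro allI impI)
      fix i assume i: "i < N"
      define u where "u v = x (the_inv_into {..<N} b v)" for v
      have ub: "u (b i) = x i" if "i < N" for i
        using that b by (simp add: u_def the_inv_into_f_f bij_betw_def)
      have "(\<Sum>v\<in>Bs. smult (cK (u v)) v) = 0"
        using sum.reindex_bij_betw[OF b, of "\<lambda>v. smult (cK (u v)) v"] 0 by (simp add: ub)
      moreover have "b i \<in> Bs" using b i by (auto dest: bij_betwE)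
      ultimately show "x i = 0" using cs.independentD[OF Bs(2) fin subset_refl] ub[OF i] by metis
    qed
  qed
qed

end


section \<open>The pair of matrices attached to a transform\<close>

lemma TP_diff: "TP (G - H) = TP G - TP H"
  using TP_add[of "G - H" H] by simp

lemma index_row_mult:
  assumes "P \<in> carrier_mat 1 n" "Q \<in> carrier_mat n m" "j < m"
  shows "(P * Q) $$ (0,j) = (\<Sum>k<n. P $$ (0,k) * Q $$ (k,j))"
  using assms by (auto simp: scalar_prod_def lessThan_atLeast0 intro!: sum.cong)

lemma minus_minus_cancel_mat:
  fixes P :: "'a :: ab_group_add mat"
  assumes "P \<in> carrier_mat n m" "Q \<in> carrier_mat n m" "X \<in> carrier_mat n m"
  shows "P - X - (Q - X) = P - Q"
  using assms by (intro eq_matI) auto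

lemma sigK_to_fract_poly: "x \<in> range to_fract \<Longrightarrow> sigK x \<in> range to_fract"
  by (auto simp: sigK_def shift_hom.fract_map_to_fract)

context darboux_data
begin

lemma theta_coeff: "coeff \<theta> d = 1" "k > d \<Longrightarrow> coeff \<theta> k = 0"
proof -
  have "tends (coeff R d) (coeff \<theta> d)" using lim by (simp add: ptends_def)
  then show "coeff \<theta> d = 1" using R by simp
  show "coeff \<theta> k = 0" if "k > d"
  proof -
    have "tends (coeff R k) (coeff \<theta> k)" using lim by (simp add: ptends_def)
    then show ?thesis using that by (simp add: coeff_eq_0)
  qed
qed

lemma theta_monic: "lead_coeff \<theta> = 1" "degree \<theta> = d"
proof -
  show d: "degree \<theta> = d"
    using theta_coeff by (intro le_antisym degree_le le_degree) auto
  show "lead_coeff \<theta> = 1" unfolding d by (rule theta_coeff(1))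
qed

text \<open>\<open>T\<close> preserves J, C[n][w] and vanishing at infinity; only the degree may
  reach d. Subtracting a multiple of \<open>R\<close> to remove the top term is harmless, since its
  factor tends to 0 and \<open>R\<close> has a limit.\<close>

lemma V_shift:
  assumes "g \<in> V"
  shows "TP g - smult (coeff (TP g) d) R \<in> V"
proof -
  obtain p where p: "\<And>i. coeff p i \<in> range to_fract" "g - p \<in> J"
    and g: "\<And>k. k \<ge> d \<Longrightarrow> coeff g k = 0" "\<And>k. tends (coeff g k) 0"
    using assms unfolding V_def by auto
  have t: "tends (coeff (TP g) k) 0" for k using g(2) by (cases k) auto
  show ?thesis
  proof (rule V_I[of _ "TP p"])
    fix k assume "k \<ge> d"
    show "coeff (TP g - smult (coeff (TP g) d) R) k = 0"
    proof (cases "k = d")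
      case True
      then show ?thesis using R by simp
    next
      case False
      then obtain k' where k': "k = Suc k'" "k' \<ge> d" using \<open>k \<ge> d\<close> by (cases k) auto
      then show ?thesis using g(1) by (simp add: coeff_eq_0)
    qed
  next
    fix k
    have "tends (coeff R k) (coeff \<theta> k)" using lim by (simp add: ptends_def)
    then show "tends (coeff (TP g - smult (coeff (TP g) d) R) k) 0"
      using tends_diff[OF t[of k] tends_mult[OF t[of d]]] by fastforce
  next
    fix i show "coeff (TP p) i \<in> range to_fract"
      using p(1) by (cases i) (auto intro: sigK_to_fract_poly poly_closed)
  next
    have eq: "TP g - smult (coeff (TP g) d) R - TP p = TP (g - p) - smult (coeff (TP g) d) R"
      by (simp add: TP_diff)
    show "TP g - smult (coeff (TP g) d) R - TP p \<in> J"
      unfolding eq by (intro J_diff J_TP J_smult p(2) R_in_J)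
  qed
qed

text \<open>n g has a limit c in C[w] because g vanishes at infinity, and n g - c vanishes there
  again. J is stable under multiplication by n.\<close>

lemma V_mult_n:
  assumes "g \<in> V"
  shows "\<exists>c. smult nK g - cP c \<in> V"
proof -
  obtain p where p: "\<And>i. coeff p i \<in> range to_fract" "g - p \<in> J"
    and g: "\<And>k. k \<ge> d \<Longrightarrow> coeff g k = 0" "\<And>k. tends (coeff g k) 0"
    using assms unfolding V_def by auto
  obtain e where e: "\<And>k. tends (nK * coeff g k) (e k)"
    using tends_nK_mult[OF g(2)] by metis
  define c where "c = (\<Sum>k<d. monom (e k) k)"
  have ck: "coeff c k = e k" for k
    using e[of k] g(1)[of k] by (auto simp: c_def coeff_sum not_less)
  show ?thesis
  proof (intro exI[of _ c] V_I[of _ "smult nK p - cP c"])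
    fix k assume "k \<ge> d"
    then show "coeff (smult nK g - cP c) k = 0"
      using g(1)[of k] e[of k] by (simp add: ck)
  next
    fix k show "tends (coeff (smult nK g - cP c) k) 0"
      using tends_diff[OF e[of k], of "cK (e k)" "e k"] by (simp add: ck)
  next
    fix i
    have "nK \<in> range to_fract" by (simp add: nK_def)
    then show "coeff (smult nK p - cP c) i \<in> range to_fract"
      using p(1) by (auto intro!: poly_closed(2,3))
  next
    have "smult nK g - cP c - (smult nK p - cP c) = smult nK (g - p)"
      by (simp add: smult_diff_right)
    then show "smult nK g - cP c - (smult nK p - cP c) \<in> J" using J_smult[OF p(2)] by simp
  qed
qed

text \<open>R lies in J, so R - \<theta> is congruent to -\<theta>, and \<theta> is the limit of R
  with the same leading term.\<close>

lemma V_generator: "R - cP \<theta> \<in> V"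
proof (rule V_I[of _ "- cP \<theta>"])
  fix k assume "k \<ge> d"
  then show "coeff (R - cP \<theta>) k = 0"
    using theta_coeff R by (cases "k = d") (auto simp: coeff_eq_0)
next
  fix k
  have "tends (coeff R k) (coeff \<theta> k)" using lim by (simp add: ptends_def)
  from tends_diff[OF this, of "cK (coeff \<theta> k)" "coeff \<theta> k"]
  show "tends (coeff (R - cP \<theta>) k) 0" by simp
next
  fix i
  have "- cK x \<in> range to_fract" for x by (simp flip: cK_hom.hom_uminus)
  then show "coeff (- cP \<theta>) i \<in> range to_fract" by simp
qed (use R_in_J in simp)

end

section \<open>Coordinates on \<open>V\<close> and the matrices of its two endomorphisms\<close>

locale darboux_basis = darboux_data +
  fixes N :: nat and b :: "nat \<Rightarrow> ratK poly"
  assumes b_V: "i < N \<Longrightarrow> b i \<in> V"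
    and b_span: "g \<in> V \<Longrightarrow> \<exists>x. g = (\<Sum>i<N. smult (cK (x i)) (b i))"
    and b_indep: "(\<Sum>i<N. smult (cK (x i)) (b i)) = 0 \<Longrightarrow> \<forall>i<N. x i = 0"
begin

definition phi :: "complex vec \<Rightarrow> ratK poly" where
  "phi x = (\<Sum>i<N. smult (cK (x $ i)) (b i))"

lemma phi_V: "phi x \<in> V"
  unfolding phi_def using V_subspace b_V by (intro cs.subspace_sum cs.subspace_scale) auto

lemma phi_smult: "x \<in> carrier_vec N \<Longrightarrow> phi (c \<cdot>\<^sub>v x) = smult (cK c) (phi x)"
  by (simp add: phi_def cK_hom.hom_mult smult_sum2)

lemma phi_diff: "x \<in> carrier_vec N \<Longrightarrow> y \<in> carrier_vec N \<Longrightarrow> phi (x - y) = phi x - phi y"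
  by (simp add: phi_def cK_hom.hom_minus smult_diff_left sum_subtractf)

lemma phi_inj:
  assumes "x \<in> carrier_vec N" "phi x = 0"
  shows "x = 0\<^sub>v N"
proof -
  have "\<forall>i<N. x $ i = 0"
    by (rule b_indep) (use assms(2) in \<open>simp only: phi_def\<close>)
  then show ?thesis using assms(1) by (intro eq_vecI) simp_all
qed

lemma phi_surj:
  assumes "g \<in> V" obtains x where "x \<in> carrier_vec N" "phi x = g"
proof -
  obtain x where "g = (\<Sum>i<N. smult (cK (x i)) (b i))" using b_span[OF assms] by blast
  then have "phi (vec N x) = g" by (simp add: phi_def)
  then show ?thesis using that[of "vec N x"] by simp
qed

lemma phi_mat:
  assumes M: "\<And>j. j < N \<Longrightarrow> phi (col M j) = F j" "M \<in> carrier_mat N N" and x: "x \<in> carrier_vec N"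
  shows "phi (M *\<^sub>v x) = (\<Sum>j<N. smult (cK (x $ j)) (F j))"
proof -
  have "phi (M *\<^sub>v x) = (\<Sum>i<N. \<Sum>j<N. smult (cK (x $ j)) (smult (cK (M $$ (i,j))) (b i)))"
    unfolding phi_def using M(2) x
    by (intro sum.cong) (auto simp: scalar_prod_def lessThan_atLeast0 cK_hom.hom_sum cK_hom.hom_mult
        smult_sum mult.commute)
  also have "\<dots> = (\<Sum>j<N. smult (cK (x $ j)) (\<Sum>i<N. smult (cK (M $$ (i,j))) (b i)))"
    by (subst sum.swap) (simp add: smult_sum2)
  also have "\<dots> = (\<Sum>j<N. smult (cK (x $ j)) (phi (col M j)))"
    using M(2) by (simp add: phi_def)
  finally show ?thesis using M(1) by simp
qed

lemma mat_of_images: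
  assumes "\<And>j. j < N \<Longrightarrow> F j \<in> V"
  obtains M where "M \<in> carrier_mat N N" "\<And>j. j < N \<Longrightarrow> phi (col M j) = F j"
proof -
  have "\<exists>x. j < N \<longrightarrow> x \<in> carrier_vec N \<and> phi x = F j" for j
    using phi_surj[OF assms] by metis
  then obtain x where x: "\<And>j. j < N \<Longrightarrow> x j \<in> carrier_vec N" "\<And>j. j < N \<Longrightarrow> phi (x j) = F j" by metis
  have "col (mat N N (\<lambda>(i,j). x j $ i)) j = x j" if "j < N" for j
    using x(1)[OF that] that by (intro eq_vecI) auto
  then show ?thesis using x(2) that[of "mat N N (\<lambda>(i,j). x j $ i)"] by simp
qed

text \<open>\<open>B\<close> is the matrix of the map in \<open>V_shift\<close>. A kernel vector
  would give T g = h R; the constant term of T g is 0 and that of R is not, so h = 0 and g =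
  0.\<close>

lemma shift_matrix:
  obtains B where "B \<in> carrier_mat N N"
    "\<And>x. x \<in> carrier_vec N \<Longrightarrow> phi (B *\<^sub>v x) = TP (phi x) - smult (coeff (TP (phi x)) d) R"
    "det B \<noteq> 0"
proof -
  obtain B where B: "B \<in> carrier_mat N N"
    "\<And>j. j < N \<Longrightarrow> phi (col B j) = TP (b j) - smult (coeff (TP (b j)) d) R"
    using mat_of_images[of "\<lambda>j. TP (b j) - smult (coeff (TP (b j)) d) R"] b_V V_shift by blast
  have phiB: "phi (B *\<^sub>v x) = TP (phi x) - smult (coeff (TP (phi x)) d) R" if x: "x \<in> carrier_vec N" for x
  proof -
    have T: "TP (phi x) = (\<Sum>j<N. smult (cK (x $ j)) (TP (b j)))"
      by (simp add: phi_def TP_sum TP_smult)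
    have "phi (B *\<^sub>v x) = (\<Sum>j<N. smult (cK (x $ j)) (TP (b j) - smult (coeff (TP (b j)) d) R))"
      by (rule phi_mat[OF _ B(1) x]) (rule B(2))
    then show ?thesis
      unfolding T
      by (simp add: smult_diff_right sum_subtractf coeff_sum smult_sum)
  qed
  have "det B \<noteq> 0"
  proof
    assume "det B = 0"
    then obtain x where x: "x \<in> carrier_vec N" "x \<noteq> 0\<^sub>v N" "B *\<^sub>v x = 0\<^sub>v N"
      using det_0_iff_vec_prod_zero_field[OF B(1)] by auto
    have eq: "TP (phi x) = smult (coeff (TP (phi x)) d) R"
      using phiB[OF x(1)] by (simp add: x(3)) (simp add: phi_def)
    have "coeff (TP (phi x)) d * coeff R 0 = 0"
      using arg_cong[OF eq, of "\<lambda>p. coeff p 0"] by simp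
    then have 0: "TP (phi x) = 0" using R0 by (subst eq) simp
    have "coeff (phi x) k = 0" for k
    proof -
      have "coeff (TP (phi x)) (Suc k) = 0" by (simp only: 0 coeff_0)
      then show ?thesis by simp
    qed
    then have "phi x = 0" by (intro poly_eqI) simp
    then show False using phi_inj x by blast
  qed
  then show ?thesis using that B(1) phiB by blast
qed

text \<open>\<open>c j\<close> is the limit of n b_j, so the correction to multiplication by n
  depends linearly on the coordinates.\<close>

lemma mult_n_matrix:
  obtains \<Xi> c where "\<Xi> \<in> carrier_mat N N"
    "\<And>x. x \<in> carrier_vec N \<Longrightarrow> phi (\<Xi> *\<^sub>v x) = smult nK (phi x) - cP (\<Sum>j<N. smult (x $ j) (c j))"
proof -
  have "\<exists>c. j < N \<longrightarrow> smult nK (b j) - cP c \<in> V" for j using V_mult_n b_V by blast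
  then obtain c where c: "\<And>j. j < N \<Longrightarrow> smult nK (b j) - cP (c j) \<in> V" by metis
  obtain M where M: "M \<in> carrier_mat N N" "\<And>j. j < N \<Longrightarrow> phi (col M j) = smult nK (b j) - cP (c j)"
    using mat_of_images[of "\<lambda>j. smult nK (b j) - cP (c j)"] c by blast
  have "phi (M *\<^sub>v x) = smult nK (phi x) - cP (\<Sum>j<N. smult (x $ j) (c j))" if x: "x \<in> carrier_vec N" for x
  proof -
    have "phi (M *\<^sub>v x) = (\<Sum>j<N. smult (cK (x $ j)) (smult nK (b j) - cP (c j)))"
      by (rule phi_mat[OF _ M(1) x]) (rule M(2))
    then show ?thesis
    by (simp add: phi_def[of x] smult_diff_right sum_subtractf smult_sum2 cP_hom.hom_sum cK_hom.map_poly_hom_smult mult.commute)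
  qed
  then show ?thesis using that M(1) by blast
qed

end

locale darboux_matrices = darboux_basis +
  fixes B \<Xi> :: "complex mat" and c :: "nat \<Rightarrow> complex poly" and u :: "complex vec"
  assumes B: "B \<in> carrier_mat N N" and Xi: "\<Xi> \<in> carrier_mat N N" and u: "u \<in> carrier_vec N"
    and phi_B: "x \<in> carrier_vec N \<Longrightarrow> phi (B *\<^sub>v x) = TP (phi x) - smult (coeff (TP (phi x)) d) R"
    and det_B: "det B \<noteq> 0"
    and phi_Xi: "x \<in> carrier_vec N \<Longrightarrow> phi (\<Xi> *\<^sub>v x) = smult nK (phi x) - cP (\<Sum>j<N. smult (x $ j) (c j))"
    and phi_u: "phi u = R - cP \<theta>"
begin

text \<open>The limit at infinity of n times \<open>phi x\<close>.\<close>

definition kap :: "complex vec \<Rightarrow> complex poly" where "kap x = (\<Sum>j<N. smult (x $ j) (c j))"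

text \<open>The amount by which the correction \<open>kap x\<close> lowers the multiple of
  \<open>R\<close> removed when \<open>B\<close> acts on \<Xi> x.\<close>

definition gam :: "complex vec \<Rightarrow> complex" where "gam x = coeff (pCons 0 (kap x)) d"

text \<open>Both commutation relations come from one identity whose left side vanishes at infinity
  while its right side does not depend on \<open>n\<close>.\<close>

lemma commutation:
  assumes x: "x \<in> carrier_vec N"
  shows "B *\<^sub>v (\<Xi> *\<^sub>v x) - \<Xi> *\<^sub>v (B *\<^sub>v x) - B *\<^sub>v x - gam x \<cdot>\<^sub>v u = 0\<^sub>v N"
    and "pCons 0 (kap x) - kap (B *\<^sub>v x) = smult (gam x) \<theta>"
proof -
  have Bx: "B *\<^sub>v x \<in> carrier_vec N" and Xx: "\<Xi> *\<^sub>v x \<in> carrier_vec N"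
    using B Xi x by auto
  have BXx: "B *\<^sub>v (\<Xi> *\<^sub>v x) \<in> carrier_vec N" and XBx: "\<Xi> *\<^sub>v (B *\<^sub>v x) \<in> carrier_vec N"
    using B Xi Bx Xx by auto
  let ?y = "B *\<^sub>v (\<Xi> *\<^sub>v x) - \<Xi> *\<^sub>v (B *\<^sub>v x) - B *\<^sub>v x - gam x \<cdot>\<^sub>v u"
  have y: "?y \<in> carrier_vec N" using BXx XBx Bx u by auto
  define t h where "t = TP (phi x)" and "h = coeff t d"
  have 1: "phi (\<Xi> *\<^sub>v x) = smult nK (phi x) - cP (kap x)"
    using phi_Xi[OF x] by (simp add: kap_def)
  \<comment> \<open>Since T n = (n + 1) T, the shift adds one more copy of t, which accounts for the
    summand \<open>B *\<^sub>v x\<close> in the claim.\<close>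
  have T: "TP (phi (\<Xi> *\<^sub>v x)) = smult (nK + 1) t - cP (pCons 0 (kap x))"
    unfolding 1 by (simp add: TP_diff TP_smult TP_cP t_def)
  have hT: "coeff (TP (phi (\<Xi> *\<^sub>v x))) d = (nK + 1) * h - cK (gam x)"
    unfolding T by (simp add: h_def gam_def coeff_map_poly)
  have "phi ?y = phi (B *\<^sub>v (\<Xi> *\<^sub>v x)) - phi (\<Xi> *\<^sub>v (B *\<^sub>v x)) - phi (B *\<^sub>v x) - smult (cK (gam x)) (phi u)"
    using BXx XBx Bx u by (simp add: phi_diff phi_smult)
  also have "\<dots> = smult (nK + 1) t - cP (pCons 0 (kap x)) - smult ((nK + 1) * h - cK (gam x)) R
     - (smult nK (t - smult h R) - cP (kap (B *\<^sub>v x))) - (t - smult h R) - smult (cK (gam x)) (R - cP \<theta>)"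
    unfolding phi_B[OF Xx] phi_Xi[OF Bx] phi_B[OF x] phi_u hT kap_def[symmetric]
    unfolding T t_def[symmetric] h_def[symmetric] ..
  also have "\<dots> = cP (kap (B *\<^sub>v x) - pCons 0 (kap x) + smult (gam x) \<theta>)"
    by (simp add: cP_hom.hom_add cP_hom.hom_minus cK_hom.map_poly_hom_smult smult_diff_right
        smult_add_left smult_diff_left algebra_simps del: map_poly_pCons)
  finally have eq: "phi ?y = cP (kap (B *\<^sub>v x) - pCons 0 (kap x) + smult (gam x) \<theta>)" .
  have "coeff (kap (B *\<^sub>v x) - pCons 0 (kap x) + smult (gam x) \<theta>) k = 0" for k
  proof -
    have "tends (coeff (phi ?y) k) 0" using phi_V[of ?y] unfolding V_def by blast
    then show ?thesis unfolding eq by (simp add: coeff_map_poly del: map_poly_pCons)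
  qed
  then have 0: "kap (B *\<^sub>v x) - pCons 0 (kap x) + smult (gam x) \<theta> = 0" by (intro poly_eqI) simp
  then show "pCons 0 (kap x) - kap (B *\<^sub>v x) = smult (gam x) \<theta>" by (simp add: algebra_simps)
  show "?y = 0\<^sub>v N" using eq unfolding 0 by (intro phi_inj[OF y]) simp
qed

lemma kap_mat:
  assumes D: "D \<in> carrier_mat N N" and y: "y \<in> carrier_vec N"
  shows "kap (D *\<^sub>v y) = (\<Sum>i<N. smult (y $ i) (kap (col D i)))"
proof -
  have "kap (D *\<^sub>v y) = (\<Sum>k<N. \<Sum>i<N. smult (y $ i) (smult (D $$ (k,i)) (c k)))"
    unfolding kap_def using D y
    by (intro sum.cong) (auto simp: scalar_prod_def lessThan_atLeast0 smult_sum mult.commute)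
  also have "\<dots> = (\<Sum>i<N. smult (y $ i) (kap (col D i)))"
    using D by (subst sum.swap) (simp add: kap_def smult_sum2)
  finally show ?thesis .
qed

text \<open>Let G be the row of basis functions, so that G x represents \<open>phi x\<close>.
  Multiplication by A(n) leaves -\<open>kap\<close> on the columns of D, free of n; multiplication
  by w - B then leaves \<theta>(w) L, by the second commutation relation. Solving for G and applying
  it to u gives R - \<theta> = \<theta> L (w - B)^(-1) A(n)^(-1) u, which is the wave function. The
  first relation provides the rank condition.\<close>

lemma cm_representation:
  obtains X Z where "X \<in> carrier_mat N N" "Z \<in> carrier_mat N N" "det (1\<^sub>m N + Z) \<noteq> 0"
    "N = 0 \<or> vec_space.rank N (X * Z - Z * X + 1\<^sub>m N) = 1"
    "io R / io (cP \<theta>) = psi_rep X Z"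
proof -
  obtain D where D: "D \<in> carrier_mat N N" "B * D = 1\<^sub>m N" "D * B = 1\<^sub>m N"
    by (rule nonzero_det_inverse[OF B det_B])
  define X where "X = \<Xi> * D"
  define Z where "Z = B - 1\<^sub>m N"
  define U where "U = mat N 1 (\<lambda>(i,j). u $ i)"
  \<comment> \<open>The row for which the first commutation relation, applied to the columns of D =
    B^(-1), becomes [X, B] + 1 = U L.\<close>
  define L where "L = mat 1 N (\<lambda>(i,j). - gam (col D j))"
  have X: "X \<in> carrier_mat N N" using mult_carrier_mat[OF Xi D(1)] by (simp add: X_def)
  have Z: "Z \<in> carrier_mat N N" unfolding Z_def by (rule minus_carrier_mat) simp
  have U: "U \<in> carrier_mat N 1" and L: "L \<in> carrier_mat 1 N" by (simp_all add: U_def L_def)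
  have BZ: "1\<^sub>m N + Z = B" unfolding Z_def using B by (intro eq_matI) auto
  have colD: "col D j \<in> carrier_vec N" if "j < N" for j using D that by auto
  have BcolD: "B *\<^sub>v col D j = unit_vec N j" if "j < N" for j
    using col_mult2[OF B D(1) that] D(2) that by simp
  have comm: "X * Z - Z * X + 1\<^sub>m N = U * L"
  proof -
    have XB: "X * B = \<Xi>" using assoc_mult_mat[OF Xi D(1) B] D(3) right_mult_one_mat[OF Xi] by (simp add: X_def)
    have "X * Z - Z * X = X * B - B * X"
    proof -
      have "X * Z = X * B - X" unfolding Z_def
        using mult_minus_distrib_mat[OF X B one_carrier_mat] right_mult_one_mat[OF X] by simp
      moreover have "Z * X = B * X - X" unfolding Z_def
        using minus_mult_distrib_mat[OF B one_carrier_mat X] left_mult_one_mat[OF X] by simp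
      ultimately show ?thesis
        using minus_minus_cancel_mat[OF mult_carrier_mat[OF X B] mult_carrier_mat[OF B X] X] by simp
    qed
    also have "X * B - B * X + 1\<^sub>m N = U * L"
    proof (rule eq_matI)
      fix i j assume "i < dim_row (U * L)" "j < dim_col (U * L)"
      then have ij: "i < N" "j < N" by (simp_all add: U_def L_def)
      have "(B *\<^sub>v (\<Xi> *\<^sub>v col D j)) $ i = (B * X) $$ (i,j)"
      proof -
        have "\<Xi> *\<^sub>v col D j = col X j" unfolding X_def by (rule col_mult2[OF Xi D(1) ij(2), symmetric])
        moreover have "B *\<^sub>v col X j = col (B * X) j" by (rule col_mult2[OF B X ij(2), symmetric])
        ultimately show ?thesis using ij B X by simp
      qed
      moreover have "(\<Xi> *\<^sub>v (B *\<^sub>v col D j)) $ i = \<Xi> $$ (i,j)"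
        unfolding BcolD[OF ij(2)] using ij Xi by (simp add: scalar_prod_right_unit)
      moreover have "(B *\<^sub>v (\<Xi> *\<^sub>v col D j) - \<Xi> *\<^sub>v (B *\<^sub>v col D j) - B *\<^sub>v col D j - gam (col D j) \<cdot>\<^sub>v u) $ i = 0"
        unfolding commutation(1)[OF colD[OF ij(2)]] using ij by simp
      ultimately have "(B * X) $$ (i,j) - \<Xi> $$ (i,j) - unit_vec N j $ i - gam (col D j) * u $ i = 0"
        using ij B Xi D u unfolding BcolD[OF ij(2)] by (simp del: index_mult_mat(1) index_mult_mat_vec)
      then show "(X * B - B * X + 1\<^sub>m N) $$ (i,j) = (U * L) $$ (i,j)"
        unfolding XB using ij Xi B X
        by (simp add: U_def L_def scalar_prod_def One_nat_def algebra_simps)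
    qed (use X B in \<open>auto simp: U_def L_def\<close>)
    finally show ?thesis .
  qed
  define h where "h = map_mat cF"
  define A where "A = h X - nF \<cdot>\<^sub>m h D"
  define W where "W = wF \<cdot>\<^sub>m 1\<^sub>m N - h B"
  define G where "G = mat 1 N (\<lambda>(i,j). io (b j))"
  have G: "G \<in> carrier_mat 1 N" by (simp add: G_def)
  obtain AK where AK: "AK \<in> carrier_mat N N" "(map_mat cK X - nK \<cdot>\<^sub>m map_mat cK D) * AK = 1\<^sub>m N"
    by (rule exists_A_inverse[OF X D(1) B D(3)])
  define A' where "A' = map_mat embK AK"
  have A': "A' \<in> carrier_mat N N" using AK by (simp add: A'_def)
  have A_emb: "A = map_mat embK (map_mat cK X - nK \<cdot>\<^sub>m map_mat cK D)"
    unfolding A_def h_def using X D by (intro eq_matI) (auto simp: embK_hom.hom_minus embK_hom.hom_mult)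
  have AKc: "map_mat cK X - nK \<cdot>\<^sub>m map_mat cK D \<in> carrier_mat N N" using X D by auto
  have A: "A \<in> carrier_mat N N" using AKc by (simp add: A_emb)
  have AA': "A * A' = 1\<^sub>m N"
    unfolding A_emb A'_def using embK_hom.mat_hom_mult[OF AKc AK(1)] AK(2) by (simp add: embK_hom.mat_hom_one)
  obtain W' where W': "W' \<in> carrier_mat N N" "W * W' = 1\<^sub>m N"
    unfolding W_def h_def by (rule exists_W_inverse[OF B])
  have hB: "h B \<in> carrier_mat N N" using B by (simp add: h_def)
  have W: "W \<in> carrier_mat N N" unfolding W_def by (rule minus_carrier_mat[OF hB])
  have psi: "psi_rep X Z = 1 + (h L * W' * A' * h U) $$ (0,0)"
    unfolding h_def
    by (rule psi_rep_eq[OF X Z U L D(1) _ comm A_def[unfolded h_def] A' AA' W'(1)])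
      (use D W' in \<open>simp_all add: BZ W_def h_def\<close>)
  have GM: "(G * h M) $$ (0,j) = io (phi (col M j))" if "M \<in> carrier_mat N K" "j < K" for M j K
    using that G by (simp add: G_def h_def scalar_prod_def phi_def lessThan_atLeast0 io_hom.hom_sum io_smult mult.commute)
  \<comment> \<open>X = \<Xi> D, so column j compares \<open>phi\<close> of \<Xi> D_j with n times
    \<open>phi\<close> of D_j; they differ exactly by the limit \<open>kap\<close>.\<close>
  have GA: "(G * A) $$ (0,j) = - io (cP (kap (col D j)))" if j: "j < N" for j
  proof -
    have "G * A = G * h X - nF \<cdot>\<^sub>m (G * h D)"
      unfolding A_def using mult_minus_distrib_mat[OF G, of "h X" N "nF \<cdot>\<^sub>m h D"] mult_smult_distrib[OF G, of "h D" N nF] X D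
      by (simp add: h_def)
    then have "(G * A) $$ (0,j) = (G * h X) $$ (0,j) - nF * (G * h D) $$ (0,j)"
      using G X D j by (simp add: h_def del: index_mult_mat(1))
    also have "\<dots> = io (phi (\<Xi> *\<^sub>v col D j)) - nF * io (phi (col D j))"
    proof -
      have "col X j = \<Xi> *\<^sub>v col D j" unfolding X_def by (rule col_mult2[OF Xi D(1) j])
      then show ?thesis using GM[OF X j] GM[OF D(1) j] by simp
    qed
    also have "\<dots> = - io (cP (kap (col D j)))"
      unfolding phi_Xi[OF colD[OF j]] kap_def[symmetric]
      by (simp add: io_hom.hom_minus io_smult)
    finally show ?thesis .
  qed
  define t where "t = io (cP \<theta>)"
  have GAc: "G * A \<in> carrier_mat 1 N" using G A by (rule mult_carrier_mat)
  have w_io: "wF * io (cP p) = io (cP (pCons 0 p))" for p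
    by (simp add: io_def cK_hom.map_poly_pCons_hom embK_hom.map_poly_pCons_hom)
  have GAW: "G * A * W = t \<cdot>\<^sub>m h L"
  proof (rule eq_matI)
    fix i j assume "i < dim_row (t \<cdot>\<^sub>m h L)" "j < dim_col (t \<cdot>\<^sub>m h L)"
    then have i: "i = 0" and j: "j < N" using L by (auto simp: h_def)
    have "G * A * W = wF \<cdot>\<^sub>m (G * A) - G * A * h B"
      unfolding W_def using mult_minus_distrib_mat[OF GAc _ hB, of "wF \<cdot>\<^sub>m 1\<^sub>m N"]
        mult_smult_distrib[OF GAc one_carrier_mat, of wF] right_mult_one_mat[OF GAc] by simp
    then have "(G * A * W) $$ (0,j) = wF * (G * A) $$ (0,j) - (G * A * h B) $$ (0,j)"
      using GAc mult_carrier_mat[OF GAc hB] j by (simp del: index_mult_mat)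
    also have "(G * A * h B) $$ (0,j) = (\<Sum>k<N. (G * A) $$ (0,k) * cF (B $$ (k,j)))"
      unfolding index_row_mult[OF GAc hB j] using B j by (intro sum.cong) (simp_all add: h_def)
    also have "\<dots> = - io (cP (\<Sum>k<N. smult (B $$ (k,j)) (kap (col D k))))"
      by (simp add: GA cP_hom.hom_sum io_hom.hom_sum cK_hom.map_poly_hom_smult io_smult sum_negf mult.commute
         del: index_mult_mat(1))
    also have "(\<Sum>k<N. smult (B $$ (k,j)) (kap (col D k))) = kap (D *\<^sub>v col B j)"
      using B j by (subst kap_mat[OF D(1)]) auto
    \<comment> \<open>Both sides are a unit vector; the right-hand form matches the second
      commutation relation.\<close>
    also have "D *\<^sub>v col B j = B *\<^sub>v col D j"
      unfolding BcolD[OF j] using col_mult2[OF D(1) B j] D(3) j by simp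
    finally have "(G * A * W) $$ (0,j) = - io (cP (pCons 0 (kap (col D j)) - kap (B *\<^sub>v col D j)))"
      by (simp add: GA[OF j] w_io cP_hom.hom_minus io_hom.hom_minus del: index_mult_mat(1) map_poly_pCons)
    also have "\<dots> = t * cF (- gam (col D j))"
      unfolding commutation(2)[OF colD[OF j]]
      by (simp add: cK_hom.map_poly_hom_smult io_smult t_def cF_hom.hom_uminus)
    finally show "(G * A * W) $$ (i,j) = (t \<cdot>\<^sub>m h L) $$ (i,j)"
      unfolding i using j by (simp add: h_def L_def del: index_mult_mat(1))
  qed (use GAc W L in \<open>auto simp: h_def\<close>)
  have hL: "h L \<in> carrier_mat 1 N" and hU: "h U \<in> carrier_mat N 1" using L U by (simp_all add: h_def)
  have LW: "h L * W' \<in> carrier_mat 1 N" by (rule mult_carrier_mat[OF hL W'(1)])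
  have LWA: "h L * W' * A' \<in> carrier_mat 1 N" by (rule mult_carrier_mat[OF LW A'])
  have "G * A = G * A * W * W'"
    using assoc_mult_mat[OF GAc W W'(1)] W'(2) right_mult_one_mat[OF GAc] by simp
  also have "\<dots> = t \<cdot>\<^sub>m (h L * W')" unfolding GAW by (rule mult_smult_assoc_mat[OF hL W'(1)])
  finally have GA2: "G * A = t \<cdot>\<^sub>m (h L * W')" .
  have "G = G * A * A'"
    using assoc_mult_mat[OF G A A'] AA' right_mult_one_mat[OF G] by simp
  also have "\<dots> = t \<cdot>\<^sub>m (h L * W' * A')" unfolding GA2 by (rule mult_smult_assoc_mat[OF LW A'])
  finally have "G * h U = t \<cdot>\<^sub>m (h L * W' * A' * h U)"
    using mult_smult_assoc_mat[OF LWA hU, of t] by simp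
  then have "(G * h U) $$ (0,0) = t * (h L * W' * A' * h U) $$ (0,0)"
    using index_smult_11[OF mult_carrier_mat[OF LWA hU]] by simp
  moreover have "(G * h U) $$ (0,0) = io R - t"
  proof -
    have "col U 0 = u" using u by (intro eq_vecI) (auto simp: U_def)
    then show ?thesis using GM[OF U, of 0] by (simp add: phi_u t_def io_hom.hom_minus)
  qed
  moreover have t0: "t \<noteq> 0" using theta_monic(1) by (auto simp: t_def)
  ultimately have "io R / t = psi_rep X Z"
    unfolding psi by (simp add: field_simps del: index_mult_mat(1))
  moreover have "N = 0 \<or> vec_space.rank N (X * Z - Z * X + 1\<^sub>m N) = 1"
    using rank_one_or_empty_iff[OF X Z] comm U L by blast
  ultimately show ?thesis using that[OF X Z] det_B by (simp add: BZ t_def)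
qed

end

lemma (in darboux_data) exists_cm_pair:
  obtains N X Z where "X \<in> carrier_mat N N" "Z \<in> carrier_mat N N" "det (1\<^sub>m N + Z) \<noteq> 0"
    "N = 0 \<or> vec_space.rank N (X * Z - Z * X + 1\<^sub>m N) = 1"
    "io R / io (cP \<theta>) = psi_rep X Z"
proof -
  obtain N :: nat and b where b: "\<And>i. i < N \<Longrightarrow> b i \<in> V"
    "\<And>g. g \<in> V \<Longrightarrow> \<exists>x. g = (\<Sum>i<N. smult (cK (x i)) (b i))"
    "\<And>x. (\<Sum>i<N. smult (cK (x i)) (b i)) = 0 \<Longrightarrow> (\<forall>i<N. x i = 0)"
    by (rule V_basis) blast
  interpret darboux_basis R S q \<theta> N b
    by unfold_locales (use b in auto)
  obtain B where B: "B \<in> carrier_mat N N"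
    "\<And>x. x \<in> carrier_vec N \<Longrightarrow> phi (B *\<^sub>v x) = TP (phi x) - smult (coeff (TP (phi x)) d) R"
    "det B \<noteq> 0" by (rule shift_matrix) blast
  obtain \<Xi> c where Xi: "\<Xi> \<in> carrier_mat N N"
    "\<And>x. x \<in> carrier_vec N \<Longrightarrow> phi (\<Xi> *\<^sub>v x) = smult nK (phi x) - cP (\<Sum>j<N. smult (x $ j) (c j))"
    by (rule mult_n_matrix) blast
  obtain u where u: "u \<in> carrier_vec N" "phi u = R - cP \<theta>" by (rule phi_surj[OF V_generator])
  interpret darboux_matrices R S q \<theta> N b B \<Xi> c u
    by unfold_locales (use B Xi u in auto)
  show ?thesis by (rule cm_representation[OF that])
qed

section \<open>Splitting off a power of w\<close>

lemma monom_factor: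
  fixes p :: "'a::comm_ring_1 poly"
  assumes "p \<noteq> 0"
  obtains j p' where "p = monom 1 j * p'" "coeff p' 0 \<noteq> 0"
proof -
  have "\<exists>j p'. p = monom 1 j * p' \<and> coeff p' 0 \<noteq> 0"
    using assms
  proof (induction p)
    case (pCons a p)
    show ?case
    proof (cases "a = 0")
      case True
      then have "p \<noteq> 0" using pCons.prems by auto
      then obtain j p' where "p = monom 1 j * p'" "coeff p' 0 \<noteq> 0" using pCons.IH by blast
      then show ?thesis using True
        by (intro exI[of _ "Suc j"] exI[of _ p']) (simp add: monom_Suc)
    next
      case False
      then show ?thesis by (intro exI[of _ 0] exI[of _ "pCons a p"]) simp
    qed
  qed simp
  then show ?thesis using that by blast
qed

text \<open>w is free of n, so multiplication by w^j commutes with \<open>T\<close>; the injective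
  \<open>io\<close> carries this to K[w].\<close>

lemma TP_monom_mult: "TP (monom 1 j * G) = monom 1 j * TP G"
proof -
  have "io (TP (monom 1 j * G)) = io (monom 1 j * TP G)"
    unfolding T_op_io[symmetric] io_hom.hom_mult
    by (simp add: T_op_def shiftF_hom.hom_mult io_monom shiftF_hom.hom_power)
  then show ?thesis by (simp add: io_hom.eq_iff)
qed

lemma opP_monom_mult: "opP S (monom 1 j * G) = monom 1 j * opP S G"
proof -
  have "(TP ^^ k) (monom 1 j * G) = monom 1 j * (TP ^^ k) G" for k
    by (induction k) (simp_all add: TP_monom_mult)
  then show ?thesis by (simp add: opP_def sum_distrib_left)
qed

text \<open>Clearing \<theta>0 shows that S sends R to the constant-coefficient polynomial \<nu>
  \<theta>0. With R = w^j R', the factor R' satisfies the conditions of \<open>darboux_data\<close>,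
  and f = (w^j \<theta>/\<theta>0) (R'/\<theta>), where \<theta> is the limit of R' and has the same
  degree.\<close>

lemma cm_pair_of_poly_DDT:
  assumes "poly_DDT f"
  obtains \<theta>1 \<theta>2 N X Z where "lead_coeff \<theta>1 = 1" "lead_coeff \<theta>2 = 1" "degree \<theta>1 = degree \<theta>2"
    "X \<in> carrier_mat N N" "Z \<in> carrier_mat N N"
    "N = 0 \<or> vec_space.rank N (X * Z - Z * X + 1\<^sub>m N) = 1" "det (1\<^sub>m N + Z) \<noteq> 0"
    "f = evalF \<theta>1 zF / evalF \<theta>2 zF * psi_rep X Z"
proof -
  obtain R S \<theta>0 \<nu> where *: "lead_coeff R = 1" "lead_coeff S = 1" "lead_coeff \<theta>0 = 1" "lead_coeff \<nu> = 1"
    "degree R = degree \<theta>0" "f = io R / io (cP \<theta>0)" "lop T_op S f = io (cP \<nu>)"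
    using assms unfolding poly_DDT_iff by blast
  have nz: "R \<noteq> 0" "\<theta>0 \<noteq> 0" "\<nu> \<noteq> 0" using * by auto
  have "io (opP S R) / io (cP \<theta>0) = io (cP \<nu>)"
    using *(7) unfolding *(6) by (simp add: lop_T_io)
  then have "io (opP S R) = io (cP (\<nu> * \<theta>0))"
    using nz by (simp add: field_simps cP_hom.hom_mult io_hom.hom_mult)
  then have SR: "opP S R = cP (\<nu> * \<theta>0)" by (simp add: io_hom.eq_iff)
  obtain j R' where R': "R = monom 1 j * R'" "coeff R' 0 \<noteq> 0" by (rule monom_factor[OF nz(1)])
  have "\<nu> * \<theta>0 \<noteq> 0" using nz by simp
  then obtain i p where p: "\<nu> * \<theta>0 = monom 1 i * p" "coeff p 0 \<noteq> 0" by (rule monom_factor)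
  have eq: "monom 1 j * opP S R' = monom 1 i * cP p"
    using SR unfolding R'(1) opP_monom_mult p(1) cP_hom.hom_mult by simp
  \<comment> \<open>If i < j, the coefficient of w^i vanishes on the left of \<open>eq\<close> but
    equals p(0) on the right. Thus the whole factor w^j can be cancelled.\<close>
  have "j \<le> i"
  proof (rule ccontr)
    assume "\<not> j \<le> i"
    then have "coeff (monom 1 j * opP S R') i = 0" by (simp add: coeff_monom_mult)
    then show False unfolding eq using p(2) by (simp add: coeff_monom_mult coeff_map_poly)
  qed
  define q where "q = monom 1 (i - j) * p"
  have "monom 1 j * opP S R' = monom 1 j * cP q"
    using \<open>j \<le> i\<close> unfolding eq q_def by (simp add: cP_hom.hom_mult mult_monom flip: mult.assoc)
  then have SR': "opP S R' = cP q" by simp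
  have mon: "lead_coeff R' = 1" using *(1) unfolding R'(1) by (simp add: lead_coeff_mult degree_monom_eq)
  have qmon: "lead_coeff q = 1"
  proof -
    have "lead_coeff (\<nu> * \<theta>0) = 1" using * by (simp add: lead_coeff_mult)
    then show ?thesis unfolding p(1) q_def by (simp add: lead_coeff_mult degree_monom_eq)
  qed
  then have "q \<noteq> 0" by auto
  then obtain \<theta> where \<theta>: "ptends R' \<theta>"
    using monic_right_divisor_has_limit[OF mon *(2) SR'] by blast
  interpret darboux_data R' S q \<theta>
    by unfold_locales (fact mon qmon SR' \<theta> R'(2))+
  obtain N X Z where XZ: "X \<in> carrier_mat N N" "Z \<in> carrier_mat N N" "det (1\<^sub>m N + Z) \<noteq> 0"
    "N = 0 \<or> vec_space.rank N (X * Z - Z * X + 1\<^sub>m N) = 1"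
    "io R' / io (cP \<theta>) = psi_rep X Z"
    by (rule exists_cm_pair)
  \<comment> \<open>The factor w^j returns to the numerator; composition with 1 + X passes from
    polynomials in w to polynomials in z.\<close>
  define \<theta>1 \<theta>2 where "\<theta>1 = pcompose (monom 1 j * \<theta>) [:1, 1:]" and "\<theta>2 = pcompose \<theta>0 [:1, 1:]"
  have th: "\<theta> \<noteq> 0" using theta_monic(1) by auto
  have R'0: "R' \<noteq> 0" using R'(2) by auto
  have m: "lead_coeff (monom 1 j * \<theta>) = 1" using theta_monic(1) by (simp add: lead_coeff_mult degree_monom_eq)
  have ev: "evalF (pcompose p [:1, 1:]) zF = io (cP p)" for p
    by (simp add: evalF_pcompose evalF_wF[symmetric] wF_def)
  have "degree R = j + degree R'" unfolding R'(1) using R'0 by (simp add: degree_mult_eq degree_monom_eq)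
  then have deg: "degree \<theta>1 = degree \<theta>2"
    unfolding \<theta>1_def \<theta>2_def using *(5) th theta_monic(2)
    by (simp add: degree_pcompose degree_mult_eq degree_monom_eq)
  have "f = evalF \<theta>1 zF / evalF \<theta>2 zF * psi_rep X Z"
    unfolding \<theta>1_def \<theta>2_def ev XZ(5)[symmetric] *(6) R'(1) using th
    by (simp add: cP_hom.hom_mult io_hom.hom_mult io_monom)
  then show ?thesis
    using that[of \<theta>1 \<theta>2 X N Z] monic_pcompose(1)[OF m] monic_pcompose(1)[OF *(3)] deg XZ
    by (simp add: \<theta>1_def \<theta>2_def)
qed

theorem theorem4p3:
  fixes f :: ratF
  shows "poly_DDT f \<longleftrightarrow>
    (\<exists>(\<theta>1 :: complex poly) (\<theta>2 :: complex poly) (N :: nat) (X :: complex mat) (Z :: complex mat).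
       lead_coeff \<theta>1 = 1 \<and> lead_coeff \<theta>2 = 1 \<and> degree \<theta>1 = degree \<theta>2 \<and>
       X \<in> carrier_mat N N \<and> Z \<in> carrier_mat N N \<and>
       (N = 0 \<or> vec_space.rank N (X * Z - Z * X + 1\<^sub>m N) = 1) \<and>
       det (1\<^sub>m N + Z) \<noteq> 0 \<and>
       f = evalF \<theta>1 zF / evalF \<theta>2 zF * psi_rep X Z)"
proof
  assume "poly_DDT f"
  then show "\<exists>\<theta>1 \<theta>2 N X Z. lead_coeff \<theta>1 = 1 \<and> lead_coeff \<theta>2 = 1 \<and> degree \<theta>1 = degree \<theta>2 \<and>
       X \<in> carrier_mat N N \<and> Z \<in> carrier_mat N N \<and>
       (N = 0 \<or> vec_space.rank N (X * Z - Z * X + 1\<^sub>m N) = 1) \<and>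
       det (1\<^sub>m N + Z) \<noteq> 0 \<and> f = evalF \<theta>1 zF / evalF \<theta>2 zF * psi_rep X Z"
    by (rule cm_pair_of_poly_DDT) blast
qed (use poly_DDT_of_cm_pair in blast)

end
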